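(* Let $k$ be an algebraically closed field, let $R=k[x,y,z]$, and let $J\subset R$ be a homogeneous ideal such that $R/J$ has a minimal graded free resolution of the form $$0\rightarrow R(-6)^2\rightarrow R(-4)^3\rightarrow R,$$ and such that $J$ has analytic spread $3$. If $R/J^2$ is also Cohen--Macaulay, then the (three quartic) generators of $J$ define a Cremona map of $\mathbb P^2$ of degree $4$.
   Context: $R$ is standard graded. The analytic spread of $J$ is the Krull dimension of $\mathcal R(J)/(x,y,z)\mathcal R(J)$, where $\mathcal R(J)$ is the Rees algebra of $J$. A Cremona map of $\mathbb P^2$ is a birational map $\mathbb P^2\dashrightarrow\mathbb P^2$; it has degree $d$ if it is given by three forms of degree $d$ without nontrivial common factor. *)

theory Defs
  imports
    "HOL-Algebra.QuotRing"
    "HOL-Algebra.Ideal_Product"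
    "HOL-Algebra.Ring_Divisibility"
    "HOL-Algebra.Algebraic_Closure_Type"
    "HOL-Library.Extended_Nat"
    "HOL-Library.Numeral_Type"
    "HOL-Library.Poly_Mapping"
    "Jordan_Normal_Form.Matrix"
begin

section \<open>Commutative algebra of carrier-based rings\<close>

text \<open>The dimension of the zero ring is 0 here.\<close>

definition krull_dim :: "('a, 'b) ring_scheme \<Rightarrow> enat" where
  "krull_dim A = Sup {enat n | n.
     \<exists>P :: nat \<Rightarrow> 'a set. (\<forall>i\<le>n. primeideal (P i) A) \<and> (\<forall>i<n. P i \<subset> P (Suc i))}"

definition ideal_power :: "('a, 'b) ring_scheme \<Rightarrow> 'a set \<Rightarrow> nat \<Rightarrow> 'a set" where
  "ideal_power A I n = (ideal_prod A I ^^ n) (carrier A)"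

text \<open>
  The localization of \<open>A\<close> at a prime \<open>P\<close>; a fraction \<open>a/s\<close> is the equivalence class
  of the pair \<open>(a, s)\<close>.
\<close>

definition frac_rel :: "('a, 'b) ring_scheme \<Rightarrow> 'a set \<Rightarrow> (('a \<times> 'a) \<times> ('a \<times> 'a)) set" where
  "frac_rel A P = {((a, s), (b, t)).
     a \<in> carrier A \<and> b \<in> carrier A \<and> s \<in> carrier A - P \<and> t \<in> carrier A - P \<and>
     (\<exists>u \<in> carrier A - P. u \<otimes>\<^bsub>A\<^esub> (a \<otimes>\<^bsub>A\<^esub> t) = u \<otimes>\<^bsub>A\<^esub> (b \<otimes>\<^bsub>A\<^esub> s))}"

definition localization :: "('a, 'b) ring_scheme \<Rightarrow> 'a set \<Rightarrow> ('a \<times> 'a) set ring" where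
  "localization A P = \<lparr>
     carrier = (carrier A \<times> (carrier A - P)) // frac_rel A P,
     monoid.mult = (\<lambda>F G. \<Union>(a, s)\<in>F. \<Union>(b, t)\<in>G. frac_rel A P `` {(a \<otimes>\<^bsub>A\<^esub> b, s \<otimes>\<^bsub>A\<^esub> t)}),
     one = frac_rel A P `` {(\<one>\<^bsub>A\<^esub>, \<one>\<^bsub>A\<^esub>)},
     ring.zero = frac_rel A P `` {(\<zero>\<^bsub>A\<^esub>, \<one>\<^bsub>A\<^esub>)},
     add = (\<lambda>F G. \<Union>(a, s)\<in>F. \<Union>(b, t)\<in>G.
              frac_rel A P `` {(a \<otimes>\<^bsub>A\<^esub> t \<oplus>\<^bsub>A\<^esub> b \<otimes>\<^bsub>A\<^esub> s, s \<otimes>\<^bsub>A\<^esub> t)})\<rparr>"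

definition regular_sequence :: "('a, 'b) ring_scheme \<Rightarrow> 'a list \<Rightarrow> bool" where
  "regular_sequence A xs \<longleftrightarrow>
     set xs \<subseteq> carrier A \<and>
     (\<forall>i<length xs. \<forall>a\<in>carrier A.
        xs ! i \<otimes>\<^bsub>A\<^esub> a \<in> genideal A (set (take i xs)) \<longrightarrow> a \<in> genideal A (set (take i xs))) \<and>
     genideal A (set xs) \<noteq> carrier A"

definition depth :: "('a, 'b) ring_scheme \<Rightarrow> 'a set \<Rightarrow> enat" where
  "depth A M = Sup {enat (length xs) | xs. regular_sequence A xs \<and> set xs \<subseteq> M}"

definition cohen_macaulay_local :: "('a, 'b) ring_scheme \<Rightarrow> bool" where
  "cohen_macaulay_local A \<longleftrightarrow> cring A \<and> noetherian_ring A \<and>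
     (\<exists>M. {I. maximalideal I A} = {M} \<and> depth A M = krull_dim A)"

definition cohen_macaulay :: "('a, 'b) ring_scheme \<Rightarrow> bool" where
  "cohen_macaulay A \<longleftrightarrow> cring A \<and> noetherian_ring A \<and>
     (\<forall>M. maximalideal M A \<longrightarrow> cohen_macaulay_local (localization A M))"


section \<open>Polynomial rings\<close>

text \<open>
  \<open>('v, 'k) mpoly\<close> is the polynomial ring over \<open>'k\<close> in variables indexed by \<open>'v\<close>: finitely
  supported coefficient functions on exponent vectors.  The index type \<open>3\<close> gives \<open>k[x,y,z]\<close>.
\<close>

type_synonym ('v, 'k) mpoly = "('v \<Rightarrow>\<^sub>0 nat) \<Rightarrow>\<^sub>0 'k"

definition Var :: "'v \<Rightarrow> ('v, 'k::comm_ring_1) mpoly" where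
  "Var i = Poly_Mapping.single (Poly_Mapping.single i 1) 1"

abbreviation mpoly_ring :: "('v, 'k::comm_ring_1) mpoly ring" where
  "mpoly_ring \<equiv> ring_of_type_algebra"

definition mon_degree :: "('v::finite \<Rightarrow>\<^sub>0 nat) \<Rightarrow> nat" where
  "mon_degree m = (\<Sum>i\<in>UNIV. Poly_Mapping.lookup m i)"

definition form :: "nat \<Rightarrow> ('v::finite, 'k::comm_ring_1) mpoly \<Rightarrow> bool" where
  "form d p \<longleftrightarrow> (\<forall>m\<in>Poly_Mapping.keys p. mon_degree m = d)"

definition homogeneous_ideal :: "('v::finite, 'k::comm_ring_1) mpoly set \<Rightarrow> bool" where
  "homogeneous_ideal J \<longleftrightarrow>
     (\<exists>S. (\<forall>p\<in>S. \<exists>d. form d p) \<and> J = genideal mpoly_ring S)"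

definition irrelevant_ideal :: "('v, 'k::comm_ring_1) mpoly set" where
  "irrelevant_ideal = genideal mpoly_ring (range Var)"

definition subst :: "('v::finite \<Rightarrow> ('w, 'k::comm_ring_1) mpoly) \<Rightarrow> ('v, 'k) mpoly \<Rightarrow> ('w, 'k) mpoly"
  where "subst g p = (\<Sum>m\<in>Poly_Mapping.keys p.
     Poly_Mapping.single 0 (Poly_Mapping.lookup p m) * (\<Prod>i\<in>UNIV. g i ^ Poly_Mapping.lookup m i))"


section \<open>Graded free resolutions\<close>

text \<open>
  \<open>graded_map as bs M\<close>: the matrix \<open>M\<close> represents a homogeneous map of degree 0 from the direct
  sum of the \<open>R(-b)\<close>, \<open>b\<close> in \<open>bs\<close>, to the direct sum of the \<open>R(-a)\<close>, \<open>a\<close> in \<open>as\<close>.  So the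
  \<open>(i, j)\<close> entry is a form of degree \<open>bs ! j - as ! i\<close>, and zero if that number is negative.
\<close>

definition graded_map :: "nat list \<Rightarrow> nat list \<Rightarrow> ('v::finite, 'k::comm_ring_1) mpoly mat \<Rightarrow> bool" where
  "graded_map as bs M \<longleftrightarrow>
     M \<in> carrier_mat (length as) (length bs) \<and>
     (\<forall>i<length as. \<forall>j<length bs. \<forall>m\<in>Poly_Mapping.keys (M $$ (i, j)).
        mon_degree m + as ! i = bs ! j)"

definition minimal_map :: "('v, 'k::comm_ring_1) mpoly mat \<Rightarrow> bool" where
  "minimal_map M \<longleftrightarrow> elements_mat M \<subseteq> irrelevant_ideal"

definition mat_ker :: "'a::comm_ring_1 mat \<Rightarrow> 'a vec set" where
  "mat_ker M = {v \<in> carrier_vec (dim_col M). M *\<^sub>v v = 0\<^sub>v (dim_row M)}"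

definition mat_im :: "'a::comm_ring_1 mat \<Rightarrow> 'a vec set" where
  "mat_im M = (\<lambda>v. M *\<^sub>v v) ` carrier_vec (dim_col M)"

text \<open>
  \<open>R/J\<close> has a minimal graded free resolution
  \<open>0 \<longrightarrow> (direct sum of the R(-c)) \<longrightarrow> (direct sum of the R(-b)) \<longrightarrow> R\<close> with \<open>b\<close> in \<open>bs\<close>, \<open>c\<close> in \<open>cs\<close>.
  The augmentation \<open>R \<longrightarrow> R/J\<close> is the projection: its kernel \<open>J\<close> is the image of the
  one-row matrix \<open>A\<close>.
\<close>

definition has_minimal_graded_resolution ::
    "('v::finite, 'k::comm_ring_1) mpoly set \<Rightarrow> nat list \<Rightarrow> nat list \<Rightarrow> bool" where
  "has_minimal_graded_resolution J bs cs \<longleftrightarrow> (\<exists>A B.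
     graded_map [0] bs A \<and> graded_map bs cs B \<and>
     minimal_map A \<and> minimal_map B \<and>
     (\<lambda>w. w $ 0) ` mat_im A = J \<and>
     mat_ker A = mat_im B \<and>
     mat_ker B = {0\<^sub>v (length cs)})"


section \<open>Rees algebra and analytic spread\<close>

text \<open>The Rees algebra is the subring of the \<open>p\<close> in \<open>R[t]\<close> whose \<open>t^n\<close>-coefficient lies in \<open>J^n\<close>.\<close>

definition rees_algebra :: "'a::comm_ring_1 set \<Rightarrow> 'a poly ring" where
  "rees_algebra J = ring_of_type_algebra
     \<lparr>carrier := {p. \<forall>n. poly.coeff p n \<in> ideal_power ring_of_type_algebra J n}\<rparr>"

definition analytic_spread :: "('v, 'k::comm_ring_1) mpoly set \<Rightarrow> enat" where
  "analytic_spread J =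
     krull_dim (rees_algebra J Quot genideal (rees_algebra J) (range (\<lambda>i. [:Var i:])))"


section \<open>Cremona maps of the projective plane\<close>

text \<open>
  A rational map \<open>P^2 \<longrightarrow> P^2\<close> is represented by three forms of the same degree, not all zero;
  two triples represent the same map iff they are proportional.
\<close>

definition represents_rational_map :: "(3 \<Rightarrow> (3, 'k::field) mpoly) \<Rightarrow> bool" where
  "represents_rational_map f \<longleftrightarrow> (\<exists>d. \<forall>i. form d (f i)) \<and> (\<exists>i. f i \<noteq> 0)"

definition same_rational_map :: "(3 \<Rightarrow> (3, 'k::field) mpoly) \<Rightarrow> (3 \<Rightarrow> (3, 'k) mpoly) \<Rightarrow> bool" where
  "same_rational_map f g \<longleftrightarrow>
     represents_rational_map f \<and> represents_rational_map g \<and> (\<forall>i j. f i * g j = f j * g i)"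

text \<open>
  The composite "\<open>g\<close> after \<open>f\<close>"; it represents a rational map only if the result is not
  identically zero, which \<open>same_rational_map\<close> requires.  The triple \<open>Var\<close> is the identity map.
\<close>

definition compose_map ::
    "(3 \<Rightarrow> (3, 'k::field) mpoly) \<Rightarrow> (3 \<Rightarrow> (3, 'k) mpoly) \<Rightarrow> 3 \<Rightarrow> (3, 'k) mpoly" where
  "compose_map g f = (\<lambda>i. subst f (g i))"

definition birational :: "(3 \<Rightarrow> (3, 'k::field) mpoly) \<Rightarrow> bool" where
  "birational f \<longleftrightarrow> represents_rational_map f \<and>
     (\<exists>g. represents_rational_map g \<and>
          same_rational_map (compose_map g f) Var \<and> same_rational_map (compose_map f g) Var)"

definition defines_cremona_map :: "nat \<Rightarrow> (3 \<Rightarrow> (3, 'k::field) mpoly) \<Rightarrow> bool" where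
  "defines_cremona_map d f \<longleftrightarrow>
     (\<forall>i. form d (f i)) \<and> (\<forall>h. (\<forall>i. h dvd f i) \<longrightarrow> h dvd 1) \<and> birational f"

end

theory Submission
  imports Defs "Berlekamp_Zassenhaus.Unique_Factorization_Poly"
begin

text \<open>
  Write \<open>R = k[x,y,z]\<close> and \<open>f = (f\<^sub>0, f\<^sub>1, f\<^sub>2)\<close> for the three quartics.  A vector \<open>c\<close> of quadratic forms
  in \<open>T\<^sub>0, T\<^sub>1, T\<^sub>2\<close> with \<open>x c\<^sub>0(f) + y c\<^sub>1(f) + z c\<^sub>2(f) = 0\<close>, that is, an equation of bidegree (1,2) of the
  Rees algebra, says that \<open>c(f)\<close> is orthogonal to \<open>(x,y,z)\<close>.  Two such relations \<open>c, c'\<close> that are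
  not proportional determine the point \<open>(x:y:z)\<close> from \<open>f\<close> as the cross product \<open>c(f) \<times> c'(f)\<close>, so \<open>g = c \<times> c'\<close> is
  an inverse of the rational map \<open>f\<close> (\<open>relations_imp_birational\<close>).  For the composite \<open>f \<circ> g\<close>
  this uses that the \<open>f\<^sub>i\<close> are algebraically independent, which is what analytic spread 3 means
  (\<open>analytic_spread_3_imp_independent\<close>).

  The relations come from the Cohen-Macaulay property of \<open>R/J\<^sup>2\<close>.  By the resolution, \<open>J\<close> is not
  primary to \<open>(x,y,z)\<close> (\<open>some_Var_not_nilpotent\<close>), so the localization of \<open>R/J\<^sup>2\<close> at the origin has
  positive dimension and thus positive depth.  As \<open>k\<close> is infinite, some linear form \<open>l\<close> is then regular modulo \<open>J\<^sup>2\<close>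
  (\<open>cohen_macaulay_quotient_imp_regular_linear_form\<close>).  Modulo \<open>l\<close>, the twelve products of two
  variables with the six \<open>f\<^sub>i f\<^sub>j\<close> lie in the 10-dimensional space of binary forms of degree 9, whence two
  linear relations; they lift to \<open>R\<close> because \<open>l u \<in> J\<^sup>2\<close> implies \<open>u \<in> J\<^sup>2\<close>
  (\<open>two_independent_relations\<close>).  If these relations were proportional over \<open>k(T)\<close>,
  unique factorization would yield a nonzero relation that is linear or constant in the \<open>f\<^sub>i\<close>.  This contradicts that
  the syzygies of \<open>J\<close> are generated by quadrics
  (\<open>independent_relations_not_proportional\<close>).  The resolution also shows that the \<open>f\<^sub>i\<close> have no
  common factor (\<open>common_divisor_is_unit\<close>).

  The dimension theory that enters is the bound on chains of primes in \<open>k[T]\<close> modulo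
  a nonzero polynomial (\<open>no_prime_chain_above_nonzero\<close>).  It is obtained from algebraic
  relations by the elementary argument of Coquand and Lombardi, and the relations by counting monomials.
\<close>

section \<open>Polynomials in several variables\<close>

abbreviation Const :: "'k::comm_ring_1 \<Rightarrow> ('v, 'k) mpoly" where
  "Const \<equiv> Poly_Mapping.single 0"

lemma mpoly_eq_sum_singles:
  "p = (\<Sum>m\<in>Poly_Mapping.keys p. Poly_Mapping.single m (Poly_Mapping.lookup p m))"
  by (rule poly_mapping_eqI)
    (auto simp: lookup_sum lookup_single when_def in_keys_iff sum.delta' if_distrib cong: if_cong)

lemma mpoly_induct [case_names zero single add]:
  assumes "P 0" "\<And>m c. P (Poly_Mapping.single m c)" "\<And>p q. P p \<Longrightarrow> P q \<Longrightarrow> P (p + q)"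
  shows "P (p :: 'a \<Rightarrow>\<^sub>0 'b::comm_monoid_add)"
proof -
  have "P (\<Sum>m\<in>A. Poly_Mapping.single m (Poly_Mapping.lookup p m))" if "finite A" for A
    using that by induction (use assms in auto)
  then show ?thesis
    by (metis finite_keys poly_mapping_eqI mpoly_eq_sum_singles[of p])
qed

text \<open>
  Besides \<^const>\<open>subst\<close>, this covers the maps from \<open>k[x,y,z]\<close> to the iterated univariate polynomial
  ring and to \<open>R[t]\<close>.
\<close>

definition mev :: "('k::comm_ring_1 \<Rightarrow> 'b::comm_ring_1) \<Rightarrow> ('v::finite \<Rightarrow> 'b) \<Rightarrow> ('v, 'k) mpoly \<Rightarrow> 'b"
  where "mev \<phi> g p = (\<Sum>m\<in>Poly_Mapping.keys p.
    \<phi> (Poly_Mapping.lookup p m) * (\<Prod>i\<in>UNIV. g i ^ Poly_Mapping.lookup m i))"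

lemma subst_eq_mev: "subst g = mev Const g"
  by (simp add: subst_def mev_def fun_eq_iff)

lemma comm_ring_hom_Const: "comm_ring_hom (Const :: 'k::comm_ring_1 \<Rightarrow> ('v, 'k) mpoly)"
  by standard (simp_all add: single_add mult_single)

context
  fixes \<phi> :: "'k::comm_ring_1 \<Rightarrow> 'b::comm_ring_1"
  assumes hom: "comm_ring_hom \<phi>"
begin

interpretation \<phi>: comm_ring_hom \<phi> by (rule hom)

lemma mev_superset:
  assumes "finite A" "Poly_Mapping.keys p \<subseteq> A"
  shows "mev \<phi> g p =
    (\<Sum>m\<in>A. \<phi> (Poly_Mapping.lookup p m) * (\<Prod>i\<in>UNIV. g i ^ Poly_Mapping.lookup m i))"
  unfolding mev_def using assms
  by (intro sum.mono_neutral_left) (auto simp: in_keys_iff)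

lemma mev_add: "mev \<phi> g (p + q) = mev \<phi> g p + mev \<phi> g q"
proof -
  let ?A = "Poly_Mapping.keys p \<union> Poly_Mapping.keys q"
  have "mev \<phi> g (p + q) = (\<Sum>m\<in>?A. \<phi> (Poly_Mapping.lookup (p + q) m) *
      (\<Prod>i\<in>UNIV. g i ^ Poly_Mapping.lookup m i))"
    by (rule mev_superset) (auto dest: subsetD[OF keys_add])
  also have "\<dots> = mev \<phi> g p + mev \<phi> g q"
    by (simp add: mev_superset[of ?A p] mev_superset[of ?A q] lookup_add \<phi>.hom_add
        distrib_right sum.distrib)
  finally show ?thesis .
qed

lemma mev_single:
  "mev \<phi> g (Poly_Mapping.single m c) = \<phi> c * (\<Prod>i\<in>UNIV. g i ^ Poly_Mapping.lookup m i)"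
  by (cases "c = 0") (simp_all add: mev_def)

lemma mev_mult: "mev \<phi> g (p * q) = mev \<phi> g p * mev \<phi> g q"
proof (induction p rule: mpoly_induct)
  case zero
  then show ?case by (simp add: mev_def)
next
  case (single m c)
  show ?case
  proof (induction q rule: mpoly_induct)
    case zero
    then show ?case by (simp add: mev_def)
  next
    case (single n d)
    then show ?case
      by (simp add: mult_single mev_single \<phi>.hom_mult lookup_add power_add prod.distrib mult_ac)
  next
    case (add p q)
    then show ?case by (simp add: distrib_left mev_add)
  qed
next
  case (add p q)
  then show ?case by (simp add: distrib_right mev_add)
qed

lemma comm_ring_hom_mev: "comm_ring_hom (mev \<phi> g)"
proof
  show "mev \<phi> g 1 = 1"
    using mev_single[of g 0 1] by simp
qed (simp_all add: mev_add mev_mult mev_def[of _ _ 0])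

lemma mev_Const: "mev \<phi> g (Const c) = \<phi> c"
  by (simp add: mev_single)

lemma mev_Var: "mev \<phi> g (Var i) = g i"
proof -
  have "(\<Prod>j\<in>UNIV. g j ^ Poly_Mapping.lookup (Poly_Mapping.single i 1) j) = (\<Prod>j\<in>UNIV. if j = i then g j else 1)"
    by (intro prod.cong) (auto simp: lookup_single when_def)
  then show ?thesis by (simp add: Var_def mev_single prod.delta)
qed

end

lemma single_eq_Const_times_Vars:
  fixes m :: "'v::finite \<Rightarrow>\<^sub>0 nat" and c :: "'k::comm_ring_1"
  shows "Poly_Mapping.single m c = Const c * (\<Prod>i\<in>UNIV. Var i ^ Poly_Mapping.lookup m i)"
proof -
  have pw: "(Var i :: ('v, 'k) mpoly) ^ n = Poly_Mapping.single (Poly_Mapping.single i n) 1" for i n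
    by (induction n) (simp_all add: Var_def mult_single flip: single_add)
  have "(\<Prod>i\<in>A. Poly_Mapping.single (h i) (1::'k)) = Poly_Mapping.single (\<Sum>i\<in>A. h i) 1"
    if "finite A" for A :: "'v set" and h :: "'v \<Rightarrow> 'v \<Rightarrow>\<^sub>0 nat"
    using that by induction (simp_all add: mult_single)
  moreover have "(\<Sum>i\<in>UNIV. Poly_Mapping.single i (Poly_Mapping.lookup m i)) = m"
    by (rule poly_mapping_eqI)
      (auto simp: lookup_sum lookup_single when_def sum.delta' if_distrib cong: if_cong)
  ultimately show ?thesis by (simp add: pw mult_single)
qed

lemma Const_mult_single_1: "Const c * Poly_Mapping.single m 1 = Poly_Mapping.single m c"
  by (simp only: mult_single add_0_left mult_1_right)

lemma mpoly_hom_eqI: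
  assumes F: "comm_ring_hom F" and G: "comm_ring_hom G"
    and "\<And>c. F (Const c) = G (Const c)" and "\<And>i. F (Var i) = G (Var i)"
  shows "F p = G (p :: ('v::finite, 'k::comm_ring_1) mpoly)"
proof -
  interpret F: comm_ring_hom F by fact
  interpret G: comm_ring_hom G by fact
  show ?thesis
  proof (induction p rule: mpoly_induct)
    case (single m c)
    then show ?case
      unfolding single_eq_Const_times_Vars[of m c]
      by (simp add: F.hom_mult G.hom_mult F.hom_prod G.hom_prod F.hom_power G.hom_power assms)
  qed (simp_all add: F.hom_add G.hom_add)
qed

lemma comm_ring_hom_subst: "comm_ring_hom (subst g)"
  unfolding subst_eq_mev by (rule comm_ring_hom_mev[OF comm_ring_hom_Const])

interpretation subst: comm_ring_hom "subst g" for g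
  by (rule comm_ring_hom_subst)

lemma subst_Const [simp]: "subst g (Const c) = Const c"
  unfolding subst_eq_mev by (rule mev_Const[OF comm_ring_hom_Const])

lemma subst_Var [simp]: "subst g (Var i) = g i"
  unfolding subst_eq_mev by (rule mev_Var[OF comm_ring_hom_Const])

lemma subst_subst: "subst f (subst g p) = subst (\<lambda>i. subst f (g i)) p"
proof -
  have "comm_ring_hom (\<lambda>p. subst f (subst g p))"
    by standard (simp_all add: subst.hom_add subst.hom_mult)
  then show ?thesis
    by (rule mpoly_hom_eqI) (simp_all add: comm_ring_hom_subst)
qed

section \<open>Homogeneous components\<close>

lemma mon_degree_add: "mon_degree (m + n) = mon_degree m + mon_degree n"
  by (simp add: mon_degree_def lookup_add sum.distrib)

lemma mon_degree_0 [simp]: "mon_degree 0 = 0"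
  by (simp add: mon_degree_def)

lemma mon_degree_single [simp]: "mon_degree (Poly_Mapping.single i n) = n"
proof -
  have "mon_degree (Poly_Mapping.single i n) = (\<Sum>j\<in>UNIV. if j = i then n else 0)"
    unfolding mon_degree_def by (intro sum.cong) (auto simp: lookup_single when_def)
  then show ?thesis by simp
qed

lemma mon_degree_eq_0: "mon_degree m = 0 \<longleftrightarrow> m = 0"
  by (auto simp: mon_degree_def intro: poly_mapping_eqI)

lemma form_0 [simp]: "form d 0"
  by (simp add: form_def)

lemma form_add: "form d p \<Longrightarrow> form d q \<Longrightarrow> form d (p + q)"
  unfolding form_def using keys_add[of p q] by blast

lemma form_uminus: "form d (- p) \<longleftrightarrow> form d p"
  by (simp add: form_def in_keys_iff)

lemma form_diff: "form d p \<Longrightarrow> form d q \<Longrightarrow> form d (p - q)"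
  using form_add[of d p "- q"] by (simp add: form_uminus)

lemma form_sum: "(\<And>i. i \<in> A \<Longrightarrow> form d (p i)) \<Longrightarrow> form d (\<Sum>i\<in>A. p i)"
  by (induction A rule: infinite_finite_induct) (auto intro: form_add)

lemma form_mult: "form d p \<Longrightarrow> form e q \<Longrightarrow> form (d + e) (p * q)"
  unfolding form_def using keys_mult[of p q] by (fastforce simp: mon_degree_add)

lemma form_single [simp]: "form (mon_degree m) (Poly_Mapping.single m c)"
  by (simp add: form_def)

lemma form_Const [simp]: "form 0 (Const c)"
  using form_single[of 0 c] by simp

lemma form_1 [simp]: "form 0 1"
  by (simp add: form_def)

lemma form_Const_mult: "form d p \<Longrightarrow> form d (Const c * p)"
  using form_mult[of 0 "Const c" d p] by simp

lemma form_Var [simp]: "form 1 (Var i)" "form (Suc 0) (Var i)"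
  using form_single[of "Poly_Mapping.single i 1" 1] by (simp_all add: Var_def)

lemma form_power: "form d p \<Longrightarrow> form (d * n) (p ^ n)"
  by (induction n) (auto simp: add.commute dest: form_mult)

lemma form_prod: "(\<And>i. i \<in> A \<Longrightarrow> form (d i) (p i)) \<Longrightarrow> finite A \<Longrightarrow> form (\<Sum>i\<in>A. d i) (\<Prod>i\<in>A. p i)"
proof (induction A rule: infinite_finite_induct)
  case (insert x F)
  then show ?case by (auto intro!: form_mult)
qed auto

lemma form_subst:
  assumes "\<And>i. form d (g i)" "form e p"
  shows "form (d * e) (subst g p)"
  unfolding subst_def
proof (intro form_sum form_Const_mult)
  fix m assume "m \<in> Poly_Mapping.keys p"
  then have "d * e = (\<Sum>i\<in>UNIV. d * Poly_Mapping.lookup m i)"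
    using assms(2) by (auto simp: form_def mon_degree_def simp flip: sum_distrib_left)
  then show "form (d * e) (\<Prod>i\<in>UNIV. g i ^ Poly_Mapping.lookup m i)"
    by (auto intro!: form_prod form_power assms(1))
qed

lemma form_0_eq_Const:
  assumes "form 0 p"
  obtains c where "p = Const c"
proof
  show "p = Const (Poly_Mapping.lookup p 0)"
    using assms by (intro poly_mapping_eqI)
      (auto simp: form_def in_keys_iff lookup_single when_def mon_degree_eq_0)
qed

definition hcomp :: "nat \<Rightarrow> ('v::finite, 'k::comm_ring_1) mpoly \<Rightarrow> ('v, 'k) mpoly" where
  "hcomp n p = Abs_poly_mapping (\<lambda>m. if mon_degree m = n then Poly_Mapping.lookup p m else 0)"

lemma lookup_hcomp:
  "Poly_Mapping.lookup (hcomp n p) m = (if mon_degree m = n then Poly_Mapping.lookup p m else 0)"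
proof -
  have "finite {m. (if mon_degree m = n then Poly_Mapping.lookup p m else 0) \<noteq> 0}"
    by (rule finite_subset[OF _ finite_keys[of p]]) (auto simp: in_keys_iff split: if_splits)
  then show ?thesis by (simp add: hcomp_def)
qed

lemma hcomp_add: "hcomp n (p + q) = hcomp n p + hcomp n q"
  by (rule poly_mapping_eqI) (simp add: lookup_hcomp lookup_add)

lemma hcomp_0 [simp]: "hcomp n 0 = 0"
  by (rule poly_mapping_eqI) (simp add: lookup_hcomp)

lemma hcomp_uminus: "hcomp n (- p) = - hcomp n p"
  by (rule poly_mapping_eqI) (simp add: lookup_hcomp)

lemma hcomp_sum: "hcomp n (\<Sum>i\<in>A. p i) = (\<Sum>i\<in>A. hcomp n (p i))"
  by (induction A rule: infinite_finite_induct) (auto simp: hcomp_add)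

lemma form_hcomp [simp]: "form n (hcomp n p)"
  by (auto simp: form_def in_keys_iff lookup_hcomp split: if_splits)

lemma hcomp_form: "form d p \<Longrightarrow> hcomp n p = (if n = d then p else 0)"
  by (rule poly_mapping_eqI) (auto simp: lookup_hcomp form_def in_keys_iff)

lemma mpoly_eq_sum_hcomp:
  assumes "\<And>m. m \<in> Poly_Mapping.keys p \<Longrightarrow> mon_degree m \<le> N"
  shows "p = (\<Sum>n\<le>N. hcomp n p)"
proof (rule poly_mapping_eqI)
  fix m
  show "Poly_Mapping.lookup p m = Poly_Mapping.lookup (\<Sum>n\<le>N. hcomp n p) m"
    using assms[of m] by (auto simp: lookup_sum lookup_hcomp in_keys_iff)
qed

lemma obtain_degree_bound:
  obtains N where "\<And>m. m \<in> Poly_Mapping.keys p \<Longrightarrow> mon_degree m \<le> N"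
proof
  fix m assume "m \<in> Poly_Mapping.keys p"
  then show "mon_degree m \<le> Max (mon_degree ` Poly_Mapping.keys p)" by simp
qed

lemma hcomp_eqI: "(\<And>n. hcomp n p = hcomp n q) \<Longrightarrow> p = q"
  by (rule poly_mapping_eqI) (metis lookup_hcomp)

lemma hcomp_mult_form:
  assumes "form d q"
  shows "hcomp (n + d) (p * q) = hcomp n p * q"
    and "n < d \<Longrightarrow> hcomp n (p * q) = 0"
proof -
  obtain N where N: "\<And>m. m \<in> Poly_Mapping.keys p \<Longrightarrow> mon_degree m \<le> N"
    using obtain_degree_bound by blast
  have *: "hcomp l (p * q) = (\<Sum>k\<le>max N n. if l = k + d then hcomp k p * q else 0)" for l
  proof -
    have "p * q = (\<Sum>k\<le>max N n. hcomp k p * q)"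
      using mpoly_eq_sum_hcomp[of p "max N n"] N by (metis le_max_iff_disj sum_distrib_right)
    then have "hcomp l (p * q) = (\<Sum>k\<le>max N n. hcomp l (hcomp k p * q))"
      by (simp add: hcomp_sum)
    also have "\<dots> = (\<Sum>k\<le>max N n. if l = k + d then hcomp k p * q else 0)"
      by (intro sum.cong refl hcomp_form form_mult assms) simp
    finally show ?thesis .
  qed
  show "hcomp (n + d) (p * q) = hcomp n p * q"
    unfolding * by (simp add: sum.delta)
  show "hcomp n (p * q) = 0" if "n < d"
    unfolding * using that by (intro sum.neutral) auto
qed

section \<open>Linear algebra and counting\<close>

lemma exists_nontrivial_solution:
  fixes a :: "'e \<Rightarrow> 'u \<Rightarrow> 'k::field"
  assumes "finite E" "finite U" "card E < card U"
  obtains v where "\<exists>u\<in>U. v u \<noteq> 0" "\<And>e. e \<in> E \<Longrightarrow> (\<Sum>u\<in>U. a e u * v u) = 0"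
proof -
  have "\<exists>v. (\<exists>u\<in>U. v u \<noteq> 0) \<and> (\<forall>e\<in>E. (\<Sum>u\<in>U. a e u * v u) = 0)"
    using assms
  proof (induction E arbitrary: U a rule: finite_induct)
    case empty
    then have "U \<noteq> {}" by auto
    then show ?case by (auto intro!: exI[of _ "\<lambda>_. 1"])
  next
    case (insert e E)
    show ?case
    proof (cases "\<forall>u\<in>U. a e u = 0")
      case True
      have "card E < card U" using insert by simp
      then obtain v where "\<exists>u\<in>U. v u \<noteq> 0" "\<forall>e\<in>E. (\<Sum>u\<in>U. a e u * v u) = 0"
        using insert.IH[of U a] insert.prems by auto
      then show ?thesis using True by (auto intro!: exI[of _ v])
    next
      case False
      then obtain w where w: "w \<in> U" "a e w \<noteq> 0" by auto
      \<comment> \<open>Solve equation \<open>e\<close> for the unknown \<open>w\<close> and substitute it into the others.\<close>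
      define a' where "a' = (\<lambda>d u. a d u - a d w * a e u / a e w)"
      have "card E < card (U - {w})" using insert w by simp
      then obtain v where v: "\<exists>u\<in>U - {w}. v u \<noteq> 0"
          "\<forall>d\<in>E. (\<Sum>u\<in>U - {w}. a' d u * v u) = 0"
        using insert.IH[of "U - {w}" a'] insert.prems by auto
      define s where "s = (\<Sum>u\<in>U - {w}. a e u * v u)"
      define v' where "v' = v(w := - s / a e w)"
      have split: "(\<Sum>u\<in>U. a d u * v' u) = a d w * (- s / a e w) + (\<Sum>u\<in>U - {w}. a d u * v u)" for d
        using insert.prems w by (subst sum.remove[of U w]) (auto simp: v'_def intro!: sum.cong)
      have "(\<Sum>u\<in>U. a d u * v' u) = 0" if "d \<in> E" for d
      proof -
        have "0 = (\<Sum>u\<in>U - {w}. a' d u * v u)" using v that by auto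
        also have "\<dots> = (\<Sum>u\<in>U - {w}. a d u * v u) - a d w * s / a e w"
          by (simp add: a'_def s_def algebra_simps sum_subtractf sum_distrib_left sum_divide_distrib)
        finally show ?thesis by (simp add: split)
      qed
      moreover have "(\<Sum>u\<in>U. a e u * v' u) = 0"
        using w by (simp add: split s_def)
      moreover have "\<exists>u\<in>U. v' u \<noteq> 0" using v by (auto simp: v'_def)
      ultimately show ?thesis by auto
    qed
  qed
  then show ?thesis using that by blast
qed

lemma lookup_Const_mult: "Poly_Mapping.lookup (Const c * p) m = c * Poly_Mapping.lookup p m"
  by (simp add: Poly_Mapping.map.rep_eq when_def flip: mult_map_scale_conv_mult)

lemma mpoly_eq_0_if_lookup: "(\<And>m. m \<in> E \<Longrightarrow> Poly_Mapping.lookup p m = 0) \<Longrightarrow> Poly_Mapping.keys p \<subseteq> E \<Longrightarrow> p = 0"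
  by (rule poly_mapping_eqI) (auto simp: in_keys_iff)

lemma linearly_dependent_mpolys:
  fixes P :: "'u \<Rightarrow> ('v, 'k::field) mpoly"
  assumes "finite E" "finite U" "card E < card U" "\<And>u. u \<in> U \<Longrightarrow> Poly_Mapping.keys (P u) \<subseteq> E"
  obtains v where "\<exists>u\<in>U. v u \<noteq> 0" "(\<Sum>u\<in>U. Const (v u) * P u) = 0"
proof -
  obtain v where v: "\<exists>u\<in>U. v u \<noteq> 0"
      "\<And>e. e \<in> E \<Longrightarrow> (\<Sum>u\<in>U. Poly_Mapping.lookup (P u) e * v u) = 0"
    using exists_nontrivial_solution[OF assms(1-3), of "\<lambda>e u. Poly_Mapping.lookup (P u) e"] by blast
  have "(\<Sum>u\<in>U. Const (v u) * P u) = 0"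
  proof (rule poly_mapping_eqI)
    fix m
    show "Poly_Mapping.lookup (\<Sum>u\<in>U. Const (v u) * P u) m = Poly_Mapping.lookup 0 m"
    proof (cases "m \<in> E")
      case True
      then show ?thesis using v(2)[OF True] by (simp add: lookup_sum lookup_Const_mult mult.commute[of "v _"])
    next
      case False
      then have "Poly_Mapping.lookup (P u) m = 0" if "u \<in> U" for u
        using assms(4)[OF that] by (auto simp: in_keys_iff)
      then show ?thesis by (simp add: lookup_sum lookup_Const_mult)
    qed
  qed
  then show ?thesis using v that by blast
qed

lemma UNIV_3: "(UNIV :: 3 set) = {0, 1, 2}"
proof -
  have "card {0, 1, 2 :: 3} = card (UNIV :: 3 set)" by simp
  then show ?thesis by (metis card_subset_eq finite subset_UNIV)
qed

lemma exhaust_3: obtains "i = (0::3)" | "i = 1" | "i = 2"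
  using UNIV_3 by (metis UNIV_I insertE singletonD)

lemma sum_3: "(\<Sum>i\<in>(UNIV::3 set). h i) = h 0 + h 1 + (h 2 :: 'a::comm_monoid_add)"
  unfolding UNIV_3 by (simp add: add.assoc)

lemma prod_3: "(\<Prod>i\<in>(UNIV::3 set). h i) = h 0 * h 1 * (h 2 :: 'a::comm_monoid_mult)"
  unfolding UNIV_3 by (simp add: mult.assoc)

lemma monomials_of_degree:
  "finite {m :: 3 \<Rightarrow>\<^sub>0 nat. mon_degree m = n} \<and>
   card {m :: 3 \<Rightarrow>\<^sub>0 nat. mon_degree m = n} = (n + 1) * (n + 2) div 2"
proof -
  define mon :: "nat \<times> nat \<Rightarrow> 3 \<Rightarrow>\<^sub>0 nat" where
    "mon = (\<lambda>(i, j). Poly_Mapping.single 0 i + Poly_Mapping.single 1 j + Poly_Mapping.single 2 (n - i - j))"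
  have l: "Poly_Mapping.lookup (mon (i, j)) 0 = i" "Poly_Mapping.lookup (mon (i, j)) 1 = j"
      "Poly_Mapping.lookup (mon (i, j)) 2 = n - i - j" for i j
    by (simp_all add: mon_def lookup_add lookup_single)
  have bij: "bij_betw mon (SIGMA i:{..n}. {..n - i}) {m. mon_degree m = n}"
    unfolding bij_betw_def
  proof
    show "inj_on mon (SIGMA i:{..n}. {..n - i})"
      by (auto simp: inj_on_def) (metis l)+
    have "m \<in> mon ` (SIGMA i:{..n}. {..n - i})" if "mon_degree m = n" for m
    proof
      show "m = mon (Poly_Mapping.lookup m 0, Poly_Mapping.lookup m 1)"
      proof (rule poly_mapping_eqI)
        fix k
        show "Poly_Mapping.lookup m k = Poly_Mapping.lookup (mon (Poly_Mapping.lookup m 0, Poly_Mapping.lookup m 1)) k"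
          using that by (cases k rule: exhaust_3) (auto simp: l mon_degree_def sum_3)
      qed
      show "(Poly_Mapping.lookup m 0, Poly_Mapping.lookup m 1) \<in> (SIGMA i:{..n}. {..n - i})"
        using that by (auto simp: mon_degree_def sum_3)
    qed
    then show "mon ` (SIGMA i:{..n}. {..n - i}) = {m. mon_degree m = n}"
      by (auto simp: mon_degree_def sum_3 l)
  qed
  have fin: "finite {m :: 3 \<Rightarrow>\<^sub>0 nat. mon_degree m = n}"
    using bij_betw_finite[OF bij] by simp
  have "card {m :: 3 \<Rightarrow>\<^sub>0 nat. mon_degree m = n} = (\<Sum>i\<le>n. Suc (n - i))"
    using bij_betw_same_card[OF bij] by simp
  also have "\<dots> = (\<Sum>i\<le>n. Suc i)"
    by (rule sum.reindex_bij_witness[of _ "\<lambda>i. n - i" "\<lambda>i. n - i"]) auto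
  also have "\<dots> = (n + 1) * (n + 2) div 2"
    by (induction n) auto
  finally show ?thesis using fin by blast
qed

lemmas card_monomials_of_degree = monomials_of_degree[THEN conjunct2]
  and finite_monomials_of_degree = monomials_of_degree[THEN conjunct1]

section \<open>Factorization\<close>

lemma hcomp_mult:
  "hcomp n (p * q) = (\<Sum>j\<le>n. hcomp (n - j) p * hcomp j q)"
proof -
  obtain N where N: "\<And>m. m \<in> Poly_Mapping.keys q \<Longrightarrow> mon_degree m \<le> N"
    using obtain_degree_bound by blast
  have "q = (\<Sum>j\<le>max n N. hcomp j q)"
    by (rule mpoly_eq_sum_hcomp) (meson N max.coboundedI2)
  then have "p * q = (\<Sum>j\<le>max n N. p * hcomp j q)"
    by (metis sum_distrib_left)
  then have "hcomp n (p * q) = (\<Sum>j\<le>max n N. hcomp n (p * hcomp j q))"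
    by (simp add: hcomp_sum)
  also have "\<dots> = (\<Sum>j\<le>max n N. if j \<le> n then hcomp (n - j) p * hcomp j q else 0)"
    by (intro sum.cong refl) (metis form_hcomp hcomp_mult_form le_add_diff_inverse2 not_le)
  also have "\<dots> = (\<Sum>j\<le>n. hcomp (n - j) p * hcomp j q)"
    by (rule sum.mono_neutral_cong_right) auto
  finally show ?thesis .
qed

lemma finite_hcomp_support: "finite {n. hcomp n p \<noteq> 0}"
proof -
  obtain N where N: "\<And>m. m \<in> Poly_Mapping.keys p \<Longrightarrow> mon_degree m \<le> N"
    using obtain_degree_bound by blast
  have "hcomp n p = 0" if "n > N" for n
  proof (rule poly_mapping_eqI)
    fix m
    show "Poly_Mapping.lookup (hcomp n p) m = Poly_Mapping.lookup 0 m"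
      using N[of m] that by (cases "m \<in> Poly_Mapping.keys p") (auto simp: lookup_hcomp in_keys_iff)
  qed
  then have "{n. hcomp n p \<noteq> 0} \<subseteq> {..N}"
    by (metis (mono_tags, lifting) atMost_iff mem_Collect_eq not_le subsetI)
  then show ?thesis by (rule finite_subset) simp
qed

text \<open>
  The lowest components of two polynomials multiply to the lowest component of the product and the
  highest components to the highest one; in a form the two coincide.
\<close>

lemma form_mult_imp_forms:
  fixes p q :: "(3, 'k::field) mpoly"
  assumes "form d (p * q)" "p * q \<noteq> 0"
  obtains a b where "form a p" "form b q" "a + b = d"
proof -
  define P where "P = {n. hcomp n p \<noteq> 0}"
  define Q where "Q = {n. hcomp n q \<noteq> 0}"
  have "p \<noteq> 0" "q \<noteq> 0" using assms(2) by auto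
  then have ne: "P \<noteq> {}" "Q \<noteq> {}"
    unfolding P_def Q_def by (metis (mono_tags, lifting) Collect_empty_eq hcomp_0 hcomp_eqI)+
  have fin: "finite P" "finite Q" by (simp_all add: P_def Q_def finite_hcomp_support)
  have mem: "Min P \<in> P" "Min Q \<in> Q" "Max P \<in> P" "Max Q \<in> Q" using ne fin by auto
  have PI: "Min P \<le> n" "n \<le> Max P" if "hcomp n p \<noteq> 0" for n
    using that fin by (auto simp: P_def)
  have QI: "Min Q \<le> n" "n \<le> Max Q" if "hcomp n q \<noteq> 0" for n
    using that fin by (auto simp: Q_def)
  have d: "a + b = d" if "a \<in> P" "b \<in> Q"
      and *: "\<And>j. j \<le> a + b \<Longrightarrow> j \<noteq> b \<Longrightarrow> hcomp (a + b - j) p = 0 \<or> hcomp j q = 0" for a b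
  proof -
    have "hcomp (a + b) (p * q) = (\<Sum>j\<le>a + b. if j = b then hcomp a p * hcomp b q else 0)"
      unfolding hcomp_mult using * by (intro sum.cong) auto
    also have "\<dots> \<noteq> 0" using that by (simp add: P_def Q_def)
    finally show ?thesis using hcomp_form[OF assms(1), of "a + b"] by (auto split: if_splits)
  qed
  have "Min P + Min Q = d"
    by (rule d[OF mem(1,2)]) (rule ccontr, use PI QI in fastforce)
  moreover have "Max P + Max Q = d"
    by (rule d[OF mem(3,4)]) (rule ccontr, use PI QI in fastforce)
  moreover have "Min P \<le> Max P" "Min Q \<le> Max Q" using fin ne by auto
  ultimately have eq: "Min P = Max P" "Min Q = Max Q" "Max P + Max Q = d" by linarith+
  have "form (Max P) p"
    unfolding form_def using PI eq by (metis lookup_hcomp in_keys_iff lookup_zero order_antisym)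
  moreover have "form (Max Q) q"
    unfolding form_def using QI eq by (metis lookup_hcomp in_keys_iff lookup_zero order_antisym)
  ultimately show ?thesis using eq that by blast
qed

text \<open>
  Unique factorization is transported to \<open>k[x,y,z]\<close> from the iterated univariate polynomial ring.
\<close>

definition to_poly :: "(3, 'k::field) mpoly \<Rightarrow> 'k poly poly poly" where
  "to_poly = mev (\<lambda>c. [:[:[:c:]:]:])
     (\<lambda>i. if i = 0 then [:[:[:0, 1:]:]:] else if i = 1 then [:[:0, 1:]:] else [:0, 1:])"

lemma comm_ring_hom_const3: "comm_ring_hom (\<lambda>c::'k::field. [:[:[:c:]:]:])"
  by standard simp_all

lemma comm_ring_hom_to_poly: "comm_ring_hom to_poly"
  unfolding to_poly_def by (rule comm_ring_hom_mev[OF comm_ring_hom_const3])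

interpretation to_poly: comm_ring_hom to_poly
  by (rule comm_ring_hom_to_poly)

lemma to_poly_single:
  "to_poly (Poly_Mapping.single m c) =
     Polynomial.monom (Polynomial.monom (Polynomial.monom c (Poly_Mapping.lookup m 0))
       (Poly_Mapping.lookup m 1)) (Poly_Mapping.lookup m 2)"
proof -
  have X: "[:0, 1:] ^ n = Polynomial.monom (1::'b::comm_ring_1) n" for n
    by (metis monom_altdef smult_1_left)
  have "to_poly (Poly_Mapping.single m c) = [:[:[:c:]:]:] * ([:[:[:0, 1:]:]:] ^ Poly_Mapping.lookup m 0 *
      [:[:0, 1:]:] ^ Poly_Mapping.lookup m 1 * [:0, 1:] ^ Poly_Mapping.lookup m 2)"
    unfolding to_poly_def mev_single[OF comm_ring_hom_const3] prod_3 by simp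
  also have "\<dots> = [:[:[:c:]:]:] * ([:[:Polynomial.monom 1 (Poly_Mapping.lookup m 0):]:] *
      [:Polynomial.monom 1 (Poly_Mapping.lookup m 1):] * Polynomial.monom 1 (Poly_Mapping.lookup m 2))"
    by (simp only: poly_const_pow X)
  also have "\<dots> = Polynomial.monom (Polynomial.monom (Polynomial.monom c (Poly_Mapping.lookup m 0))
       (Poly_Mapping.lookup m 1)) (Poly_Mapping.lookup m 2)"
    by (simp add: smult_monom)
  finally show ?thesis .
qed

lemma coeff_to_poly:
  "poly.coeff (poly.coeff (poly.coeff (to_poly p) (Poly_Mapping.lookup m 2))
     (Poly_Mapping.lookup m 1)) (Poly_Mapping.lookup m 0) = Poly_Mapping.lookup p m"
proof (induction p rule: mpoly_induct)
  case (single n c)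
  have "m = n \<longleftrightarrow> Poly_Mapping.lookup m 0 = Poly_Mapping.lookup n 0 \<and>
      Poly_Mapping.lookup m 1 = Poly_Mapping.lookup n 1 \<and> Poly_Mapping.lookup m 2 = Poly_Mapping.lookup n 2"
    (is "_ \<longleftrightarrow> ?R")
  proof
    assume R: ?R
    show "m = n"
    proof (rule poly_mapping_eqI)
      fix i
      show "Poly_Mapping.lookup m i = Poly_Mapping.lookup n i"
        using R by (cases i rule: exhaust_3) auto
    qed
  qed simp
  then show ?case
    by (auto simp: to_poly_single lookup_single when_def)
qed (simp_all add: to_poly.hom_add lookup_add)

lemma inj_to_poly: "inj to_poly"
  by (rule injI, rule poly_mapping_eqI) (metis coeff_to_poly)

lemma surj_to_poly: "surj (to_poly :: (3, 'k::field) mpoly \<Rightarrow> _)"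
proof -
  let ?T = "range (to_poly :: (3, 'k) mpoly \<Rightarrow> _)"
  have Const: "[:[:[:c:]:]:] \<in> ?T" for c :: 'k
    by (rule range_eqI[of _ _ "Const c"]) (simp add: to_poly_single monom_0)
  have Var: "to_poly (Var i) = (if i = 0 then [:[:[:0, 1:]:]:] else if i = 1 then [:[:0, 1:]:] else [:0, 1:])" for i
    unfolding to_poly_def by (rule mev_Var[OF comm_ring_hom_const3])
  have V: "[:[:[:0, 1:]:]:] \<in> ?T" "[:[:0, 1:]:] \<in> ?T" "[:0, 1:] \<in> ?T"
    by (rule range_eqI[of _ _ "Var 0"], simp add: Var)
      (rule range_eqI[of _ _ "Var 1"], simp add: Var, rule range_eqI[of _ _ "Var 2"], simp add: Var)
  have add: "a + b \<in> ?T" if "a \<in> ?T" "b \<in> ?T" for a b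
    using that by (auto simp flip: to_poly.hom_add)
  have mult: "a * b \<in> ?T" if "a \<in> ?T" "b \<in> ?T" for a b
    using that by (auto simp flip: to_poly.hom_mult)
  have 1: "[:[:p:]:] \<in> ?T" for p
  proof (induction p)
    case 0
    show ?case using Const[of 0] by simp
  next
    case (pCons a p)
    show ?case using add[OF Const[of a] mult[OF V(1) pCons(2)]] by simp
  qed
  have 2: "[:p:] \<in> ?T" for p
  proof (induction p)
    case 0
    show ?case using Const[of 0] by simp
  next
    case (pCons a p)
    show ?case using add[OF 1[of a] mult[OF V(2) pCons(2)]] by simp
  qed
  have "p \<in> ?T" for p
  proof (induction p)
    case 0
    show ?case using Const[of 0] by simp
  next
    case (pCons a p)
    show ?case using add[OF 2[of a] mult[OF V(3) pCons(2)]] by simp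
  qed
  then show ?thesis by blast
qed

lemma proportional_imp_common_factor_ufd:
  fixes a b :: "'i::finite \<Rightarrow> 'a::ufd"
  assumes "\<And>i j. a i * b j = a j * b i" "\<exists>i. a i \<noteq> 0"
  obtains \<alpha> \<beta> e where "\<And>i. a i = \<alpha> * e i" "\<And>i. b i = \<beta> * e i"
proof -
  obtain xs :: "'i list" where xs: "set xs = UNIV" using finite_list[OF finite[of UNIV]] by auto
  define \<alpha> where "\<alpha> = some_gcd.listgcd (map a xs)"
  have "\<alpha> dvd a i" for i
    unfolding \<alpha>_def by (rule some_gcd.listgcd) (use xs in auto)
  then obtain e where e: "\<And>i. a i = \<alpha> * e i" unfolding dvd_def by metis
  obtain i0 where i0: "a i0 \<noteq> 0" using assms(2) by blast
  \<comment> \<open>The \<open>e i\<close> have no common factor, so \<open>e i0\<close> divides \<open>b i0\<close>.\<close>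
  have "a i0 dvd \<alpha> * b i0"
    unfolding \<alpha>_def
  proof (rule some_gcd.listgcd_greatest_mult)
    fix x assume "x \<in> set (map a xs)"
    then obtain i where "x = a i" by auto
    then show "a i0 dvd x * b i0" using assms(1)[of i0 i] by (metis dvd_triv_left)
  qed
  then have "e i0 dvd b i0" using e[of i0] i0 by auto
  then obtain \<beta> where \<beta>: "b i0 = \<beta> * e i0" by (auto simp: dvd_def mult.commute)
  have "b i = \<beta> * e i" for i
  proof -
    have "a i0 * b i = a i0 * (\<beta> * e i)"
      using assms(1)[of i0 i] e[of i] e[of i0] \<beta> by (simp add: mult_ac)
    then show ?thesis using i0 by simp
  qed
  then show ?thesis using that e by blast
qed

lemma proportional_imp_common_factor:
  fixes a b :: "3 \<Rightarrow> (3, 'k::field) mpoly"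
  assumes "\<And>i j. a i * b j = a j * b i" "\<exists>i. a i \<noteq> 0"
  obtains \<alpha> \<beta> e where "\<And>i. a i = \<alpha> * e i" "\<And>i. b i = \<beta> * e i"
proof -
  have 1: "\<exists>i. to_poly (a i) \<noteq> 0" using assms(2) inj_to_poly to_poly.hom_zero by (metis injD)
  have 2: "to_poly (a i) * to_poly (b j) = to_poly (a j) * to_poly (b i)" for i j
    using assms(1)[of i j] by (simp flip: to_poly.hom_mult)
  obtain \<alpha> \<beta> e where *: "\<And>i. to_poly (a i) = \<alpha> * e i" "\<And>i. to_poly (b i) = \<beta> * e i"
    by (rule proportional_imp_common_factor_ufd[of "\<lambda>i. to_poly (a i)" "\<lambda>i. to_poly (b i)", OF 2 1]) (rule that)
  define g where "g = inv_into UNIV (to_poly :: (3, 'k) mpoly \<Rightarrow> _)"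
  have g: "to_poly (g x) = x" for x unfolding g_def by (rule surj_f_inv_f[OF surj_to_poly])
  have "a i = g \<alpha> * g (e i)" "b i = g \<beta> * g (e i)" for i
    by (rule injD[OF inj_to_poly], simp add: to_poly.hom_mult g *)+
  then show ?thesis by (rule that)
qed

section \<open>Ideals with a resolution by quartics and quadrics\<close>

text \<open>
  The row \<open>a\<close> and the two columns \<open>b1\<close>, \<open>b2\<close> are the matrices of the resolution; the type 3
  indexes the three summands in the middle.
\<close>

locale quartic_resolution =
  fixes J :: "(3, 'k::field) mpoly set" and a b1 b2 :: "3 \<Rightarrow> (3, 'k) mpoly"
  assumes form_a: "form 4 (a i)" and form_b: "form 2 (b1 i)" "form 2 (b2 i)"
    and J_eq: "J = {\<Sum>i\<in>UNIV. v i * a i | v. True}"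
    and syzygy_iff: "(\<Sum>i\<in>UNIV. v i * a i) = 0 \<longleftrightarrow> (\<exists>w1 w2. \<forall>i. v i = w1 * b1 i + w2 * b2 i)"
    and columns_independent: "(\<forall>i. w1 * b1 i + w2 * b2 i = 0) \<Longrightarrow> w1 = 0 \<and> w2 = 0"
begin

lemma mem_J: "(\<Sum>i\<in>UNIV. v i * a i) \<in> J"
  using J_eq by blast

lemma J_closed: "p \<in> J \<Longrightarrow> r * p \<in> J"
proof -
  assume "p \<in> J"
  then obtain v where "p = (\<Sum>i\<in>UNIV. v i * a i)" using J_eq by blast
  then have "r * p = (\<Sum>i\<in>UNIV. (r * v i) * a i)" by (simp add: sum_distrib_left mult.assoc)
  then show ?thesis using mem_J by simp
qed

lemma a_mem_J: "a i \<in> J"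
proof -
  have "(\<Sum>j\<in>UNIV. (if j = i then 1 else 0) * a j) = (\<Sum>j\<in>UNIV. if j = i then a j else 0)"
    by (intro sum.cong) auto
  then show ?thesis using mem_J[of "\<lambda>j. if j = i then 1 else 0"] by simp
qed

text \<open>The syzygies are generated by the columns, whose entries are quadrics.\<close>

lemma low_degree_syzygy_eq_0:
  assumes "(\<Sum>i\<in>UNIV. v i * a i) = 0" and "\<And>i n. n \<ge> 2 \<Longrightarrow> hcomp n (v i) = 0"
  shows "v i = 0"
proof -
  obtain w1 w2 where v: "\<And>i. v i = w1 * b1 i + w2 * b2 i"
    using assms(1) syzygy_iff by metis
  have "hcomp n w1 = 0 \<and> hcomp n w2 = 0" for n
  proof (rule columns_independent, intro allI)
    fix i
    show "hcomp n w1 * b1 i + hcomp n w2 * b2 i = 0"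
      using assms(2)[of "n + 2" i] hcomp_mult_form(1)[OF form_b(1)] hcomp_mult_form(1)[OF form_b(2)]
      by (simp only: v hcomp_add)
  qed
  then have "w1 = 0" "w2 = 0" by (auto intro: hcomp_eqI)
  then show ?thesis by (simp add: v)
qed

lemma a_neq_0: "a i \<noteq> 0"
proof
  assume "a i = 0"
  then have "(\<Sum>j\<in>UNIV. (if j = i then 1 else 0) * a j) = 0"
    by (intro sum.neutral) auto
  then have "(if i = i then 1 else 0 :: (3, 'k) mpoly) = 0"
    by (rule low_degree_syzygy_eq_0) (auto simp: hcomp_form[OF form_1])
  then show False by simp
qed

lemma Var_combination_eq_0:
  fixes c :: "3 \<Rightarrow> 'k"
  assumes "(\<Sum>i\<in>UNIV. Var i * Const (c i)) = 0"
  shows "c i = 0"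
proof -
  have s: "Poly_Mapping.single j (1::nat) = Poly_Mapping.single i 1 \<longleftrightarrow> j = i" for i j :: 3
    by (metis lookup_single_eq lookup_single_not_eq zero_neq_one)
  have "0 = Poly_Mapping.lookup (\<Sum>j\<in>UNIV. Var j * Const (c j)) (Poly_Mapping.single i 1)"
    using assms by simp
  also have "\<dots> = (\<Sum>j\<in>UNIV. if j = i then c j else 0)"
    unfolding lookup_sum
    by (intro sum.cong refl) (simp only: Var_def mult_single lookup_single when_def s add_0_right mult_1_left)
  finally show ?thesis by simp
qed

text \<open>
  The quartics in \<open>J\<close> are constant combinations of the \<open>a i\<close>, so a relation among them with the
  variables as coefficients is a linear syzygy of \<open>a\<close>.
\<close>

lemma linear_relation_of_quartics_eq_0:
  assumes q: "\<And>i. q i \<in> J" "\<And>i. form 4 (q i)" and rel: "(\<Sum>i\<in>UNIV. Var i * q i) = 0"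
  shows "q i = 0"
proof -
  have "\<exists>v. q i = (\<Sum>j\<in>UNIV. v j * a j)" for i using q(1)[of i] J_eq by blast
  then obtain v where v: "\<And>i. q i = (\<Sum>j\<in>UNIV. v i j * a j)" by metis
  have "\<exists>k. hcomp 0 (v i j) = Const k" for i j by (metis form_0_eq_Const form_hcomp)
  then obtain k where k: "\<And>i j. hcomp 0 (v i j) = Const (k i j)" by metis
  have qk: "q i = (\<Sum>j\<in>UNIV. Const (k i j) * a j)" for i
  proof -
    have "q i = hcomp (0 + 4) (\<Sum>j\<in>UNIV. v i j * a j)"
      using hcomp_form[OF q(2)[of i], of 4] v by simp
    also have "\<dots> = (\<Sum>j\<in>UNIV. Const (k i j) * a j)"
      by (simp only: hcomp_sum hcomp_mult_form(1)[OF form_a] k)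
    finally show ?thesis .
  qed
  define l where "l j = (\<Sum>i\<in>UNIV. Var i * Const (k i j))" for j
  have "(\<Sum>j\<in>UNIV. l j * a j) = (\<Sum>i\<in>UNIV. Var i * q i)"
    unfolding l_def qk by (simp only: sum_distrib_left sum_distrib_right mult.assoc) (rule sum.swap)
  then have "(\<Sum>j\<in>UNIV. l j * a j) = 0" using rel by simp
  moreover have "form 1 (l j)" for j
    unfolding l_def using form_mult[OF form_Var(1) form_Const] by (intro form_sum) simp
  ultimately have "l j = 0" for j
    by (intro low_degree_syzygy_eq_0[of l]) (auto simp: hcomp_form[of "Suc 0"])
  then have "k i j = 0" for i j
    unfolding l_def by (rule Var_combination_eq_0)
  then show ?thesis by (simp add: qk)
qed

text \<open>
  If \<open>a = h a'\<close> with \<open>deg h > 0\<close>, then the Koszul syzygies of \<open>a'\<close> are combinations of the columns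
  with coefficients of degree at most 1.  Up to sign, the three pairs of coefficients form two
  syzygies of \<open>a\<close>, which therefore vanish.
\<close>

lemma common_divisor_is_unit:
  assumes dvd: "\<And>i. h dvd a i"
  shows "h dvd 1"
proof -
  obtain a' where a': "\<And>i. a i = h * a' i" using dvd unfolding dvd_def by metis
  have h0: "h \<noteq> 0" and a'0: "a' i \<noteq> 0" for i using a_neq_0[of i] a'[of i] by auto
  obtain d e where d: "form d h" "form e (a' 0)" "d + e = 4"
    using form_mult_imp_forms[of 4 h "a' 0"] form_a[of 0] a_neq_0[of 0] a'[of 0] by metis
  have form_a': "form (4 - d) (a' i)" for i
  proof -
    obtain d2 e2 where d2: "form d2 h" "form e2 (a' i)" "d2 + e2 = 4"
      using form_mult_imp_forms[of 4 h "a' i"] form_a[of i] a_neq_0[of i] a'[of i] by metis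
    have "d2 = d" using hcomp_form[OF d2(1), of d] hcomp_form[OF d(1), of d] h0 by (metis (full_types))
    moreover have "e2 = 4 - d2" using d2(3) by simp
    ultimately show ?thesis using d2(2) by simp
  qed
  show ?thesis
  proof (cases "d = 0")
    case True
    then obtain c where "h = Const c" using d(1) form_0_eq_Const by blast
    moreover from this have "c \<noteq> 0" using h0 by auto
    ultimately have "h * Const (inverse c) = 1" by (simp add: mult_single)
    then show ?thesis by (metis dvd_triv_left)
  next
    case False
    define K where "K i j = (\<lambda>k. if k = i then a' j else if k = j then - a' i else 0)" for i j :: 3
    have "\<exists>w1 w2. (\<forall>n\<ge>2. hcomp n w1 = 0 \<and> hcomp n w2 = 0) \<and> (\<forall>k. K i j k = w1 * b1 k + w2 * b2 k)"
      if "i \<noteq> j" for i j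
    proof -
      have "(\<Sum>k\<in>UNIV. K i j k * a k) = (\<Sum>k\<in>{i, j}. K i j k * a k)"
        by (rule sum.mono_neutral_right) (auto simp: K_def)
      also have "\<dots> = 0" using that by (simp add: K_def a' mult_ac)
      finally have "\<exists>w1 w2. \<forall>k. K i j k = w1 * b1 k + w2 * b2 k"
        unfolding syzygy_iff .
      then obtain w1 w2 where w: "\<And>k. K i j k = w1 * b1 k + w2 * b2 k"
        by (elim exE) (rule that, simp)
      have "hcomp n w1 = 0 \<and> hcomp n w2 = 0" if "n \<ge> 2" for n
      proof (rule columns_independent, intro allI)
        fix k
        have f: "form (4 - d) (K i j k)" by (simp add: K_def form_a' form_uminus)
        have "n + 2 \<noteq> 4 - d" using False that by linarith
        then have "hcomp (n + 2) (K i j k) = 0" using hcomp_form[OF f, of "n + 2"] by (simp only: if_False)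
        then show "hcomp n w1 * b1 k + hcomp n w2 * b2 k = 0"
          unfolding w[of k] hcomp_add hcomp_mult_form(1)[OF form_b(1)] hcomp_mult_form(1)[OF form_b(2)] .
      qed
      then show ?thesis using w by (intro exI[of _ w1] exI[of _ w2]) simp
    qed
    then obtain w1 w2 where
      w: "\<And>i j n. i \<noteq> j \<Longrightarrow> n \<ge> 2 \<Longrightarrow> hcomp n (w1 i j) = 0 \<and> hcomp n (w2 i j) = 0"
        "\<And>i j k. i \<noteq> j \<Longrightarrow> K i j k = w1 i j * b1 k + w2 i j * b2 k"
      by metis
    have ne: "(0::3) \<noteq> 1" "(0::3) \<noteq> 2" "(1::3) \<noteq> 2" by simp_all
    define u where "u w = a' 2 * w 0 1 - a' 1 * w 0 2 + a' 0 * w 1 2" for w :: "3 \<Rightarrow> 3 \<Rightarrow> (3, 'k) mpoly"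
    have "u w1 = 0 \<and> u w2 = 0"
    proof (rule columns_independent, intro allI)
      fix k
      have "u w1 * b1 k + u w2 * b2 k = a' 2 * K 0 1 k - a' 1 * K 0 2 k + a' 0 * K 1 2 k"
        unfolding w(2)[OF ne(1)] w(2)[OF ne(2)] w(2)[OF ne(3)] u_def by (simp add: algebra_simps)
      also have "\<dots> = 0" using ne by (cases k rule: exhaust_3) (simp_all add: K_def)
      finally show "u w1 * b1 k + u w2 * b2 k = 0" .
    qed
    moreover have "w 0 1 = 0" if "u w = 0" and w0: "\<And>i j n. i \<noteq> j \<Longrightarrow> n \<ge> 2 \<Longrightarrow> hcomp n (w i j) = 0" for w
    proof -
      define v where "v = (\<lambda>i::3. if i = 0 then w 1 2 else if i = 1 then - w 0 2 else w 0 1)"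
      have "(\<Sum>i\<in>UNIV. v i * a i) = h * u w"
        using ne by (simp add: sum_3 v_def u_def a' algebra_simps)
      then have "(\<Sum>i\<in>UNIV. v i * a i) = 0" using that(1) by simp
      moreover have "hcomp n (v i) = 0" if "n \<ge> 2" for i n
        using w0[OF ne(1) that] w0[OF ne(2) that] w0[OF ne(3) that] by (simp add: v_def hcomp_uminus)
      ultimately have "v 2 = 0" by (rule low_degree_syzygy_eq_0)
      then show ?thesis using ne by (simp add: v_def)
    qed
    ultimately have "w1 0 1 = 0" "w2 0 1 = 0" using w(1) by blast+
    then have "a' 0 = 0" using w(2)[of 0 1 1] ne by (simp add: K_def)
    then show ?thesis using a'0 by blast
  qed
qed

text \<open>
  Otherwise \<open>J\<close> contains all forms of some degree \<open>n\<close>, and a linear section of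
  \<open>R(-4)\<^sup>3 \<longrightarrow> R\<close> in degree \<open>n\<close>, together with the columns, embeds \<open>R\<^sub>n \<oplus> R\<^sub>n\<^sub>-\<^sub>6\<^sup>2\<close>
  into \<open>R\<^sub>n\<^sub>-\<^sub>4\<^sup>3\<close>.  But the first space has the larger dimension: the difference is 12.
\<close>

lemma some_Var_not_nilpotent: "\<exists>i. \<forall>n. Var i ^ n \<notin> J"
proof (rule ccontr)
  assume "\<not> ?thesis"
  then obtain l where l: "\<And>i. Var i ^ l i \<in> J" by metis
  define k where "k = l 0 + l 1 + l 2"
  let ?M = "\<lambda>n. {m :: 3 \<Rightarrow>\<^sub>0 nat. mon_degree m = n}"
  have "\<forall>m\<in>?M (k + 6). \<exists>v. (\<forall>i. form (k + 2) (v i)) \<and> Poly_Mapping.single m 1 = (\<Sum>i\<in>UNIV. v i * a i)"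
  proof
    fix m assume that: "m \<in> ?M (k + 6)"
    obtain i where i: "l i \<le> Poly_Mapping.lookup m i"
    proof (rule ccontr)
      assume "\<not> thesis"
      then have "Poly_Mapping.lookup m i < l i" for i using that by (meson not_le)
      from this[of 0] this[of 1] this[of 2] show False
        using \<open>m \<in> ?M (k + 6)\<close> by (simp add: mon_degree_def sum_3 k_def)
    qed
    have "Var i ^ l i dvd Var i ^ Poly_Mapping.lookup m i" using i by (rule le_imp_power_dvd)
    also have "\<dots> dvd (\<Prod>i\<in>UNIV. Var i ^ Poly_Mapping.lookup m i)" by (rule dvd_prodI) simp_all
    also have "\<dots> = (Poly_Mapping.single m 1 :: (3, 'k) mpoly)"
      unfolding single_eq_Const_times_Vars[of m 1] by simp
    finally obtain r where "(Poly_Mapping.single m 1 :: (3, 'k) mpoly) = r * Var i ^ l i"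
      by (metis dvdE mult.commute)
    then have "(Poly_Mapping.single m 1 :: (3, 'k) mpoly) \<in> J" using l J_closed by metis
    then obtain v where v: "(Poly_Mapping.single m 1 :: (3, 'k) mpoly) = (\<Sum>i\<in>UNIV. v i * a i)" using J_eq by blast
    have "(Poly_Mapping.single m 1 :: (3, 'k) mpoly) = hcomp ((k + 2) + 4) (Poly_Mapping.single m 1)"
      using that hcomp_form[OF form_single, of "k + 6" m "1::'k"] by (simp add: add.commute)
    also have "\<dots> = (\<Sum>i\<in>UNIV. hcomp (k + 2) (v i) * a i)"
      by (simp only: v hcomp_sum hcomp_mult_form(1)[OF form_a])
    finally show "\<exists>v. (\<forall>i. form (k + 2) (v i)) \<and> Poly_Mapping.single m 1 = (\<Sum>i\<in>UNIV. v i * a i)"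
      by (intro exI[of _ "\<lambda>i. hcomp (k + 2) (v i)"]) simp
  qed
  then obtain s where "\<forall>m\<in>?M (k + 6). (\<forall>i. form (k + 2) (s m i)) \<and>
      Poly_Mapping.single m 1 = (\<Sum>i\<in>UNIV. s m i * a i)"
    by (rule bchoice[THEN exE])
  then have s: "\<And>m i. m \<in> ?M (k + 6) \<Longrightarrow> form (k + 2) (s m i)"
      "\<And>m. m \<in> ?M (k + 6) \<Longrightarrow> Poly_Mapping.single m 1 = (\<Sum>i\<in>UNIV. s m i * a i)"
    by auto
  let ?U = "?M (k + 6) <+> (?M k <+> ?M k)"
  let ?E = "(UNIV :: 3 set) \<times> ?M (k + 2)"
  define P where "P = (\<lambda>i. case_sum (\<lambda>m. s m i) (case_sum (\<lambda>m. Poly_Mapping.single m 1 * b1 i)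
    (\<lambda>m. Poly_Mapping.single m 1 * b2 i)))"
  have fin: "finite ?E" "finite ?U" by (simp_all add: finite_monomials_of_degree)
  have "card ?E < card ?U"
  proof -
    have T: "2 * card (?M n) = (n + 1) * (n + 2)" for n
      unfolding card_monomials_of_degree by (rule dvd_mult_div_cancel) simp
    have "2 * card ?E = 3 * ((k + 2 + 1) * (k + 2 + 2))"
      using T[of "k + 2"] by (simp add: card_cartesian_product)
    moreover have "2 * card ?U = (k + 6 + 1) * (k + 6 + 2) + 2 * ((k + 1) * (k + 2))"
      using T[of "k + 6"] T[of k] by (simp add: card_Plus finite_monomials_of_degree)
    ultimately show ?thesis by (simp add: algebra_simps)
  qed
  from exists_nontrivial_solution[OF fin this, of "\<lambda>e u. Poly_Mapping.lookup (P (fst e) u) (snd e)"]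
  obtain v where v: "\<exists>u\<in>?U. v u \<noteq> 0"
      and eq: "\<And>e. e \<in> ?E \<Longrightarrow> (\<Sum>u\<in>?U. Poly_Mapping.lookup (P (fst e) u) (snd e) * v u) = 0"
    by blast
  have P_form: "form (k + 2) (P i u)" if "u \<in> ?U" for i u
    using that s(1) form_mult[OF form_single form_b(1)] form_mult[OF form_single form_b(2)] by (auto simp: P_def)
  have P0: "(\<Sum>u\<in>?U. Const (v u) * P i u) = 0" for i
  proof (rule mpoly_eq_0_if_lookup)
    show "Poly_Mapping.lookup (\<Sum>u\<in>?U. Const (v u) * P i u) m = 0" if "m \<in> ?M (k + 2)" for m
      using eq[of "(i, m)"] that by (simp add: lookup_sum lookup_Const_mult mult.commute[of "v _"])
    have "form (k + 2) (\<Sum>u\<in>?U. Const (v u) * P i u)"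
      by (intro form_sum form_Const_mult P_form)
    then show "Poly_Mapping.keys (\<Sum>u\<in>?U. Const (v u) * P i u) \<subseteq> ?M (k + 2)"
      unfolding form_def by blast
  qed
  define p where "p = (\<Sum>m\<in>?M (k + 6). Poly_Mapping.single m (v (Inl m)))"
  define w1 where "w1 = (\<Sum>m\<in>?M k. Poly_Mapping.single m (v (Inr (Inl m))))"
  define w2 where "w2 = (\<Sum>m\<in>?M k. Poly_Mapping.single m (v (Inr (Inr m))))"
  have sum_U: "(\<Sum>u\<in>?U. Const (v u) * P i u) =
      (\<Sum>m\<in>?M (k + 6). Const (v (Inl m)) * s m i) + (w1 * b1 i + w2 * b2 i)" for i
  proof -
    have "w1 * b1 i = (\<Sum>m\<in>?M k. Const (v (Inr (Inl m))) * (Poly_Mapping.single m 1 * b1 i))"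
      "w2 * b2 i = (\<Sum>m\<in>?M k. Const (v (Inr (Inr m))) * (Poly_Mapping.single m 1 * b2 i))"
      unfolding w1_def w2_def sum_distrib_right mult.assoc[symmetric] Const_mult_single_1 by (rule refl)+
    then show ?thesis
      by (simp add: sum.Plus finite_monomials_of_degree P_def)
  qed
  have "p = (\<Sum>m\<in>?M (k + 6). Const (v (Inl m)) * (\<Sum>i\<in>UNIV. s m i * a i))"
    unfolding p_def by (rule sum.cong) (simp_all only: s(2)[symmetric] Const_mult_single_1)
  also have "\<dots> = (\<Sum>i\<in>UNIV. (\<Sum>m\<in>?M (k + 6). Const (v (Inl m)) * s m i) * a i)"
    by (simp only: sum_distrib_left sum_distrib_right mult.assoc) (rule sum.swap)
  also have "\<dots> = (\<Sum>i\<in>UNIV. - (w1 * b1 i + w2 * b2 i) * a i)"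
  proof (rule sum.cong)
    fix i :: 3
    have "(\<Sum>m\<in>?M (k + 6). Const (v (Inl m)) * s m i) = - (w1 * b1 i + w2 * b2 i)"
      using P0[of i] unfolding sum_U by (simp only: eq_neg_iff_add_eq_0)
    then show "(\<Sum>m\<in>?M (k + 6). Const (v (Inl m)) * s m i) * a i = - (w1 * b1 i + w2 * b2 i) * a i"
      by simp
  qed simp
  also have "\<dots> = 0"
    by (subst syzygy_iff) (rule exI[of _ "- w1"], rule exI[of _ "- w2"], simp)
  finally have "p = 0" .
  have lookup: "Poly_Mapping.lookup (\<Sum>m\<in>?M n. Poly_Mapping.single m (c m)) m = c m" if "m \<in> ?M n" for n m and c :: "_ \<Rightarrow> 'k"
    using that finite_monomials_of_degree[of n] by (simp add: lookup_sum lookup_single when_def)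
  have vl: "v (Inl m) = 0" if "m \<in> ?M (k + 6)" for m
    using lookup[OF that, of "\<lambda>m. v (Inl m)"] \<open>p = 0\<close> by (simp add: p_def)
  have "w1 = 0 \<and> w2 = 0"
    using P0 unfolding sum_U by (intro columns_independent) (simp add: vl)
  then have "v (Inr (Inl m)) = 0" "v (Inr (Inr m)) = 0" if "m \<in> ?M k" for m
    using lookup[OF that, of "\<lambda>m. v (Inr (Inl m))"] lookup[OF that, of "\<lambda>m. v (Inr (Inr m))"]
    by (simp_all add: w1_def w2_def)
  then show False using v vl by auto
qed

end

text \<open>Matrix rows and columns are indexed by natural numbers; \<open>idx3\<close> relates them to the type \<open>3\<close>.\<close>

definition idx3 :: "3 \<Rightarrow> nat" where
  "idx3 i = (if i = 0 then 0 else if i = 1 then 1 else 2)"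

definition of_idx3 :: "nat \<Rightarrow> 3" where
  "of_idx3 n = (if n = 0 then 0 else if n = 1 then 1 else 2)"

lemma idx3_simps [simp]: "idx3 0 = 0" "idx3 1 = 1" "idx3 2 = 2"
  "of_idx3 0 = 0" "of_idx3 1 = 1" "of_idx3 (Suc 0) = 1" "of_idx3 2 = 2"
  by (simp_all add: idx3_def of_idx3_def)

lemma idx3_less [simp]: "idx3 i < 3"
  by (simp add: idx3_def)

lemma of_idx3_idx3 [simp]: "of_idx3 (idx3 i) = i"
  by (cases i rule: exhaust_3) simp_all

lemma idx3_of_idx3: "n < 3 \<Longrightarrow> idx3 (of_idx3 n) = n"
  by (auto simp: idx3_def of_idx3_def)

lemma all_less_3: "(\<forall>n<3. Q n) \<longleftrightarrow> (\<forall>i. Q (idx3 i))"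
  by (metis idx3_less idx3_of_idx3)

lemma sum_less_3: "(\<Sum>n = 0..<3. h n) = (\<Sum>i\<in>UNIV. h (idx3 i))" for h :: "nat \<Rightarrow> 'a::comm_monoid_add"
  by (simp add: sum_3 numeral_3_eq_3 numeral_2_eq_2 idx3_def add.assoc)

lemma minimal_graded_resolution_imp_quartic_resolution:
  fixes J :: "(3, 'k::field) mpoly set"
  assumes "has_minimal_graded_resolution J [4, 4, 4] [6, 6]"
  obtains a b1 b2 where "quartic_resolution J a b1 b2"
proof -
  obtain A B where AB: "graded_map [0] [4, 4, 4] A" "graded_map [4, 4, 4] [6, 6] B"
      "(\<lambda>w. w $ 0) ` mat_im A = J" "mat_ker A = mat_im B" "mat_ker B = {0\<^sub>v 2}"
    using assms unfolding has_minimal_graded_resolution_def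
    by (elim exE conjE) (rule that, simp_all add: numeral_2_eq_2)
  have A: "A \<in> carrier_mat 1 3" and B: "B \<in> carrier_mat 3 2"
    using AB(1,2) by (simp_all add: graded_map_def numeral_3_eq_3 numeral_2_eq_2)
  define a where "a i = A $$ (0, idx3 i)" for i
  define b1 where "b1 i = B $$ (idx3 i, 0)" for i
  define b2 where "b2 i = B $$ (idx3 i, 1)" for i
  define vec3 :: "(3 \<Rightarrow> (3, 'k) mpoly) \<Rightarrow> (3, 'k) mpoly Matrix.vec" where "vec3 v = Matrix.vec 3 (\<lambda>n. v (of_idx3 n))" for v
  define vec2 :: "(3, 'k) mpoly \<Rightarrow> (3, 'k) mpoly \<Rightarrow> (3, 'k) mpoly Matrix.vec" where "vec2 x y = Matrix.vec 2 (\<lambda>n. if n = 0 then x else y)" for x y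
  have vec3_carrier [simp]: "vec3 v \<in> carrier_vec 3" for v by (simp add: vec3_def)
  have vec2_carrier [simp]: "vec2 x y \<in> carrier_vec 2" for x y by (simp add: vec2_def)
  have vec3_surj: "\<exists>v. u = vec3 v" if "u \<in> carrier_vec 3" for u
    using that by (intro exI[of _ "\<lambda>i. u $ idx3 i"]) (auto simp: vec3_def idx3_of_idx3)
  have vec2_surj: "\<exists>x y. u = vec2 x y" if "u \<in> carrier_vec 2" for u
  proof (intro exI)
    show "u = vec2 (u $ 0) (u $ 1)"
      using that by (intro eq_vecI) (auto simp: vec2_def less_2_cases_iff)
  qed
  have A_mult: "A *\<^sub>v vec3 v = Matrix.vec 1 (\<lambda>_. \<Sum>i\<in>UNIV. v i * a i)" for v
  proof (rule eq_vecI)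
    fix n assume "n < dim_vec (Matrix.vec 1 (\<lambda>_. \<Sum>i\<in>UNIV. v i * a i))"
    then have n: "n = 0" by simp
    have "(A *\<^sub>v vec3 v) $ 0 = (\<Sum>n = 0..<3. A $$ (0, n) * v (of_idx3 n))"
      using A by (simp add: scalar_prod_def vec3_def)
    also have "\<dots> = (\<Sum>i\<in>UNIV. v i * a i)"
      by (simp add: sum_less_3 a_def mult.commute)
    finally show "(A *\<^sub>v vec3 v) $ n = Matrix.vec 1 (\<lambda>_. \<Sum>i\<in>UNIV. v i * a i) $ n" by (simp add: n)
  qed (use A in simp)
  have B_mult: "B *\<^sub>v vec2 x y = vec3 (\<lambda>i. x * b1 i + y * b2 i)" for x y
  proof (rule eq_vecI)
    fix n assume "n < dim_vec (vec3 (\<lambda>i. x * b1 i + y * b2 i))"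
    then have n: "n < 3" by (simp add: vec3_def)
    then show "(B *\<^sub>v vec2 x y) $ n = vec3 (\<lambda>i. x * b1 i + y * b2 i) $ n"
      using B by (simp add: scalar_prod_def vec3_def vec2_def b1_def b2_def idx3_of_idx3
          numeral_2_eq_2 mult.commute)
  qed (use B in \<open>simp add: vec3_def\<close>)
  have vec3_eq: "vec3 v = vec3 w \<longleftrightarrow> (\<forall>i. v i = w i)" for v w
    by (auto simp: vec3_def vec_eq_iff all_less_3)
  have vec3_0: "0\<^sub>v 3 = vec3 (\<lambda>_. 0)" by (auto simp: vec3_def)
  have vec1_0: "Matrix.vec 1 (\<lambda>_. x) = 0\<^sub>v 1 \<longleftrightarrow> x = 0" for x :: "(3, 'k) mpoly"
    by (auto simp: vec_eq_iff)
  show ?thesis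
  proof (rule that, unfold_locales)
    have nth: "[4, 4, 4 :: nat] ! idx3 i = 4" "idx3 i < length [4, 4, 4 :: nat]" for i
      by (simp_all add: idx3_def)
    show "form 4 (a i)" for i
      unfolding form_def a_def
      using AB(1)[unfolded graded_map_def, THEN conjunct2, rule_format, of 0 "idx3 i"] nth[of i] by simp
    show "form 2 (b1 i)" for i
      unfolding form_def b1_def
      using AB(2)[unfolded graded_map_def, THEN conjunct2, rule_format, of "idx3 i" 0] nth[of i] by simp
    show "form 2 (b2 i)" for i
      unfolding form_def b2_def
      using AB(2)[unfolded graded_map_def, THEN conjunct2, rule_format, of "idx3 i" 1] nth[of i] by simp
    have "J = (\<lambda>w. w $ 0) ` (\<lambda>v. A *\<^sub>v v) ` carrier_vec 3"
      using AB(3) A by (simp add: mat_im_def)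
    also have "carrier_vec 3 = range vec3" using vec3_surj vec3_carrier by blast
    also have "(\<lambda>w. w $ 0) ` (\<lambda>v. A *\<^sub>v v) ` range vec3 = {\<Sum>i\<in>UNIV. v i * a i | v. True}"
      by (auto simp: A_mult image_image)
    finally show "J = {\<Sum>i\<in>UNIV. v i * a i | v. True}" .
    show "(\<Sum>i\<in>UNIV. v i * a i) = 0 \<longleftrightarrow> (\<exists>w1 w2. \<forall>i. v i = w1 * b1 i + w2 * b2 i)" for v
    proof -
      have "(\<Sum>i\<in>UNIV. v i * a i) = 0 \<longleftrightarrow> vec3 v \<in> mat_ker A"
        using A by (simp add: mat_ker_def A_mult vec1_0 del: One_nat_def)
      also have "\<dots> \<longleftrightarrow> (\<exists>u\<in>carrier_vec 2. vec3 v = B *\<^sub>v u)"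
        using B unfolding AB(4) mat_im_def by auto
      also have "\<dots> \<longleftrightarrow> (\<exists>x y. vec3 v = B *\<^sub>v vec2 x y)"
        using vec2_surj vec2_carrier by metis
      finally show ?thesis by (simp add: B_mult vec3_eq)
    qed
    show "w1 = 0 \<and> w2 = 0" if "\<forall>i. w1 * b1 i + w2 * b2 i = 0" for w1 w2
    proof -
      have "B *\<^sub>v vec2 w1 w2 = 0\<^sub>v 3" using that by (simp add: B_mult vec3_0 vec3_eq)
      then have "vec2 w1 w2 \<in> mat_ker B" using B by (simp add: mat_ker_def)
      then have "vec2 w1 w2 = 0\<^sub>v 2" using AB(5) by simp
      then have "vec2 w1 w2 $ 0 = 0" "vec2 w1 w2 $ 1 = 0" by simp_all
      then show ?thesis by (simp add: vec2_def)
    qed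
  qed
qed

section \<open>Carrier-based rings of a type\<close>

lemma type_ring_simps [simp]:
  "carrier (ring_of_type_algebra :: 'a::comm_ring_1 ring) = UNIV"
  "x \<otimes>\<^bsub>ring_of_type_algebra\<^esub> y = x * y"
  "x \<oplus>\<^bsub>ring_of_type_algebra\<^esub> y = x + y"
  "\<zero>\<^bsub>ring_of_type_algebra\<^esub> = 0"
  "\<one>\<^bsub>ring_of_type_algebra\<^esub> = 1"
  by (simp_all add: ring_of_type_algebra_def)

lemma type_ring_uminus [simp]: "\<ominus>\<^bsub>ring_of_type_algebra\<^esub> x = - (x :: 'a::comm_ring_1)"
proof -
  interpret ring "ring_of_type_algebra :: 'a ring" by (rule ring_from_type_algebra)
  show ?thesis by (rule minus_equality) simp_all
qed

lemma type_ring_idealI: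
  fixes I :: "'a::comm_ring_1 set"
  assumes "0 \<in> I" "\<And>a b. a \<in> I \<Longrightarrow> b \<in> I \<Longrightarrow> a + b \<in> I" "\<And>r a. a \<in> I \<Longrightarrow> r * a \<in> I"
  shows "ideal I ring_of_type_algebra"
proof (rule idealI)
  interpret ring "ring_of_type_algebra :: 'a ring" by (rule ring_from_type_algebra)
  show "subgroup I (add_monoid ring_of_type_algebra)"
  proof (rule add.subgroupI)
    show "\<ominus>\<^bsub>ring_of_type_algebra\<^esub> a \<in> I" if "a \<in> I" for a
      using assms(3)[OF that, of "-1"] by simp
  qed (use assms in auto)
qed (use assms in \<open>auto simp: mult.commute\<close>)

lemma type_ring_ideal_iff:
  fixes I :: "'a::comm_ring_1 set"
  shows "ideal I ring_of_type_algebra \<longleftrightarrow>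
    0 \<in> I \<and> (\<forall>a\<in>I. \<forall>b\<in>I. a + b \<in> I) \<and> (\<forall>a\<in>I. \<forall>r. r * a \<in> I)"
proof
  assume "ideal I ring_of_type_algebra"
  then interpret ideal I ring_of_type_algebra .
  show "0 \<in> I \<and> (\<forall>a\<in>I. \<forall>b\<in>I. a + b \<in> I) \<and> (\<forall>a\<in>I. \<forall>r. r * a \<in> I)"
    using additive_subgroup.zero_closed[OF is_additive_subgroup]
      additive_subgroup.a_closed[OF is_additive_subgroup] I_l_closed by simp
qed (auto intro: type_ring_idealI)

lemma type_ring_primeidealD:
  fixes P :: "'a::comm_ring_1 set"
  assumes "primeideal P ring_of_type_algebra"
  shows "ideal P ring_of_type_algebra" "1 \<notin> P" "x * y \<in> P \<Longrightarrow> x \<in> P \<or> y \<in> P"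
proof -
  interpret primeideal P ring_of_type_algebra by fact
  show "ideal P ring_of_type_algebra" by (rule is_ideal)
  show "1 \<notin> P" using I_notcarr one_imp_carrier by auto
  show "x * y \<in> P \<Longrightarrow> x \<in> P \<or> y \<in> P" using I_prime by simp
qed

lemma type_ring_ideal_sum:
  fixes I :: "'a::comm_ring_1 set"
  assumes "ideal I ring_of_type_algebra" "\<And>x. x \<in> A \<Longrightarrow> h x \<in> I"
  shows "(\<Sum>x\<in>A. h x) \<in> I"
  using assms(2) by (induction A rule: infinite_finite_induct)
    (use assms(1) in \<open>auto simp: type_ring_ideal_iff\<close>)

lemma type_ring_ideal_diff:
  fixes I :: "'a::comm_ring_1 set"
  assumes "ideal I ring_of_type_algebra" "a \<in> I" "b \<in> I"
  shows "a - b \<in> I"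
proof -
  have "- 1 * b \<in> I" using assms unfolding type_ring_ideal_iff by blast
  then have "a + (- 1 * b) \<in> I" using assms unfolding type_ring_ideal_iff by blast
  then show ?thesis by simp
qed

section \<open>Chains of prime ideals in a polynomial ring modulo a nonzero element\<close>

text \<open>
  One step of the lexicographic argument of Coquand and Lombardi: in a sum of terms with powers of
  \<open>x\<close>, only the terms with the lowest power survive the passage from \<open>P\<close> to \<open>P'\<close>.
\<close>

lemma lowest_terms_mem_next_prime:
  fixes P P' :: "'a::comm_ring_1 set" and t :: "'m \<Rightarrow> 'a"
  assumes P: "primeideal P ring_of_type_algebra" and P': "ideal P' ring_of_type_algebra" "P \<subseteq> P'"
    and x: "x \<notin> P" "x \<in> P'" and K: "finite K" "K \<noteq> {}"
    and sum: "(\<Sum>m\<in>K. t m * x ^ e m) \<in> P"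
  obtains n where "{m \<in> K. e m = n} \<noteq> {}" "(\<Sum>m\<in>{m \<in> K. e m = n}. t m) \<in> P'"
proof -
  define n where "n = Min (e ` K)"
  have n: "n \<le> e m" if "m \<in> K" for m using K that by (simp add: n_def)
  have "n \<in> e ` K" unfolding n_def using K by (intro Min_in) auto
  then have ne: "{m \<in> K. e m = n} \<noteq> {}" by auto
  have "(\<Sum>m\<in>K. t m * x ^ e m) = x ^ n * (\<Sum>m\<in>K. t m * x ^ (e m - n))"
    unfolding sum_distrib_left
  proof (rule sum.cong)
    fix m assume "m \<in> K"
    then have "x ^ e m = x ^ n * x ^ (e m - n)" using n by (simp flip: power_add)
    then show "t m * x ^ e m = x ^ n * (t m * x ^ (e m - n))" by (simp add: mult_ac)
  qed simp
  moreover have "x ^ k \<notin> P" for k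
    by (induction k) (use type_ring_primeidealD[OF P] x(1) in auto)
  ultimately have "(\<Sum>m\<in>K. t m * x ^ (e m - n)) \<in> P"
    using sum type_ring_primeidealD(3)[OF P] by metis
  then have all: "(\<Sum>m\<in>K. t m * x ^ (e m - n)) \<in> P'" using P'(2) by blast
  have high: "(\<Sum>m\<in>K - {m \<in> K. e m = n}. t m * x ^ (e m - n)) \<in> P'"
  proof (rule type_ring_ideal_sum[OF P'(1)])
    fix m assume "m \<in> K - {m \<in> K. e m = n}"
    then have "e m - n = Suc (e m - n - 1)" using n[of m] by auto
    then have "t m * x ^ (e m - n) = (t m * x ^ (e m - n - 1)) * x" by (metis mult.assoc power_Suc2)
    then show "t m * x ^ (e m - n) \<in> P'" using x(2) P'(1) unfolding type_ring_ideal_iff by metis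
  qed
  have "(\<Sum>m\<in>K. t m * x ^ (e m - n)) = (\<Sum>m\<in>K - {m \<in> K. e m = n}. t m * x ^ (e m - n)) +
      (\<Sum>m\<in>{m \<in> K. e m = n}. t m * x ^ (e m - n))"
    by (rule sum.subset_diff) (use K in auto)
  moreover have "(\<Sum>m\<in>{m \<in> K. e m = n}. t m * x ^ (e m - n)) = (\<Sum>m\<in>{m \<in> K. e m = n}. t m)"
    by (rule sum.cong) auto
  ultimately have "(\<Sum>m\<in>{m \<in> K. e m = n}. t m) =
      (\<Sum>m\<in>K. t m * x ^ (e m - n)) - (\<Sum>m\<in>K - {m \<in> K. e m = n}. t m * x ^ (e m - n))"
    by simp
  also have "\<dots> \<in> P'" by (rule type_ring_ideal_diff[OF P'(1) all high])
  finally show ?thesis using ne that by blast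
qed

text \<open>
  Passing through the chain reduces a polynomial relation to its lexicographically lowest
  coefficient, which is a unit.
\<close>

lemma no_relation_along_prime_chain:
  fixes P0 P1 P2 P3 :: "(3, 'k::field) mpoly set" and p :: "3 \<Rightarrow> (3, 'k) mpoly" and Q :: "(3, 'k) mpoly"
  assumes P: "primeideal P0 mpoly_ring" "primeideal P1 mpoly_ring" "primeideal P2 mpoly_ring" "primeideal P3 mpoly_ring"
    and sub: "P0 \<subseteq> P1" "P1 \<subseteq> P2" "P2 \<subseteq> P3"
    and p: "p 0 \<in> P1 - P0" "p 1 \<in> P2 - P1" "p 2 \<in> P3 - P2"
    and Q: "subst p Q \<in> P0" "Q \<noteq> 0"
  shows False
proof -
  let ?l = "\<lambda>m :: 3 \<Rightarrow>\<^sub>0 nat. Poly_Mapping.lookup m"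
  let ?c = "\<lambda>m. Const (Poly_Mapping.lookup Q m) :: (3, 'k) mpoly"
  note id = type_ring_primeidealD(1)
  define K0 where "K0 = Poly_Mapping.keys Q"
  have "(\<Sum>m\<in>K0. (?c m * p 2 ^ ?l m 2 * p 1 ^ ?l m 1) * p 0 ^ ?l m 0) \<in> P0"
    using Q(1) by (simp add: subst_def prod_3 K0_def mult_ac)
  then obtain n0 where K1: "{m \<in> K0. ?l m 0 = n0} \<noteq> {}"
      "(\<Sum>m\<in>{m \<in> K0. ?l m 0 = n0}. ?c m * p 2 ^ ?l m 2 * p 1 ^ ?l m 1) \<in> P1"
    using lowest_terms_mem_next_prime[OF P(1) id[OF P(2)] sub(1), of "p 0" K0 "\<lambda>m. ?c m * p 2 ^ ?l m 2 * p 1 ^ ?l m 1" "\<lambda>m. ?l m 0"]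
      p(1) Q(2) by (auto simp: K0_def)
  define K1 where "K1 = {m \<in> K0. ?l m 0 = n0}"
  obtain n1 where K2: "{m \<in> K1. ?l m 1 = n1} \<noteq> {}"
      "(\<Sum>m\<in>{m \<in> K1. ?l m 1 = n1}. ?c m * p 2 ^ ?l m 2) \<in> P2"
    using lowest_terms_mem_next_prime[OF P(2) id[OF P(3)] sub(2), of "p 1" K1 "\<lambda>m. ?c m * p 2 ^ ?l m 2" "\<lambda>m. ?l m 1"]
      p(2) K1 by (auto simp: K1_def K0_def)
  define K2 where "K2 = {m \<in> K1. ?l m 1 = n1}"
  obtain n2 where K3: "{m \<in> K2. ?l m 2 = n2} \<noteq> {}" "(\<Sum>m\<in>{m \<in> K2. ?l m 2 = n2}. ?c m) \<in> P3"
    using lowest_terms_mem_next_prime[OF P(3) id[OF P(4)] sub(3), of "p 2" K2 ?c "\<lambda>m. ?l m 2"]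
      p(3) K2 by (auto simp: K2_def K1_def K0_def)
  obtain m where m: "m \<in> K2" "?l m 2 = n2" using K3(1) by blast
  have "{m \<in> K2. ?l m 2 = n2} = {m}"
  proof (intro equalityI subsetI)
    fix m' assume "m' \<in> {m \<in> K2. ?l m 2 = n2}"
    then have "?l m' i = ?l m i" for i
      using m by (cases i rule: exhaust_3) (auto simp: K2_def K1_def)
    then show "m' \<in> {m}" by (simp add: poly_mapping_eqI)
  qed (use m in auto)
  then have "?c m \<in> P3" using K3(2) by simp
  moreover have "Poly_Mapping.lookup Q m \<noteq> 0"
    using m by (simp add: K2_def K1_def K0_def in_keys_iff)
  then have "Const (inverse (Poly_Mapping.lookup Q m)) * ?c m = 1"
    by (simp add: mult_single)
  ultimately have "1 \<in> P3" using id[OF P(4)] unfolding type_ring_ideal_iff by metis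
  then show False using type_ring_primeidealD(2)[OF P(4)] by blast
qed

lemma box_of_monomials:
  "finite {m :: 3 \<Rightarrow>\<^sub>0 nat. \<forall>i. Poly_Mapping.lookup m i < n} \<and>
   card {m :: 3 \<Rightarrow>\<^sub>0 nat. \<forall>i. Poly_Mapping.lookup m i < n} = n ^ 3"
proof -
  define mon :: "nat \<times> nat \<times> nat \<Rightarrow> 3 \<Rightarrow>\<^sub>0 nat" where
    "mon = (\<lambda>(i, j, k). Poly_Mapping.single 0 i + Poly_Mapping.single 1 j + Poly_Mapping.single 2 k)"
  have l: "Poly_Mapping.lookup (mon (i, j, k)) 0 = i" "Poly_Mapping.lookup (mon (i, j, k)) 1 = j"
      "Poly_Mapping.lookup (mon (i, j, k)) 2 = k" for i j k
    by (simp_all add: mon_def lookup_add lookup_single)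
  have bij: "bij_betw mon ({..<n} \<times> {..<n} \<times> {..<n}) {m. \<forall>i. Poly_Mapping.lookup m i < n}"
    unfolding bij_betw_def
  proof
    show "inj_on mon ({..<n} \<times> {..<n} \<times> {..<n})"
      by (auto simp: inj_on_def) (metis l)+
    have "m \<in> mon ` ({..<n} \<times> {..<n} \<times> {..<n})" if m: "\<forall>i. Poly_Mapping.lookup m i < n" for m
    proof
      show "m = mon (Poly_Mapping.lookup m 0, Poly_Mapping.lookup m 1, Poly_Mapping.lookup m 2)"
      proof (rule poly_mapping_eqI)
        fix i
        show "Poly_Mapping.lookup m i = Poly_Mapping.lookup
          (mon (Poly_Mapping.lookup m 0, Poly_Mapping.lookup m 1, Poly_Mapping.lookup m 2)) i"
          by (cases i rule: exhaust_3) (simp_all add: l)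
      qed
    qed (use m in auto)
    moreover have "Poly_Mapping.lookup (mon (i, j, k)) l < n" if "i < n" "j < n" "k < n" for i j k l
      using that by (cases l rule: exhaust_3) (simp_all add: l)
    ultimately show "mon ` ({..<n} \<times> {..<n} \<times> {..<n}) = {m. \<forall>i. Poly_Mapping.lookup m i < n}"
      by auto
  qed
  show ?thesis
    using bij_betw_finite[OF bij] bij_betw_same_card[OF bij]
    by (simp add: card_cartesian_product power3_eq_cube)
qed

definition exponents_le :: "nat \<Rightarrow> ('v, 'k::zero) mpoly \<Rightarrow> bool" where
  "exponents_le n p \<longleftrightarrow> (\<forall>m\<in>Poly_Mapping.keys p. \<forall>i. Poly_Mapping.lookup m i \<le> n)"

lemma exponents_le_mult:
  "exponents_le a p \<Longrightarrow> exponents_le b q \<Longrightarrow> exponents_le (a + b) (p * q)"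
  unfolding exponents_le_def
proof (intro ballI allI)
  fix m i
  assume *: "\<forall>m\<in>Poly_Mapping.keys p. \<forall>i. Poly_Mapping.lookup m i \<le> a"
    "\<forall>m\<in>Poly_Mapping.keys q. \<forall>i. Poly_Mapping.lookup m i \<le> b" and "m \<in> Poly_Mapping.keys (p * q)"
  then obtain m1 m2 where "m = m1 + m2" "m1 \<in> Poly_Mapping.keys p" "m2 \<in> Poly_Mapping.keys q"
    using keys_mult[of p q] by blast
  then show "Poly_Mapping.lookup m i \<le> a + b" using * by (simp add: lookup_add add_mono)
qed

lemma exponents_le_mono: "exponents_le a p \<Longrightarrow> a \<le> b \<Longrightarrow> exponents_le b p"
  unfolding exponents_le_def using le_trans by blast

lemma exponents_le_power: "exponents_le a p \<Longrightarrow> exponents_le (n * a) (p ^ n)"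
proof (induction n)
  case 0
  then show ?case by (simp add: exponents_le_def)
next
  case (Suc n)
  then show ?case using exponents_le_mult by simp
qed

lemma exponents_le_obtain:
  fixes p :: "('v::finite, 'k::comm_ring_1) mpoly"
  obtains n where "exponents_le n p"
proof -
  obtain N where N: "\<And>m. m \<in> Poly_Mapping.keys p \<Longrightarrow> mon_degree m \<le> N"
    using obtain_degree_bound by blast
  have "Poly_Mapping.lookup m i \<le> N" if "m \<in> Poly_Mapping.keys p" for m i
    using N[OF that] member_le_sum[of i UNIV "Poly_Mapping.lookup m"] by (simp add: mon_degree_def)
  then have "exponents_le N p" by (simp add: exponents_le_def)
  then show ?thesis by (rule that)
qed

text \<open>
  Modulo \<open>F\<close>, any three polynomials are algebraically dependent: there are \<open>N\<^sup>3\<close> monomials in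
  them with exponents below \<open>N\<close>, whereas the polynomials with exponents below \<open>3DN\<close> modulo the multiples of \<open>F\<close>
  have dimension of the order of \<open>N\<^sup>2\<close>.
\<close>

lemma algebraic_relation_mod:
  fixes p :: "3 \<Rightarrow> (3, 'k::field) mpoly" and F :: "(3, 'k) mpoly"
  assumes "F \<noteq> 0"
  obtains Q G where "Q \<noteq> 0" "subst p Q = G * F"
proof -
  obtain e where e: "exponents_le e F" by (rule exponents_le_obtain)
  have "\<forall>i. \<exists>n. exponents_le n (p i)" by (metis exponents_le_obtain)
  then obtain d where d: "\<And>i. exponents_le (d i) (p i)" by metis
  define D where "D = d 0 + d 1 + d 2 + 1"
  have D: "exponents_le D (p i)" for i
    by (rule exponents_le_mono[OF d]) (cases i rule: exhaust_3, auto simp: D_def)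
  \<comment> \<open>With \<open>L = 3DN\<close>, the codimension of the multiples of \<open>F\<close> is at most
    \<open>L\<^sup>3 - (L - e)\<^sup>3 \<le> 3eL\<^sup>2 = 27eD\<^sup>2N\<^sup>2\<close>, which has to be less than \<open>N\<^sup>3\<close>.\<close>
  define N where "N = 27 * e * D\<^sup>2 + 1"
  define L where "L = 3 * D * N"
  let ?B = "\<lambda>n. {m :: 3 \<Rightarrow>\<^sub>0 nat. \<forall>i. Poly_Mapping.lookup m i < n}"
  have "D \<ge> 1" by (simp add: D_def)
  have "e * 1 \<le> e * D\<^sup>2" using \<open>D \<ge> 1\<close> by (intro mult_le_mono2) simp
  moreover have "N = 27 * (e * D\<^sup>2) + 1" by (simp add: N_def)
  ultimately have "e < N" by linarith
  also have "N \<le> L" using \<open>D \<ge> 1\<close> by (simp add: L_def)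
  finally have eL: "e < L" .
  let ?U = "?B N <+> ?B (L - e)"
  have fin: "finite (?B L)" "finite ?U" using box_of_monomials by auto
  have card: "card (?B L) < card ?U"
  proof -
    define x where "x = L - e"
    have L: "L = x + e" using eL by (simp add: x_def)
    have "L ^ 3 \<le> x ^ 3 + 3 * e * L\<^sup>2"
      unfolding L by (simp add: power2_eq_square power3_eq_cube algebra_simps)
    also have "3 * e * L\<^sup>2 = 27 * e * D\<^sup>2 * N\<^sup>2" by (simp add: L_def power_mult_distrib)
    also have "\<dots> < N * N\<^sup>2" by (rule mult_strict_right_mono) (simp_all add: N_def)
    finally have "L ^ 3 < N ^ 3 + (L - e) ^ 3" by (simp add: x_def power3_eq_cube power2_eq_square)
    then show ?thesis using box_of_monomials by (simp add: card_Plus)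
  qed
  define P where "P = case_sum (\<lambda>m. subst p (Poly_Mapping.single m 1)) (\<lambda>m. Poly_Mapping.single m 1 * F)"
  have keys: "Poly_Mapping.keys (P u) \<subseteq> ?B L" if u: "u \<in> ?U" for u
  proof (cases u)
    case (Inl m)
    have m: "Poly_Mapping.lookup m i \<le> N - 1" for i
    proof -
      have "Poly_Mapping.lookup m i < N" using u Inl by auto
      then show ?thesis by linarith
    qed
    have "exponents_le (Poly_Mapping.lookup m 0 * D + Poly_Mapping.lookup m 1 * D + Poly_Mapping.lookup m 2 * D) (P u)"
      unfolding Inl P_def sum.case subst_eq_mev mev_single[OF comm_ring_hom_Const] prod_3 single_one mult_1_left
      by (intro exponents_le_mult exponents_le_power D)
    moreover have "Poly_Mapping.lookup m 0 * D + Poly_Mapping.lookup m 1 * D + Poly_Mapping.lookup m 2 * D < L"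
    proof -
      have "Poly_Mapping.lookup m i * D \<le> (N - 1) * D" for i using m by (rule mult_le_mono1)
      from this[of 0] this[of 1] this[of 2]
      have "Poly_Mapping.lookup m 0 * D + Poly_Mapping.lookup m 1 * D + Poly_Mapping.lookup m 2 * D \<le> 3 * ((N - 1) * D)"
        by linarith
      also have "\<dots> < 3 * (N * D)" using \<open>D \<ge> 1\<close> by (simp add: N_def)
      finally show ?thesis by (simp add: L_def mult_ac)
    qed
    ultimately show ?thesis unfolding exponents_le_def by (blast intro: le_less_trans)
  next
    case (Inr m)
    then have m: "Poly_Mapping.lookup m i < L - e" for i using u by auto
    have "exponents_le (L - e - 1) (Poly_Mapping.single m (1::'k))"
      unfolding exponents_le_def
    proof (intro ballI allI)
      fix m' i assume "m' \<in> Poly_Mapping.keys (Poly_Mapping.single m (1::'k))"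
      then have "m' = m" by simp
      show "Poly_Mapping.lookup m' i \<le> L - e - 1" unfolding \<open>m' = m\<close> using m[of i] by linarith
    qed
    from exponents_le_mult[OF this e] have "exponents_le (L - 1) (P u)"
      using eL by (simp add: Inr P_def)
    moreover have "L - 1 < L" using eL by simp
    ultimately show ?thesis unfolding exponents_le_def by (blast intro: le_less_trans)
  qed
  obtain v where v: "\<exists>u\<in>?U. v u \<noteq> 0" "(\<Sum>u\<in>?U. Const (v u) * P u) = 0"
    by (rule linearly_dependent_mpolys[of "?B L" ?U P])
      ((rule fin card | erule keys | erule that, assumption)+)
  define Q where "Q = (\<Sum>m\<in>?B N. Poly_Mapping.single m (v (Inl m)))"
  define G where "G = (\<Sum>m\<in>?B (L - e). Poly_Mapping.single m (v (Inr m)))"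
  have "subst p Q = (\<Sum>m\<in>?B N. Const (v (Inl m)) * P (Inl m))"
  proof -
    have "subst p (Poly_Mapping.single m c) = Const c * subst p (Poly_Mapping.single m 1)" for m c
      using Const_mult_single_1[of c m] by (metis subst.hom_mult subst_Const)
    then show ?thesis unfolding Q_def P_def sum.case subst.hom_sum by (intro sum.cong refl)
  qed
  moreover have "G * F = (\<Sum>m\<in>?B (L - e). Const (v (Inr m)) * P (Inr m))"
  proof -
    have "Poly_Mapping.single m c * F = Const c * (Poly_Mapping.single m 1 * F)" for m c
      unfolding mult.assoc[symmetric] Const_mult_single_1 ..
    then show ?thesis unfolding G_def P_def sum.case sum_distrib_right by (intro sum.cong refl)
  qed
  moreover have "(\<Sum>u\<in>?U. Const (v u) * P u) =
      (\<Sum>m\<in>?B N. Const (v (Inl m)) * P (Inl m)) + (\<Sum>m\<in>?B (L - e). Const (v (Inr m)) * P (Inr m))"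
    by (simp only: sum.Plus[OF box_of_monomials[THEN conjunct1] box_of_monomials[THEN conjunct1]] o_def)
  ultimately have "subst p Q + G * F = 0" using v(2) by (simp only:)
  then have QG: "subst p Q = (- G) * F" by (simp only: mult_minus_left eq_neg_iff_add_eq_0)
  have lookup: "Poly_Mapping.lookup (\<Sum>m\<in>?B n. Poly_Mapping.single m (c m)) m = c m"
    if "m \<in> ?B n" for n m and c :: "_ \<Rightarrow> 'k"
    using that box_of_monomials[of n] by (simp add: lookup_sum lookup_single when_def)
  have "Q \<noteq> 0"
  proof
    assume "Q = 0"
    then have "G = 0" using QG assms by (simp add: subst.hom_zero)
    have "v (Inl m) = 0" if "m \<in> ?B N" for m
      using lookup[OF that, of "\<lambda>m. v (Inl m)"] \<open>Q = 0\<close> by (simp add: Q_def)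
    moreover have "v (Inr m) = 0" if "m \<in> ?B (L - e)" for m
      using lookup[OF that, of "\<lambda>m. v (Inr m)"] \<open>G = 0\<close> by (simp add: G_def)
    ultimately show False using v(1) by blast
  qed
  then show ?thesis using that QG by blast
qed

lemma no_prime_chain_above_nonzero:
  fixes Q :: "nat \<Rightarrow> (3, 'k::field) mpoly set"
  assumes "\<And>i. i \<le> 3 \<Longrightarrow> primeideal (Q i) mpoly_ring" and "\<And>i. i < 3 \<Longrightarrow> Q i \<subset> Q (Suc i)"
    and "F \<in> Q 0" "F \<noteq> 0"
  shows False
proof -
  obtain q0 q1 q2 where q: "q0 \<in> Q 1 - Q 0" "q1 \<in> Q 2 - Q 1" "q2 \<in> Q 3 - Q 2"
    using assms(2)[of 0] assms(2)[of 1] assms(2)[of 2] by (auto simp: numeral_2_eq_2 numeral_3_eq_3)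
  define p :: "3 \<Rightarrow> (3, 'k) mpoly" where "p = (\<lambda>i. if i = 0 then q0 else if i = 1 then q1 else q2)"
  obtain R G where RG: "R \<noteq> 0" "subst p R = G * F" by (rule algebraic_relation_mod[OF assms(4)])
  have "subst p R \<in> Q 0"
    using RG(2) assms(1)[of 0] assms(3) type_ring_primeidealD(1) type_ring_ideal_iff by (metis le0)
  then show False
    using no_relation_along_prime_chain[OF assms(1)[of 0] assms(1)[of 1] assms(1)[of 2] assms(1)[of 3], of p R]
      assms(2)[of 0] assms(2)[of 1] assms(2)[of 2] q RG(1)
    by (simp add: p_def numeral_2_eq_2 numeral_3_eq_3 psubset_eq)
qed

section \<open>Analytic spread and algebraic independence\<close>

lemma enat_le_krull_dimD:
  assumes "enat N \<le> krull_dim A" "N > 0"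
  obtains P where "\<And>i. i \<le> N \<Longrightarrow> primeideal (P i) A" "\<And>i. i < N \<Longrightarrow> P i \<subset> P (Suc i)"
proof -
  let ?S = "{enat n | n. \<exists>P :: nat \<Rightarrow> 'a set. (\<forall>i\<le>n. primeideal (P i) A) \<and> (\<forall>i<n. P i \<subset> P (Suc i))}"
  have "\<exists>n\<ge>N. \<exists>P :: nat \<Rightarrow> 'a set. (\<forall>i\<le>n. primeideal (P i) A) \<and> (\<forall>i<n. P i \<subset> P (Suc i))"
  proof (rule ccontr)
    assume "\<not> ?thesis"
    then have *: "n < N" if "\<forall>i\<le>n. primeideal (P i) A" "\<forall>i<n. P i \<subset> P (Suc i)" for n P
      using that by (metis not_le)
    have "x \<le> enat (N - 1)" if x: "x \<in> ?S" for x
    proof -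
      obtain n P where "x = enat n" "\<forall>i\<le>n. primeideal (P i) A" "\<forall>i<n. P i \<subset> P (Suc i)" using x by blast
      then show ?thesis using *[of n P] by simp
    qed
    then have "Sup ?S \<le> enat (N - 1)" by (rule Sup_least)
    also have "\<dots> < enat N" using assms(2) by simp
    finally show False using assms(1) by (simp add: krull_dim_def)
  qed
  then obtain n P where "n \<ge> N" "\<And>i. i \<le> n \<Longrightarrow> primeideal (P i) A" "\<And>i. i < n \<Longrightarrow> P i \<subset> P (Suc i)"
    by blast
  then show ?thesis using that[of P] by (meson le_trans less_le_trans)
qed

lemma genideal_range_eq:
  fixes f :: "'i::finite \<Rightarrow> 'a::comm_ring_1"
  shows "genideal ring_of_type_algebra (range f) = {\<Sum>i\<in>UNIV. v i * f i | v. True}" (is "_ = ?S")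
proof
  interpret ring "ring_of_type_algebra :: 'a ring" by (rule ring_from_type_algebra)
  have "ideal ?S ring_of_type_algebra"
  proof (rule type_ring_idealI)
    show "0 \<in> ?S" by (intro CollectI exI[of _ "\<lambda>_. 0"] conjI TrueI) simp
    show "a + b \<in> ?S" if ab: "a \<in> ?S" "b \<in> ?S" for a b
    proof -
      obtain v w where "a = (\<Sum>i\<in>UNIV. v i * f i)" "b = (\<Sum>i\<in>UNIV. w i * f i)" using ab by blast
      then have "a + b = (\<Sum>i\<in>UNIV. (v i + w i) * f i)" by (simp add: distrib_right sum.distrib)
      then show ?thesis by (intro CollectI exI[of _ "\<lambda>i. v i + w i"] conjI TrueI)
    qed
    show "r * a \<in> ?S" if a: "a \<in> ?S" for r a
    proof -
      obtain v where "a = (\<Sum>i\<in>UNIV. v i * f i)" using a by blast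
      then have "r * a = (\<Sum>i\<in>UNIV. (r * v i) * f i)" by (simp add: sum_distrib_left mult.assoc)
      then show ?thesis by (intro CollectI exI[of _ "\<lambda>i. r * v i"] conjI TrueI)
    qed
  qed
  moreover have "f i \<in> ?S" for i
  proof -
    have "f i = (\<Sum>j\<in>UNIV. if j = i then f j else 0)" by simp
    also have "\<dots> = (\<Sum>j\<in>UNIV. (if j = i then 1 else 0) * f j)" by (intro sum.cong) auto
    finally show ?thesis by (intro CollectI exI[of _ "\<lambda>j. if j = i then 1 else 0"] conjI TrueI)
  qed
  ultimately show "genideal ring_of_type_algebra (range f) \<subseteq> ?S"
    by (intro genideal_minimal) auto
  have "ideal (genideal ring_of_type_algebra (range f)) ring_of_type_algebra"
    by (rule genideal_ideal) simp
  moreover have "f i \<in> genideal ring_of_type_algebra (range f)" for i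
    using genideal_self[of "range f"] by auto
  ultimately show "?S \<subseteq> genideal ring_of_type_algebra (range f)"
    by (auto intro!: type_ring_ideal_sum simp: type_ring_ideal_iff)
qed

context
  fixes J :: "'a::comm_ring_1 set"
  assumes J: "ideal J ring_of_type_algebra"
begin

lemma ideal_power_Suc: "ideal_power ring_of_type_algebra J (Suc n) =
    ideal_prod ring_of_type_algebra J (ideal_power ring_of_type_algebra J n)"
  by (simp add: ideal_power_def)

lemma ideal_power_0: "ideal_power ring_of_type_algebra J 0 = UNIV"
  by (simp add: ideal_power_def)

lemma ideal_ideal_power: "ideal (ideal_power ring_of_type_algebra J n) ring_of_type_algebra"
proof -
  interpret ring "ring_of_type_algebra :: 'a ring" by (rule ring_from_type_algebra)
  show ?thesis
    by (induction n) (use oneideal in \<open>auto simp: ideal_power_0 ideal_power_Suc intro: ideal_prod_is_ideal J\<close>)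
qed

lemma ideal_power_mult:
  assumes "p \<in> ideal_power ring_of_type_algebra J m" "q \<in> ideal_power ring_of_type_algebra J n"
  shows "p * q \<in> ideal_power ring_of_type_algebra J (m + n)"
  using assms(1)
proof (induction m arbitrary: p)
  case 0
  then show ?case using assms(2) ideal_ideal_power[of n] by (simp add: type_ring_ideal_iff)
next
  case (Suc m)
  from Suc.prems show ?case
    unfolding ideal_power_Suc add_Suc
  proof induction
    case (prod i j)
    then show ?case
      using Suc.IH[of j] ideal_prod.prod[of i J "j * q" _ "ring_of_type_algebra"] by (simp add: mult.assoc)
  next
    case (sum s1 s2)
    then show ?case using ideal_prod.sum[of _ "ring_of_type_algebra"] by (fastforce simp: distrib_right)
  qed
qed

lemma carrier_rees_algebra:
  "carrier (rees_algebra J) = {p. \<forall>n. poly.coeff p n \<in> ideal_power ring_of_type_algebra J n}"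
  by (simp add: rees_algebra_def)

lemma rees_algebra_simps:
  "x \<otimes>\<^bsub>rees_algebra J\<^esub> y = x * y" "x \<oplus>\<^bsub>rees_algebra J\<^esub> y = x + y"
  "\<zero>\<^bsub>rees_algebra J\<^esub> = 0" "\<one>\<^bsub>rees_algebra J\<^esub> = 1"
  by (simp_all add: rees_algebra_def)

lemma cring_rees_algebra: "cring (rees_algebra J)"
proof -
  interpret cring "ring_of_type_algebra :: 'a poly ring" by (rule cring_from_type_algebra)
  let ?H = "{p. \<forall>n. poly.coeff p n \<in> ideal_power ring_of_type_algebra J n}"
  note id = ideal_ideal_power[unfolded type_ring_ideal_iff]
  have "subring ?H ring_of_type_algebra"
  proof (rule subringI)
    show "\<one>\<^bsub>ring_of_type_algebra\<^esub> \<in> ?H" using id by (auto simp: ideal_power_0 coeff_1)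
    show "\<ominus>\<^bsub>ring_of_type_algebra\<^esub> h \<in> ?H" if "h \<in> ?H" for h
    proof -
      have "- 1 * poly.coeff h n \<in> ideal_power ring_of_type_algebra J n" for n using that id by blast
      then show ?thesis by simp
    qed
    show "a \<otimes>\<^bsub>ring_of_type_algebra\<^esub> b \<in> ?H" if "a \<in> ?H" "b \<in> ?H" for a b
    proof -
      have "poly.coeff (a * b) n \<in> ideal_power ring_of_type_algebra J n" for n
        unfolding coeff_mult
      proof (rule type_ring_ideal_sum[OF ideal_ideal_power])
        fix i assume "i \<in> {..n}"
        then show "poly.coeff a i * poly.coeff b (n - i) \<in> ideal_power ring_of_type_algebra J n"
          using ideal_power_mult[of "poly.coeff a i" i "poly.coeff b (n - i)" "n - i"] that by simp
      qed
      then show ?thesis by simp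
    qed
    show "a \<oplus>\<^bsub>ring_of_type_algebra\<^esub> b \<in> ?H" if "a \<in> ?H" "b \<in> ?H" for a b
      using that id by simp
  qed simp
  then show ?thesis
    using subcringI'[of ?H] subcring_iff[of ?H] by (simp add: rees_algebra_def)
qed

end

lemma mpoly_eq_Const_plus_Vars:
  fixes r :: "('v::finite, 'k::comm_ring_1) mpoly"
  shows "\<exists>c s. r = Const c + (\<Sum>i\<in>UNIV. Var i * s i)"
proof (induction r rule: mpoly_induct)
  case zero
  show ?case by (rule exI[of _ 0], rule exI[of _ "\<lambda>_. 0"]) simp
next
  case (single m c)
  show ?case
  proof (cases "m = 0")
    case True
    then show ?thesis by (intro exI[of _ c] exI[of _ "\<lambda>_. 0"]) simp
  next
    case False
    then obtain i where i: "Poly_Mapping.lookup m i \<noteq> 0" by (metis poly_mapping_eqI lookup_zero)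
    define s where "s = (\<lambda>j. if j = i then Poly_Mapping.single (m - Poly_Mapping.single i 1) c else 0)"
    have "Poly_Mapping.single i 1 + (m - Poly_Mapping.single i 1) = m"
      by (rule poly_mapping_eqI) (use i in \<open>auto simp: lookup_add lookup_minus lookup_single when_def\<close>)
    then have "Poly_Mapping.single m c = Var i * s i" by (simp add: s_def Var_def mult_single)
    also have "\<dots> = (\<Sum>j\<in>UNIV. if j = i then Var j * s j else 0)" by simp
    also have "\<dots> = (\<Sum>j\<in>UNIV. Var j * s j)" by (intro sum.cong) (auto simp: s_def)
    finally show ?thesis by (intro exI[of _ 0] exI[of _ s]) simp
  qed
next
  case (add p q)
  then obtain c s d t where "p = Const c + (\<Sum>i\<in>UNIV. Var i * s i)" "q = Const d + (\<Sum>i\<in>UNIV. Var i * t i)" by blast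
  then have "p + q = Const (c + d) + (\<Sum>i\<in>UNIV. Var i * (s i + t i))"
    by (simp add: single_add distrib_left sum.distrib)
  then show ?case by (intro exI[of _ "c + d"] exI[of _ "\<lambda>i. s i + t i"])
qed

text \<open>
  The special fiber ring is a quotient of \<open>k[T]\<close> by \<open>T\<^sub>i \<mapsto> f\<^sub>i t\<close>, because \<open>R\<close> is generated by the
  constants modulo the variables.  A homogeneous relation among the \<open>f\<^sub>i\<close> lies in the kernel, so
  that a chain of primes of length 3 in the fiber ring would lift to one above a nonzero polynomial.
\<close>

lemma analytic_spread_3_imp_independent:
  fixes f :: "3 \<Rightarrow> (3, 'k::field) mpoly"
  assumes J: "ideal J mpoly_ring" and gen: "J = genideal mpoly_ring (range f)"
    and spread: "analytic_spread J = 3" and F: "form e F" "subst f F = 0"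
  shows "F = 0"
proof (rule ccontr)
  assume "F \<noteq> 0"
  let ?R = "rees_algebra J"
  interpret R: cring ?R by (rule cring_rees_algebra[OF J])
  note simps = rees_algebra_simps[OF J]
  note id = ideal_ideal_power[OF J, unfolded type_ring_ideal_iff]
  have carr: "p \<in> carrier ?R \<longleftrightarrow> (\<forall>n. poly.coeff p n \<in> ideal_power mpoly_ring J n)" for p
    by (simp add: carrier_rees_algebra[OF J])
  have const_carr: "[:r:] \<in> carrier ?R" for r
    using id by (auto simp: carr coeff_pCons ideal_power_0[OF J] split: nat.splits)
  have monom_carr: "Polynomial.monom r n \<in> carrier ?R" if "r \<in> ideal_power mpoly_ring J n" for r n
    using id that by (auto simp: carr)
  have J1: "r \<in> ideal_power mpoly_ring J 1" if "r \<in> J" for r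
    using ideal_prod.prod[of r J 1 UNIV mpoly_ring] that by (simp add: ideal_power_Suc[OF J] ideal_power_0[OF J])
  have f_J: "f i \<in> J" for i
    using ring.genideal_self[OF ring_from_type_algebra, of "range f"] by (auto simp: gen)
  define \<nn> where "\<nn> = genideal ?R (range (\<lambda>i. [:Var i:]))"
  have "ideal \<nn> ?R" unfolding \<nn>_def by (rule R.genideal_ideal) (use const_carr in auto)
  then interpret n: ideal \<nn> ?R .
  let ?F = "?R Quot \<nn>"
  define q where "q = a_r_coset ?R \<nn>"
  interpret q: ring_hom_ring ?R ?F q unfolding q_def by (rule n.rcos_ring_hom_ring)
  have q_Var: "q [:Var i:] = \<zero>\<^bsub>?F\<^esub>" for i
  proof -
    have "[:Var i:] \<in> \<nn>" unfolding \<nn>_def using R.genideal_self[of "range (\<lambda>i. [:Var i:])"] const_carr by blast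
    then show ?thesis unfolding q_def FactRing_def using R.a_rcos_zero[OF n.is_ideal] by simp
  qed
  define E :: "(3, 'k) mpoly \<Rightarrow> (3, 'k) mpoly poly" where
    "E = mev (\<lambda>c. [:Const c:]) (\<lambda>i. Polynomial.monom (f i) 1)"
  have hom0: "comm_ring_hom (\<lambda>c::'k. [:Const c:] :: (3, 'k) mpoly poly)"
    by standard (simp_all add: single_add mult_single mult.commute)
  interpret E: comm_ring_hom E unfolding E_def by (rule comm_ring_hom_mev[OF hom0])
  have E_Const: "E (Const c) = [:Const c:]" for c unfolding E_def by (rule mev_Const[OF hom0])
  have E_Var: "E (Var i) = Polynomial.monom (f i) 1" for i unfolding E_def by (rule mev_Var[OF hom0])
  have E_carr: "E p \<in> carrier ?R" for p
  proof (induction p rule: mpoly_induct)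
    case zero
    show ?case using R.zero_closed by (simp add: simps E.hom_zero)
  next
    case (single m c)
    have pow: "x ^ n \<in> carrier ?R" if "x \<in> carrier ?R" for x n
    proof (induction n)
      case 0
      show ?case using R.one_closed by (simp add: simps)
    next
      case (Suc n)
      then show ?case using R.m_closed[OF that Suc] by (simp add: simps)
    qed
    have Vc: "E (Var i) \<in> carrier ?R" for i using monom_carr[OF J1[OF f_J]] by (simp add: E_Var)
    have mult: "x * y \<in> carrier ?R" if "x \<in> carrier ?R" "y \<in> carrier ?R" for x y
      using R.m_closed[OF that] by (simp add: simps)
    show ?case
      unfolding single_eq_Const_times_Vars[of m c] prod_3 E.hom_mult E.hom_power E_Const
      by (intro mult pow Vc const_carr)
  next
    case (add p p')
    then show ?case using R.a_closed[of "E p" "E p'"] by (simp add: simps E.hom_add)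
  qed
  define h where "h p = q (E p)" for p
  have h_add: "h (p + p') = h p \<oplus>\<^bsub>?F\<^esub> h p'" and h_mult: "h (p * p') = h p \<otimes>\<^bsub>?F\<^esub> h p'" for p p'
    unfolding h_def using q.hom_add[OF E_carr E_carr, of p p'] q.hom_mult[OF E_carr E_carr, of p p']
    by (simp_all add: simps E.hom_add E.hom_mult)
  have h: "ring_hom_ring mpoly_ring ?F h"
  proof (rule ring_hom_ringI)
    show "ring (mpoly_ring :: (3, 'k) mpoly ring)" by (rule ring_from_type_algebra)
    show "ring ?F" by (rule n.quotient_is_ring)
    show "h p \<in> carrier ?F" for p unfolding h_def by (rule q.hom_closed[OF E_carr])
    show "h \<one>\<^bsub>mpoly_ring\<^esub> = \<one>\<^bsub>?F\<^esub>" unfolding h_def using q.hom_one by (simp add: simps E.hom_one)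
  qed (simp_all add: h_add h_mult)
  \<comment> \<open>Surjectivity of \<open>h\<close>: \<open>G\<close> is closed under sums and products, and contains \<open>J\<^sup>n t\<^sup>n\<close> by induction on \<open>n\<close>.\<close>
  define G where "G = {x \<in> carrier ?R. q x \<in> range h}"
  have G_add: "x + y \<in> G" if "x \<in> G" "y \<in> G" for x y
    using that q.hom_add[of x y] R.a_closed[of x y] by (auto simp: G_def simps simp flip: h_add)
  have G_mult: "x * y \<in> G" if "x \<in> G" "y \<in> G" for x y
    using that q.hom_mult[of x y] R.m_closed[of x y] by (auto simp: G_def simps simp flip: h_mult)
  have G_E: "E p \<in> G" for p using E_carr by (auto simp: G_def h_def)
  have G_0: "0 \<in> G" using G_E[of 0] by (simp add: E.hom_zero)
  have G_sum: "(\<Sum>x\<in>I. y x) \<in> G" if "\<And>x. x \<in> I \<Longrightarrow> y x \<in> G" for I :: "'z set" and y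
    using that by (induction I rule: infinite_finite_induct) (auto intro: G_add G_0)
  have G_Var: "[:Var i:] * x \<in> G" if "x \<in> carrier ?R" for i x
  proof -
    have "q ([:Var i:] * x) = \<zero>\<^bsub>?F\<^esub>"
      using q.hom_mult[OF const_carr that, of "Var i"] q.hom_closed[OF that] by (simp add: simps q_Var)
    also have "\<dots> = h 0" unfolding h_def using q.hom_zero by (simp add: simps E.hom_zero)
    finally show ?thesis using R.m_closed[OF const_carr that] by (auto simp: G_def simps)
  qed
  have G_const: "[:r:] \<in> G" for r
  proof -
    obtain c s where r: "r = Const c + (\<Sum>i\<in>UNIV. Var i * s i)" using mpoly_eq_Const_plus_Vars[of r] by blast
    have "[:r:] = E (Const c) + [:\<Sum>i\<in>UNIV. Var i * s i:]" by (simp add: r E_Const)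
    also have "[:\<Sum>i\<in>UNIV. Var i * s i:] = (\<Sum>i\<in>UNIV. [:Var i:] * [:s i:])"
      by (simp add: sum_3)
    finally show ?thesis by (simp only:) (intro G_add G_E G_sum G_Var const_carr)
  qed
  have G_monom: "Polynomial.monom r n \<in> G" if "r \<in> ideal_power mpoly_ring J n" for r n
    using that
  proof (induction n arbitrary: r)
    case 0
    then show ?case using G_const by (simp add: monom_0)
  next
    case (Suc n)
    from Suc.prems show ?case
      unfolding ideal_power_Suc[OF J]
    proof induction
      case (prod a b)
      then obtain v where a: "a = (\<Sum>i\<in>UNIV. v i * f i)" unfolding gen genideal_range_eq by blast
      have "Polynomial.monom (a * b) (Suc n) = (\<Sum>i\<in>UNIV. [:v i:] * E (Var i)) * Polynomial.monom b n"
        by (simp add: a sum_3 E_Var mult_monom smult_monom distrib_right flip: add_monom)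
      also have "\<dots> \<in> G" using Suc.IH[OF prod(2)] by (intro G_mult G_sum G_const G_E)
      finally show ?case by simp
    next
      case (sum s1 s2)
      then show ?case using G_add by (simp flip: add_monom)
    qed
  qed
  have surj: "y \<in> range h" if y: "y \<in> carrier ?F" for y
  proof -
    obtain x where x: "x \<in> carrier ?R" "y = q x"
      using y unfolding q_def FactRing_def A_RCOSETS_def' by auto
    have "x = (\<Sum>n\<le>degree x. Polynomial.monom (poly.coeff x n) n)"
      by (simp add: poly_as_sum_of_monoms)
    also have "\<dots> \<in> G" using x(1) by (intro G_sum G_monom) (simp add: carr)
    finally show ?thesis using x by (simp add: G_def)
  qed
  have hF: "h F = \<zero>\<^bsub>?F\<^esub>"
  proof -
    have "E F = (\<Sum>m\<in>Poly_Mapping.keys F. Polynomial.monom (Const (Poly_Mapping.lookup F m) *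
        (\<Prod>i\<in>UNIV. f i ^ Poly_Mapping.lookup m i)) e)"
      unfolding E_def mev_def
    proof (rule sum.cong)
      fix m assume "m \<in> Poly_Mapping.keys F"
      then have "Poly_Mapping.lookup m 0 + Poly_Mapping.lookup m 1 + Poly_Mapping.lookup m 2 = e"
        using F(1) by (simp add: form_def mon_degree_def sum_3)
      then show "[:Const (Poly_Mapping.lookup F m):] * (\<Prod>i\<in>UNIV. Polynomial.monom (f i) 1 ^ Poly_Mapping.lookup m i) =
          Polynomial.monom (Const (Poly_Mapping.lookup F m) * (\<Prod>i\<in>UNIV. f i ^ Poly_Mapping.lookup m i)) e"
        by (simp add: prod_3 monom_power mult_monom smult_monom)
    qed simp
    also have "\<dots> = Polynomial.monom (subst f F) e"
      unfolding subst_def by (rule poly_eqI) (simp add: Polynomial.coeff_sum)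
    finally have "E F = 0" using F(2) by simp
    then show ?thesis unfolding h_def using q.hom_zero by (simp add: simps)
  qed
  have "enat 3 \<le> krull_dim ?F"
    using spread unfolding analytic_spread_def \<nn>_def by (metis numeral_eq_enat order_refl)
  then obtain P where P: "\<And>i. i \<le> 3 \<Longrightarrow> primeideal (P i) ?F" "\<And>i. i < 3 \<Longrightarrow> P i \<subset> P (Suc i)"
    by (rule enat_le_krull_dimD) auto
  define Q where "Q i = {p. h p \<in> P i}" for i
  show False
  proof (rule no_prime_chain_above_nonzero[of Q F])
    show "primeideal (Q i) mpoly_ring" if "i \<le> 3" for i
      using ring_hom_ring.primeideal_vimage[OF h cring_from_type_algebra P(1)[OF that]] by (simp add: Q_def)
    show "Q i \<subset> Q (Suc i)" if i: "i < 3" for i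
    proof -
      obtain y where y: "y \<in> P (Suc i)" "y \<notin> P i" using P(2)[OF i] by blast
      then have "y \<in> carrier ?F"
        using ideal.Icarr[OF primeideal.axioms(1)[OF P(1)[of "Suc i"]]] i by simp
      then obtain p where "y = h p" using surj by blast
      then show ?thesis using y P(2)[OF i] by (auto simp: Q_def)
    qed
    show "F \<in> Q 0"
      using hF additive_subgroup.zero_closed[OF ideal.axioms(1)[OF primeideal.axioms(1)[OF P(1)[of 0]]]]
      by (simp add: Q_def)
  qed fact
qed

section \<open>Noetherian local rings\<close>

lemma (in noetherian_ring) ideal_family_has_maximal:
  assumes "F \<noteq> {}" "\<And>I. I \<in> F \<Longrightarrow> ideal I R"
  obtains M where "M \<in> F" "\<And>I. I \<in> F \<Longrightarrow> M \<subseteq> I \<Longrightarrow> I = M"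
proof -
  have "\<exists>M\<in>F. \<forall>I\<in>F. M \<subseteq> I \<longrightarrow> I = M"
  proof (rule subset_Zorn_nonempty[OF assms(1)])
    fix C assume C: "C \<noteq> {}" "subset.chain F C"
    have CF: "C \<subseteq> F" using C(2) unfolding subset.chain_def by (rule conjunct1)
    then have "subset.chain {I. ideal I R} C"
      using assms(2) C(2) unfolding subset.chain_def by auto
    then have "\<Union>C \<in> C" by (rule ideal_chain_is_trivial[OF C(1)])
    then show "\<Union>C \<in> F" by (rule subsetD[OF CF])
  qed
  then show ?thesis using that by blast
qed

text \<open>An ideal maximal among those that avoid the powers of an element is prime.\<close>

lemma exists_prime_avoiding_element:
  assumes "cring A" "noetherian_ring A" and x: "x \<in> carrier A"
    and nil: "\<And>n::nat. x [^]\<^bsub>A\<^esub> n \<noteq> \<zero>\<^bsub>A\<^esub>"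
  obtains P where "primeideal P A" "x \<notin> P"
proof -
  interpret cring A by fact
  interpret noetherian_ring A by fact
  let ?F = "{I. ideal I A \<and> (\<forall>n::nat. x [^]\<^bsub>A\<^esub> n \<notin> I)}"
  have "{\<zero>\<^bsub>A\<^esub>} \<in> ?F" using zeroideal nil by auto
  then obtain P where P: "P \<in> ?F" and max: "\<And>I. I \<in> ?F \<Longrightarrow> P \<subseteq> I \<Longrightarrow> I = P"
    using ideal_family_has_maximal[of ?F] by blast
  then interpret P: ideal P A by blast
  have ext: "\<exists>n::nat. \<exists>p\<in>P. \<exists>r\<in>carrier A. x [^]\<^bsub>A\<^esub> n = p \<oplus>\<^bsub>A\<^esub> r \<otimes>\<^bsub>A\<^esub> a"
    if a: "a \<in> carrier A" "a \<notin> P" for a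
  proof -
    have I: "ideal (P <+>\<^bsub>A\<^esub> PIdl\<^bsub>A\<^esub> a) A"
      using add_ideals[OF P.is_ideal cgenideal_ideal[OF a(1)]] .
    have "P \<subseteq> P <+>\<^bsub>A\<^esub> PIdl\<^bsub>A\<^esub> a"
    proof
      fix p assume "p \<in> P"
      moreover have "\<zero>\<^bsub>A\<^esub> \<in> PIdl\<^bsub>A\<^esub> a"
        using additive_subgroup.zero_closed[OF ideal.axioms(1)[OF cgenideal_ideal[OF a(1)]]] .
      moreover have "p = p \<oplus>\<^bsub>A\<^esub> \<zero>\<^bsub>A\<^esub>" using P.Icarr[OF \<open>p \<in> P\<close>] by simp
      ultimately show "p \<in> P <+>\<^bsub>A\<^esub> PIdl\<^bsub>A\<^esub> a" unfolding set_add_def' by blast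
    qed
    moreover have "a \<in> P <+>\<^bsub>A\<^esub> PIdl\<^bsub>A\<^esub> a"
    proof -
      have "\<zero>\<^bsub>A\<^esub> \<in> P" using additive_subgroup.zero_closed[OF P.is_additive_subgroup] .
      moreover have "a = \<zero>\<^bsub>A\<^esub> \<oplus>\<^bsub>A\<^esub> a" using a(1) by simp
      ultimately show ?thesis unfolding set_add_def' using cgenideal_self[OF a(1)] by blast
    qed
    ultimately have "P <+>\<^bsub>A\<^esub> PIdl\<^bsub>A\<^esub> a \<notin> ?F" using max a(2) by blast
    then obtain n :: nat where "x [^]\<^bsub>A\<^esub> n \<in> P <+>\<^bsub>A\<^esub> PIdl\<^bsub>A\<^esub> a" using I by blast
    then show ?thesis unfolding set_add_def' cgenideal_def by blast
  qed
  have "primeideal P A"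
  proof (rule primeidealI[OF P.is_ideal])
    show "cring A" by fact
    show "carrier A \<noteq> P" using P nat_pow_closed[OF x, of 0] by blast
    fix a b assume ab: "a \<in> carrier A" "b \<in> carrier A" "a \<otimes>\<^bsub>A\<^esub> b \<in> P"
    show "a \<in> P \<or> b \<in> P"
    proof (rule ccontr)
      assume no: "\<not> ?thesis"
      obtain n p r where 1: "p \<in> P" "r \<in> carrier A" "x [^]\<^bsub>A\<^esub> (n::nat) = p \<oplus>\<^bsub>A\<^esub> r \<otimes>\<^bsub>A\<^esub> a"
        using ext[of a] ab no by blast
      obtain m q s where 2: "q \<in> P" "s \<in> carrier A" "x [^]\<^bsub>A\<^esub> (m::nat) = q \<oplus>\<^bsub>A\<^esub> s \<otimes>\<^bsub>A\<^esub> b"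
        using ext[of b] ab no by blast
      have pc: "p \<in> carrier A" "q \<in> carrier A" using 1(1) 2(1) P.Icarr by auto
      have "x [^]\<^bsub>A\<^esub> (n + m) = (p \<oplus>\<^bsub>A\<^esub> r \<otimes>\<^bsub>A\<^esub> a) \<otimes>\<^bsub>A\<^esub> (q \<oplus>\<^bsub>A\<^esub> s \<otimes>\<^bsub>A\<^esub> b)"
        using 1(3) 2(3) nat_pow_mult[OF x, of n m] by simp
      also have "\<dots> = (q \<oplus>\<^bsub>A\<^esub> s \<otimes>\<^bsub>A\<^esub> b) \<otimes>\<^bsub>A\<^esub> p \<oplus>\<^bsub>A\<^esub> ((r \<otimes>\<^bsub>A\<^esub> a) \<otimes>\<^bsub>A\<^esub> q \<oplus>\<^bsub>A\<^esub> (r \<otimes>\<^bsub>A\<^esub> s) \<otimes>\<^bsub>A\<^esub> (a \<otimes>\<^bsub>A\<^esub> b))"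
        using ab(1,2) 1(2) 2(2) pc by algebra
      also have "\<dots> \<in> P"
        using P.I_l_closed[OF 1(1), of "q \<oplus>\<^bsub>A\<^esub> s \<otimes>\<^bsub>A\<^esub> b"] P.I_l_closed[OF 2(1), of "r \<otimes>\<^bsub>A\<^esub> a"]
          P.I_l_closed[OF ab(3), of "r \<otimes>\<^bsub>A\<^esub> s"] ab(1,2) 1(2) 2(2) pc
        by (intro additive_subgroup.a_closed[OF P.is_additive_subgroup]) simp_all
      finally show False using P by blast
    qed
  qed
  moreover have "x \<notin> P" using P nat_pow_eone[OF x] by (metis (mono_tags, lifting) mem_Collect_eq)
  ultimately show ?thesis by (rule that)
qed

lemma ideal_le_unique_maximal:
  assumes "noetherian_ring A" "{I. maximalideal I A} = {M}" "ideal I A" "I \<noteq> carrier A"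
  shows "I \<subseteq> M"
proof -
  interpret noetherian_ring A by fact
  let ?F = "{K. ideal K A \<and> K \<noteq> carrier A \<and> I \<subseteq> K}"
  have ne: "?F \<noteq> {}" using assms(3,4) by blast
  have id: "ideal K A" if "K \<in> ?F" for K using that by simp
  obtain K where K: "K \<in> ?F" and max: "\<And>K'. K' \<in> ?F \<Longrightarrow> K \<subseteq> K' \<Longrightarrow> K' = K"
    using ideal_family_has_maximal[OF ne id] by blast
  have K': "ideal K A" "K \<noteq> carrier A" "I \<subseteq> K" using K by simp_all
  have "maximalideal K A"
  proof (rule maximalidealI[OF K'(1)])
    show "carrier A \<noteq> K" using K'(2) by simp
    show "K' = K \<or> K' = carrier A" if "ideal K' A" "K \<subseteq> K'" "K' \<subseteq> carrier A" for K'
    proof (cases "K' = carrier A")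
      case False
      have "I \<subseteq> K'" using K'(3) that(2) by simp
      then show ?thesis using max[of K'] that False by simp
    qed simp
  qed
  then have "K = M" using assms(2) by blast
  then show ?thesis using K'(3) by simp
qed

text \<open>A prime that avoids the powers of \<open>x\<close> is strictly below the maximal ideal.\<close>

lemma one_le_krull_dim_local:
  assumes "cring A" "noetherian_ring A" "{I. maximalideal I A} = {M}"
    and x: "x \<in> M" and nil: "\<And>n::nat. x [^]\<^bsub>A\<^esub> n \<noteq> \<zero>\<^bsub>A\<^esub>"
  shows "1 \<le> krull_dim A"
proof -
  interpret cring A by fact
  have M: "maximalideal M A" using assms(3) by blast
  have M': "primeideal M A" by (rule maximalideal_prime[OF M])
  have "x \<in> carrier A" using x ideal.Icarr[OF maximalideal.axioms(1)[OF M]] by blast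
  then obtain P where P: "primeideal P A" "x \<notin> P"
    using exists_prime_avoiding_element[OF assms(1,2) _ nil] by blast
  have "P \<subseteq> M"
    using ideal_le_unique_maximal[OF assms(2,3) primeideal.axioms(1)[OF P(1)]] primeideal.I_notcarr[OF P(1)] by blast
  then have "P \<subset> M" using P(2) x by blast
  then have "\<exists>Q. (\<forall>i\<le>1. primeideal (Q i) A) \<and> (\<forall>i<1. Q i \<subset> Q (Suc i))"
    using P(1) M' by (intro exI[of _ "\<lambda>i::nat. if i = 0 then P else M"]) auto
  then have "enat 1 \<le> krull_dim A" unfolding krull_dim_def by (intro Sup_upper) blast
  then show ?thesis by (simp add: one_enat_def)
qed

lemma positive_depth_imp_regular_element:
  assumes "cring A" "1 \<le> depth A M"
  obtains x where "x \<in> M" "x \<in> carrier A"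
    "\<And>b. b \<in> carrier A \<Longrightarrow> x \<otimes>\<^bsub>A\<^esub> b = \<zero>\<^bsub>A\<^esub> \<Longrightarrow> b = \<zero>\<^bsub>A\<^esub>"
proof -
  interpret cring A by fact
  have "\<exists>xs. regular_sequence A xs \<and> set xs \<subseteq> M \<and> xs \<noteq> []"
  proof (rule ccontr)
    assume "\<not> ?thesis"
    then have "depth A M \<le> 0" unfolding depth_def by (intro Sup_least) (auto simp: zero_enat_def)
    then show False using assms(2) by simp
  qed
  then obtain x xs where reg: "regular_sequence A (x # xs)" "x \<in> M"
    by (metis list.exhaust list.set_intros(1) subsetD)
  have "genideal A {} \<subseteq> {\<zero>\<^bsub>A\<^esub>}" by (rule genideal_minimal[OF zeroideal]) simp
  moreover have "\<zero>\<^bsub>A\<^esub> \<in> genideal A {}"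
    using additive_subgroup.zero_closed[OF ideal.axioms(1)[OF genideal_ideal[of "{}"]]] by simp
  ultimately have Idl: "genideal A {} = {\<zero>\<^bsub>A\<^esub>}" by blast
  show ?thesis
  proof (rule that[OF reg(2)])
    show "x \<in> carrier A" using reg(1) unfolding regular_sequence_def by simp
    show "b = \<zero>\<^bsub>A\<^esub>" if "b \<in> carrier A" "x \<otimes>\<^bsub>A\<^esub> b = \<zero>\<^bsub>A\<^esub>" for b
      using reg(1)[unfolded regular_sequence_def, THEN conjunct2, THEN conjunct1, rule_format, of 0 b] that
      by (simp add: Idl)
  qed
qed

section \<open>Localization at a prime\<close>

context
  fixes A :: "('a, 'b) ring_scheme" and P :: "'a set"
  assumes A: "cring A" and P: "primeideal P A"
begin

interpretation cring A by (rule A)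
interpretation P: primeideal P A by (rule P)

lemma complement_closed:
  assumes "s \<in> carrier A - P" "t \<in> carrier A - P"
  shows "s \<otimes>\<^bsub>A\<^esub> t \<in> carrier A - P"
  using assms P.I_prime[of s t] by auto

lemma one_complement: "\<one>\<^bsub>A\<^esub> \<in> carrier A - P"
  using P.I_notcarr P.one_imp_carrier by auto

lemma equiv_frac_rel: "equiv (carrier A \<times> (carrier A - P)) (frac_rel A P)"
proof (rule equivI)
  show "frac_rel A P \<subseteq> (carrier A \<times> (carrier A - P)) \<times> (carrier A \<times> (carrier A - P))"
    by (auto simp: frac_rel_def)
  show "refl_on (carrier A \<times> (carrier A - P)) (frac_rel A P)"
    using one_complement by (auto simp: refl_on_def frac_rel_def)
  show "sym (frac_rel A P)"
  proof (rule symI, clarify)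
    fix a s b t assume "((a, s), (b, t)) \<in> frac_rel A P"
    then have c: "a \<in> carrier A" "b \<in> carrier A" "s \<in> carrier A - P" "t \<in> carrier A - P"
      and "\<exists>u\<in>carrier A - P. u \<otimes>\<^bsub>A\<^esub> (a \<otimes>\<^bsub>A\<^esub> t) = u \<otimes>\<^bsub>A\<^esub> (b \<otimes>\<^bsub>A\<^esub> s)"
      by (auto simp: frac_rel_def)
    then have "\<exists>u\<in>carrier A - P. u \<otimes>\<^bsub>A\<^esub> (b \<otimes>\<^bsub>A\<^esub> s) = u \<otimes>\<^bsub>A\<^esub> (a \<otimes>\<^bsub>A\<^esub> t)" by metis
    then show "((b, t), (a, s)) \<in> frac_rel A P" using c unfolding frac_rel_def by blast
  qed
  show "trans (frac_rel A P)"
  proof (rule transI, clarify)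
    fix a s b t c r
    assume 1: "((a, s), (b, t)) \<in> frac_rel A P" and 2: "((b, t), (c, r)) \<in> frac_rel A P"
    obtain u where u: "u \<in> carrier A - P" "u \<otimes>\<^bsub>A\<^esub> (a \<otimes>\<^bsub>A\<^esub> t) = u \<otimes>\<^bsub>A\<^esub> (b \<otimes>\<^bsub>A\<^esub> s)"
      using 1 by (auto simp: frac_rel_def)
    obtain v where v: "v \<in> carrier A - P" "v \<otimes>\<^bsub>A\<^esub> (b \<otimes>\<^bsub>A\<^esub> r) = v \<otimes>\<^bsub>A\<^esub> (c \<otimes>\<^bsub>A\<^esub> t)"
      using 2 by (auto simp: frac_rel_def)
    have c: "a \<in> carrier A" "b \<in> carrier A" "c \<in> carrier A" "s \<in> carrier A - P" "t \<in> carrier A - P" "r \<in> carrier A - P"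
      using 1 2 by (auto simp: frac_rel_def)
    have "(t \<otimes>\<^bsub>A\<^esub> (u \<otimes>\<^bsub>A\<^esub> v)) \<otimes>\<^bsub>A\<^esub> (a \<otimes>\<^bsub>A\<^esub> r) = (v \<otimes>\<^bsub>A\<^esub> r) \<otimes>\<^bsub>A\<^esub> (u \<otimes>\<^bsub>A\<^esub> (a \<otimes>\<^bsub>A\<^esub> t))"
      using c u(1) v(1) by (simp add: m_ac)
    also have "\<dots> = (u \<otimes>\<^bsub>A\<^esub> s) \<otimes>\<^bsub>A\<^esub> (v \<otimes>\<^bsub>A\<^esub> (b \<otimes>\<^bsub>A\<^esub> r))"
      unfolding u(2) using c u(1) v(1) by (simp add: m_ac)
    also have "\<dots> = (t \<otimes>\<^bsub>A\<^esub> (u \<otimes>\<^bsub>A\<^esub> v)) \<otimes>\<^bsub>A\<^esub> (c \<otimes>\<^bsub>A\<^esub> s)"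
      unfolding v(2) using c u(1) v(1) by (simp add: m_ac)
    finally show "((a, s), (c, r)) \<in> frac_rel A P"
      using c complement_closed[OF c(5) complement_closed[OF u(1) v(1)]] by (auto simp: frac_rel_def)
  qed
qed

definition frac :: "'a \<Rightarrow> 'a \<Rightarrow> ('a \<times> 'a) set" where
  "frac a s = frac_rel A P `` {(a, s)}"

lemma frac_eq_iff:
  assumes "a \<in> carrier A" "b \<in> carrier A" "s \<in> carrier A - P" "t \<in> carrier A - P"
  shows "frac a s = frac b t \<longleftrightarrow>
    (\<exists>u\<in>carrier A - P. u \<otimes>\<^bsub>A\<^esub> (a \<otimes>\<^bsub>A\<^esub> t) = u \<otimes>\<^bsub>A\<^esub> (b \<otimes>\<^bsub>A\<^esub> s))"
  unfolding frac_def using eq_equiv_class_iff[OF equiv_frac_rel, of "(a, s)" "(b, t)"] assms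
  by (auto simp: frac_rel_def)

lemma frac_in_carrier:
  "a \<in> carrier A \<Longrightarrow> s \<in> carrier A - P \<Longrightarrow> frac a s \<in> carrier (localization A P)"
  unfolding localization_def frac_def by (simp add: quotientI)

lemma carrier_localizationE:
  assumes "x \<in> carrier (localization A P)"
  obtains a s where "a \<in> carrier A" "s \<in> carrier A - P" "x = frac a s"
proof -
  have "x \<in> (carrier A \<times> (carrier A - P)) // frac_rel A P"
    using assms by (simp add: localization_def)
  then obtain y where "y \<in> carrier A \<times> (carrier A - P)" "x = frac_rel A P `` {y}" by (rule quotientE)
  then show ?thesis using that[of "fst y" "snd y"] by (auto simp: frac_def)
qed

lemma frac_one: "\<one>\<^bsub>localization A P\<^esub> = frac \<one>\<^bsub>A\<^esub> \<one>\<^bsub>A\<^esub>"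
  and frac_zero: "\<zero>\<^bsub>localization A P\<^esub> = frac \<zero>\<^bsub>A\<^esub> \<one>\<^bsub>A\<^esub>"
  by (simp_all add: localization_def frac_def)

lemma frac_mult:
  assumes "a \<in> carrier A" "b \<in> carrier A" "s \<in> carrier A - P" "t \<in> carrier A - P"
  shows "frac a s \<otimes>\<^bsub>localization A P\<^esub> frac b t = frac (a \<otimes>\<^bsub>A\<^esub> b) (s \<otimes>\<^bsub>A\<^esub> t)"
proof -
  have indep: "frac (a' \<otimes>\<^bsub>A\<^esub> b') (s' \<otimes>\<^bsub>A\<^esub> t') = frac (a \<otimes>\<^bsub>A\<^esub> b) (s \<otimes>\<^bsub>A\<^esub> t)"
    if x: "(a', s') \<in> frac a s" and y: "(b', t') \<in> frac b t" for a' b' s' t'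
  proof -
    obtain u where u: "u \<in> carrier A - P" "u \<otimes>\<^bsub>A\<^esub> (a \<otimes>\<^bsub>A\<^esub> s') = u \<otimes>\<^bsub>A\<^esub> (a' \<otimes>\<^bsub>A\<^esub> s)"
      and c1: "a' \<in> carrier A" "s' \<in> carrier A - P"
      using x by (auto simp: frac_def frac_rel_def)
    obtain v where v: "v \<in> carrier A - P" "v \<otimes>\<^bsub>A\<^esub> (b \<otimes>\<^bsub>A\<^esub> t') = v \<otimes>\<^bsub>A\<^esub> (b' \<otimes>\<^bsub>A\<^esub> t)"
      and c2: "b' \<in> carrier A" "t' \<in> carrier A - P"
      using y by (auto simp: frac_def frac_rel_def)
    have "(u \<otimes>\<^bsub>A\<^esub> v) \<otimes>\<^bsub>A\<^esub> ((a' \<otimes>\<^bsub>A\<^esub> b') \<otimes>\<^bsub>A\<^esub> (s \<otimes>\<^bsub>A\<^esub> t)) =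
        (u \<otimes>\<^bsub>A\<^esub> (a' \<otimes>\<^bsub>A\<^esub> s)) \<otimes>\<^bsub>A\<^esub> (v \<otimes>\<^bsub>A\<^esub> (b' \<otimes>\<^bsub>A\<^esub> t))"
      using u(1) v(1) c1 c2 assms by (simp add: m_ac)
    also have "\<dots> = (u \<otimes>\<^bsub>A\<^esub> v) \<otimes>\<^bsub>A\<^esub> ((a \<otimes>\<^bsub>A\<^esub> b) \<otimes>\<^bsub>A\<^esub> (s' \<otimes>\<^bsub>A\<^esub> t'))"
      unfolding u(2)[symmetric] v(2)[symmetric] using u(1) v(1) c1 c2 assms by (simp add: m_ac)
    finally show ?thesis
      using complement_closed[OF u(1) v(1)] complement_closed[OF c1(2) c2(2)] complement_closed[OF assms(3,4)] c1 c2 assms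
      by (subst frac_eq_iff) auto
  qed
  have self: "(a, s) \<in> frac a s" "(b, t) \<in> frac b t"
    using assms equiv_class_self[OF equiv_frac_rel, of "(a, s)"] equiv_class_self[OF equiv_frac_rel, of "(b, t)"]
    unfolding frac_def by simp_all
  have "frac a s \<otimes>\<^bsub>localization A P\<^esub> frac b t =
      (\<Union>x\<in>frac a s. \<Union>y\<in>frac b t. frac (fst x \<otimes>\<^bsub>A\<^esub> fst y) (snd x \<otimes>\<^bsub>A\<^esub> snd y))"
    by (simp add: localization_def frac_def case_prod_unfold)
  also have "\<dots> = (\<Union>x\<in>frac a s. \<Union>y\<in>frac b t. frac (a \<otimes>\<^bsub>A\<^esub> b) (s \<otimes>\<^bsub>A\<^esub> t))"
    by (intro SUP_cong refl indep) simp_all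
  also have "\<dots> = frac (a \<otimes>\<^bsub>A\<^esub> b) (s \<otimes>\<^bsub>A\<^esub> t)" using self by auto
  finally show ?thesis .
qed

lemma frac_pow:
  assumes "a \<in> carrier A"
  shows "frac a \<one>\<^bsub>A\<^esub> [^]\<^bsub>localization A P\<^esub> (n::nat) = frac (a [^]\<^bsub>A\<^esub> n) \<one>\<^bsub>A\<^esub>"
  using assms one_complement by (induction n) (simp_all add: frac_one frac_mult)

lemma frac_eq_zero_iff:
  assumes "a \<in> carrier A" "s \<in> carrier A - P"
  shows "frac a s = \<zero>\<^bsub>localization A P\<^esub> \<longleftrightarrow> (\<exists>u\<in>carrier A - P. u \<otimes>\<^bsub>A\<^esub> a = \<zero>\<^bsub>A\<^esub>)"
  using assms one_complement by (auto simp: frac_zero frac_eq_iff)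

text \<open>
  An element of \<open>P\<close> that is not nilpotent in the localization forces its dimension, hence its depth, to be at
  least 1.  The numerator of a regular element of the localization is then regular up to
  multiplication by elements outside of \<open>P\<close>.
\<close>

lemma cohen_macaulay_localization_imp_regular_element:
  assumes CM: "cohen_macaulay_local (localization A P)"
    and x: "x \<in> P" "\<And>(n::nat) u. u \<in> carrier A - P \<Longrightarrow> u \<otimes>\<^bsub>A\<^esub> x [^]\<^bsub>A\<^esub> n \<noteq> \<zero>\<^bsub>A\<^esub>"
  obtains a where "a \<in> P" "\<And>v. v \<in> carrier A \<Longrightarrow> a \<otimes>\<^bsub>A\<^esub> v = \<zero>\<^bsub>A\<^esub> \<Longrightarrow> \<exists>u\<in>carrier A - P. u \<otimes>\<^bsub>A\<^esub> v = \<zero>\<^bsub>A\<^esub>"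
proof -
  let ?L = "localization A P"
  obtain M where L: "cring ?L" "noetherian_ring ?L" and M: "{I. maximalideal I ?L} = {M}" "depth ?L M = krull_dim ?L"
    using CM unfolding cohen_macaulay_local_def by blast
  interpret L: cring ?L by (rule L)
  interpret M: maximalideal M ?L using M(1) by blast
  have xc: "x \<in> carrier A" using x(1) by (rule P.Icarr)
  have fx: "frac x \<one>\<^bsub>A\<^esub> \<in> carrier ?L" using xc one_complement by (rule frac_in_carrier)
  have unit: "a \<in> P" if a: "a \<in> carrier A" "s \<in> carrier A - P" "frac a s \<in> M" for a s
  proof (rule ccontr)
    assume "a \<notin> P"
    then have a': "a \<in> carrier A - P" using a by blast
    have "frac a s \<otimes>\<^bsub>?L\<^esub> frac s a = frac (a \<otimes>\<^bsub>A\<^esub> s) (s \<otimes>\<^bsub>A\<^esub> a)" using a a' by (intro frac_mult) auto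
    also have "\<dots> = \<one>\<^bsub>?L\<^esub>"
      unfolding frac_one using complement_closed[OF a' a(2)] complement_closed[OF a(2) a'] a one_complement
      by (subst frac_eq_iff) (auto simp: m_ac intro!: bexI[of _ "\<one>\<^bsub>A\<^esub>"])
    finally have "\<one>\<^bsub>?L\<^esub> \<in> M" using M.I_r_closed[OF a(3), of "frac s a"] frac_in_carrier[of s a] a a' by simp
    then show False using M.one_imp_carrier M.I_notcarr by blast
  qed
  have "frac x \<one>\<^bsub>A\<^esub> \<in> M"
  proof -
    have "PIdl\<^bsub>?L\<^esub> (frac x \<one>\<^bsub>A\<^esub>) \<noteq> carrier ?L"
    proof
      assume "PIdl\<^bsub>?L\<^esub> (frac x \<one>\<^bsub>A\<^esub>) = carrier ?L"
      then have "\<one>\<^bsub>?L\<^esub> \<in> PIdl\<^bsub>?L\<^esub> (frac x \<one>\<^bsub>A\<^esub>)" by simp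
      then obtain y where y: "y \<in> carrier ?L" "\<one>\<^bsub>?L\<^esub> = y \<otimes>\<^bsub>?L\<^esub> frac x \<one>\<^bsub>A\<^esub>"
        unfolding cgenideal_def by blast
      from y(1) obtain b t where b: "b \<in> carrier A" "t \<in> carrier A - P" "y = frac b t" by (rule carrier_localizationE)
      have "frac \<one>\<^bsub>A\<^esub> \<one>\<^bsub>A\<^esub> = frac (b \<otimes>\<^bsub>A\<^esub> x) (t \<otimes>\<^bsub>A\<^esub> \<one>\<^bsub>A\<^esub>)"
        using y(2) b xc one_complement by (simp add: frac_one frac_mult)
      then obtain u where u: "u \<in> carrier A - P" "u \<otimes>\<^bsub>A\<^esub> t = u \<otimes>\<^bsub>A\<^esub> (b \<otimes>\<^bsub>A\<^esub> x)"
        using b xc one_complement by (subst (asm) frac_eq_iff) auto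
      have "u \<otimes>\<^bsub>A\<^esub> (b \<otimes>\<^bsub>A\<^esub> x) \<in> P" using u(1) b(1) x(1) by (intro P.I_l_closed) auto
      then show False using complement_closed[OF u(1) b(2)] u(2) by auto
    qed
    then show ?thesis
      using ideal_le_unique_maximal[OF L(2) M(1) L.cgenideal_ideal[OF fx]] L.cgenideal_self[OF fx] by blast
  qed
  moreover have "frac x \<one>\<^bsub>A\<^esub> [^]\<^bsub>?L\<^esub> n \<noteq> \<zero>\<^bsub>?L\<^esub>" for n :: nat
    using x(2) xc one_complement by (auto simp: frac_pow frac_eq_zero_iff)
  ultimately have "1 \<le> depth ?L M" using one_le_krull_dim_local[OF L M(1)] M(2) by simp
  then obtain y where y: "y \<in> M" "y \<in> carrier ?L" "\<And>b. b \<in> carrier ?L \<Longrightarrow> y \<otimes>\<^bsub>?L\<^esub> b = \<zero>\<^bsub>?L\<^esub> \<Longrightarrow> b = \<zero>\<^bsub>?L\<^esub>"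
    using positive_depth_imp_regular_element[OF L(1)] by blast
  from y(2) obtain a s where a: "a \<in> carrier A" "s \<in> carrier A - P" "y = frac a s" by (rule carrier_localizationE)
  show ?thesis
  proof (rule that)
    show "a \<in> P" using unit a y(1) by blast
    fix v assume v: "v \<in> carrier A" "a \<otimes>\<^bsub>A\<^esub> v = \<zero>\<^bsub>A\<^esub>"
    have "y \<otimes>\<^bsub>?L\<^esub> frac v \<one>\<^bsub>A\<^esub> = frac \<zero>\<^bsub>A\<^esub> (s \<otimes>\<^bsub>A\<^esub> \<one>\<^bsub>A\<^esub>)"
      using a v one_complement by (simp add: frac_mult)
    also have "\<dots> = \<zero>\<^bsub>?L\<^esub>" using a one_complement complement_closed[OF a(2) one_complement] by (auto simp: frac_eq_zero_iff)
    finally have "frac v \<one>\<^bsub>A\<^esub> = \<zero>\<^bsub>?L\<^esub>" using y(3) frac_in_carrier[OF v(1) one_complement] by blast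
    then show "\<exists>u\<in>carrier A - P. u \<otimes>\<^bsub>A\<^esub> v = \<zero>\<^bsub>A\<^esub>"
      using v(1) one_complement by (simp add: frac_eq_zero_iff)
  qed
qed

end

section \<open>Regular linear forms\<close>

definition annihilator :: "('a, 'b) ring_scheme \<Rightarrow> 'a \<Rightarrow> 'a set" where
  "annihilator A v = {r \<in> carrier A. r \<otimes>\<^bsub>A\<^esub> v = \<zero>\<^bsub>A\<^esub>}"

lemma (in cring) ideal_annihilator:
  assumes v: "v \<in> carrier R"
  shows "ideal (annihilator R v) R"
proof (rule idealI[OF ring_axioms])
  show "subgroup (annihilator R v) (add_monoid R)"
    by (rule add.subgroupI) (use v in \<open>auto simp: annihilator_def l_distr l_minus\<close>)
  show "x \<otimes> a \<in> annihilator R v" if a: "a \<in> annihilator R v" "x \<in> carrier R" for a x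
    using a v by (simp add: annihilator_def m_assoc)
  then show "a \<otimes> x \<in> annihilator R v" if a: "a \<in> annihilator R v" "x \<in> carrier R" for a x
    using a m_comm[of a x] by (auto simp: annihilator_def)
qed

lemma (in cring) maximal_annihilator_is_prime:
  assumes w: "w \<in> carrier R" "w \<noteq> \<zero>"
    and max: "\<And>v. v \<in> carrier R \<Longrightarrow> v \<noteq> \<zero> \<Longrightarrow> annihilator R w \<subseteq> annihilator R v \<Longrightarrow> annihilator R v = annihilator R w"
  shows "primeideal (annihilator R w) R"
proof (rule primeidealI[OF ideal_annihilator[OF w(1)] is_cring])
  have "\<one> \<notin> annihilator R w" using w by (simp add: annihilator_def)
  then show "carrier R \<noteq> annihilator R w" by blast
  fix a b assume ab: "a \<in> carrier R" "b \<in> carrier R" "a \<otimes> b \<in> annihilator R w"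
  show "a \<in> annihilator R w \<or> b \<in> annihilator R w"
  proof (cases "b \<otimes> w = \<zero>")
    case True
    then show ?thesis using ab by (simp add: annihilator_def)
  next
    case False
    have "annihilator R w \<subseteq> annihilator R (b \<otimes> w)"
    proof
      fix r assume r: "r \<in> annihilator R w"
      then have "r \<otimes> (b \<otimes> w) = b \<otimes> (r \<otimes> w)" using ab(2) w(1) by (simp add: annihilator_def m_lcomm)
      then show "r \<in> annihilator R (b \<otimes> w)" using r ab(2) by (simp add: annihilator_def)
    qed
    then have "annihilator R (b \<otimes> w) = annihilator R w" using max False ab(2) w(1) by simp
    moreover have "a \<in> annihilator R (b \<otimes> w)" using ab w(1) by (simp add: annihilator_def m_assoc)
    ultimately show ?thesis by simp
  qed
qed

text \<open>
  In a Noetherian ring there are only finitely many maximal annihilators: if \<open>w\<close> is a combination of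
  \<open>w\<^sub>1, \<dots>, w\<^sub>n\<close>, then the product of the annihilators of the \<open>w\<^sub>i\<close> annihilates \<open>w\<close>.  They
  cover the zero divisors.  Hence an infinite family, only finitely many members of which lie
  in the same prime, contains a nonzerodivisor.
\<close>

lemma infinite_family_contains_nonzerodivisor:
  fixes x :: "'t \<Rightarrow> 'a"
  assumes "cring A" "noetherian_ring A" and inf: "infinite (UNIV :: 't set)"
    and x: "\<And>t. x t \<in> carrier A"
    and a: "a \<in> carrier A" "\<And>v. v \<in> carrier A \<Longrightarrow> a \<otimes>\<^bsub>A\<^esub> v = \<zero>\<^bsub>A\<^esub> \<Longrightarrow> v = \<zero>\<^bsub>A\<^esub>"
    and few: "\<And>P. primeideal P A \<Longrightarrow> a \<notin> P \<Longrightarrow> finite {t. x t \<in> P}"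
  obtains t where "\<And>v. v \<in> carrier A \<Longrightarrow> x t \<otimes>\<^bsub>A\<^esub> v = \<zero>\<^bsub>A\<^esub> \<Longrightarrow> v = \<zero>\<^bsub>A\<^esub>"
proof (rule ccontr)
  assume "\<not> thesis"
  then have "\<exists>v. v \<in> carrier A \<and> x t \<otimes>\<^bsub>A\<^esub> v = \<zero>\<^bsub>A\<^esub> \<and> v \<noteq> \<zero>\<^bsub>A\<^esub>" for t
    using that by blast
  then obtain v where v: "\<And>t. v t \<in> carrier A" "\<And>t. x t \<otimes>\<^bsub>A\<^esub> v t = \<zero>\<^bsub>A\<^esub>" "\<And>t. v t \<noteq> \<zero>\<^bsub>A\<^esub>"
    by metis
  interpret cring A by fact
  interpret noetherian_ring A by fact
  define W where "W = {w \<in> carrier A. w \<noteq> \<zero>\<^bsub>A\<^esub> \<and> (\<forall>u\<in>carrier A. u \<noteq> \<zero>\<^bsub>A\<^esub> \<longrightarrow>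
    annihilator A w \<subseteq> annihilator A u \<longrightarrow> annihilator A u = annihilator A w)}"
  have prime: "primeideal (annihilator A w) A" if "w \<in> W" for w
    using that by (intro maximal_annihilator_is_prime) (auto simp: W_def)
  have cover: "\<exists>w\<in>W. x t \<in> annihilator A w" for t
  proof -
    let ?F = "annihilator A ` {u \<in> carrier A. u \<noteq> \<zero>\<^bsub>A\<^esub> \<and> annihilator A (v t) \<subseteq> annihilator A u}"
    have ne: "?F \<noteq> {}" using v(1,3)[of t] by blast
    have id: "ideal I A" if "I \<in> ?F" for I using that ideal_annihilator by blast
    obtain M where M: "M \<in> ?F" "\<And>I. I \<in> ?F \<Longrightarrow> M \<subseteq> I \<Longrightarrow> I = M"
      using ideal_family_has_maximal[OF ne id] by blast
    from M(1) obtain w where w: "w \<in> carrier A" "w \<noteq> \<zero>\<^bsub>A\<^esub>" "annihilator A (v t) \<subseteq> annihilator A w" "M = annihilator A w"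
      by blast
    have "annihilator A u = annihilator A w"
      if u: "u \<in> carrier A" "u \<noteq> \<zero>\<^bsub>A\<^esub>" "annihilator A w \<subseteq> annihilator A u" for u
    proof -
      have "annihilator A (v t) \<subseteq> annihilator A u" using w(3) u(3) by simp
      then have "annihilator A u \<in> ?F" using u(1,2) by simp
      then show ?thesis using M(2) u(3) w(4) by simp
    qed
    then have "w \<in> W" using w(1,2) by (simp add: W_def)
    moreover have "x t \<in> annihilator A w"
    proof (rule subsetD[OF w(3)])
      show "x t \<in> annihilator A (v t)" using x v(2) by (simp add: annihilator_def)
    qed
    ultimately show ?thesis by blast
  qed
  have W_carr: "W \<subseteq> carrier A" by (auto simp: W_def)
  let ?G = "(\<lambda>V. genideal A V) ` {V. finite V \<and> V \<subseteq> W}"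
  have ne: "?G \<noteq> {}" by blast
  have id: "ideal I A" if "I \<in> ?G" for I
    using that W_carr by (auto intro!: genideal_ideal)
  obtain N where N: "N \<in> ?G" "\<And>I. I \<in> ?G \<Longrightarrow> N \<subseteq> I \<Longrightarrow> I = N"
    using ideal_family_has_maximal[OF ne id] by blast
  then obtain V where V: "finite V" "V \<subseteq> W" "N = genideal A V" by blast
  have gen: "w \<in> genideal A V" if "w \<in> W" for w
  proof -
    have sub: "insert w V \<subseteq> carrier A" using that V(2) W_carr by blast
    have "genideal A V \<subseteq> genideal A (insert w V)"
      by (rule subset_Idl_subset[OF sub]) blast
    moreover have "genideal A (insert w V) \<in> ?G" using V that by simp
    ultimately have "genideal A (insert w V) = genideal A V" using N(2) V(3) by simp
    then show ?thesis using genideal_self[OF sub] by blast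
  qed
  have "\<exists>w0\<in>V. annihilator A w0 = annihilator A w" if w: "w \<in> W" for w
  proof (rule ccontr)
    assume no: "\<not> ?thesis"
    interpret p: primeideal "annihilator A w" A by (rule prime[OF w])
    have wc: "w \<in> carrier A" using w W_carr by blast
    have "\<exists>d\<in>carrier A - annihilator A w. \<forall>w0\<in>U. d \<otimes>\<^bsub>A\<^esub> w0 = \<zero>\<^bsub>A\<^esub>" if "finite U" "U \<subseteq> V" for U
      using that
    proof (induction U rule: finite_induct)
      case empty
      have "\<one>\<^bsub>A\<^esub> \<notin> annihilator A w" using p.I_notcarr p.one_imp_carrier by blast
      then show ?case by blast
    next
      case (insert w0 U)
      then obtain d where d: "d \<in> carrier A - annihilator A w" "\<And>u. u \<in> U \<Longrightarrow> d \<otimes>\<^bsub>A\<^esub> u = \<zero>\<^bsub>A\<^esub>" by blast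
      have w0: "w0 \<in> W" "w0 \<in> carrier A" using insert.prems V(2) W_carr by auto
      have "\<not> annihilator A w0 \<subseteq> annihilator A w"
      proof
        assume "annihilator A w0 \<subseteq> annihilator A w"
        then have "annihilator A w0 = annihilator A w" using w w0(1) unfolding W_def by blast
        moreover have "w0 \<in> V" using insert.prems by simp
        ultimately show False using no by blast
      qed
      then obtain c where c: "c \<in> annihilator A w0" "c \<notin> annihilator A w" by blast
      have cc: "c \<in> carrier A" "c \<otimes>\<^bsub>A\<^esub> w0 = \<zero>\<^bsub>A\<^esub>" using c(1) unfolding annihilator_def by blast+
      have dA: "d \<in> carrier A" "d \<notin> annihilator A w" using d(1) by simp_all
      have "d \<otimes>\<^bsub>A\<^esub> c \<notin> annihilator A w" using p.I_prime[OF dA(1) cc(1)] dA(2) c(2) by auto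
      moreover have "(d \<otimes>\<^bsub>A\<^esub> c) \<otimes>\<^bsub>A\<^esub> u = \<zero>\<^bsub>A\<^esub>" if u: "u \<in> insert w0 U" for u
      proof (cases "u = w0")
        case True
        then show ?thesis using d(1) cc w0(2) by (simp add: m_assoc)
      next
        case False
        then have uU: "u \<in> U" using u by blast
        then have "u \<in> carrier A" using insert.prems V(2) W_carr by blast
        then have "(d \<otimes>\<^bsub>A\<^esub> c) \<otimes>\<^bsub>A\<^esub> u = c \<otimes>\<^bsub>A\<^esub> (d \<otimes>\<^bsub>A\<^esub> u)" using d(1) cc(1) by (simp add: m_ac)
        then show ?thesis using d(2)[OF uU] cc(1) by simp
      qed
      ultimately show ?case using d(1) cc(1) by (intro bexI[of _ "d \<otimes>\<^bsub>A\<^esub> c"]) auto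
    qed
    from this[OF V(1)] obtain d where d: "d \<in> carrier A - annihilator A w" "\<And>u. u \<in> V \<Longrightarrow> d \<otimes>\<^bsub>A\<^esub> u = \<zero>\<^bsub>A\<^esub>"
      by blast
    have dc: "d \<in> carrier A" using d(1) by blast
    have "u \<in> annihilator A d" if "u \<in> V" for u
    proof -
      have "u \<in> carrier A" using that V(2) W_carr by blast
      then show ?thesis using d(2)[OF that] m_comm[OF dc, of u] unfolding annihilator_def by simp
    qed
    then have "genideal A V \<subseteq> annihilator A d"
      by (intro genideal_minimal[OF ideal_annihilator[OF dc]]) blast
    then have "w \<in> annihilator A d" using gen[OF w] by blast
    then have "w \<otimes>\<^bsub>A\<^esub> d = \<zero>\<^bsub>A\<^esub>" unfolding annihilator_def by blast
    then have "d \<otimes>\<^bsub>A\<^esub> w = \<zero>\<^bsub>A\<^esub>" by (simp only: m_comm[OF dc wc])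
    then have "d \<in> annihilator A w" using dc unfolding annihilator_def by blast
    then show False using d(1) by blast
  qed
  then have "UNIV \<subseteq> (\<Union>w\<in>V. {t. x t \<in> annihilator A w})" using cover by fastforce
  moreover have "finite {t. x t \<in> annihilator A w}" if "w \<in> V" for w
  proof (rule few[OF prime])
    show "w \<in> W" using that V(2) by blast
    then show "a \<notin> annihilator A w" using a(2)[of w] by (auto simp: annihilator_def W_def)
  qed
  ultimately have "finite (UNIV :: 't set)" using V(1) by (meson finite_UN finite_subset)
  then show False using inf by blast
qed

lemma infinite_UNIV_alg_closed_field: "infinite (UNIV :: 'k::alg_closed_field set)"
proof
  assume fin: "finite (UNIV :: 'k set)"
  define p where "p = (\<Prod>a\<in>UNIV. [:- a, 1 :: 'k:])"
  have p0: "poly p x = 0" for x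
    unfolding p_def poly_prod using fin by (intro prod_zero) auto
  have "degree (p + 1) > 0"
  proof (rule ccontr)
    assume "\<not> degree (p + 1) > 0"
    then obtain c where "p + 1 = [:c:]" using degree_0_id by (metis gr0I)
    then have "p = [:c - 1:]" by (metis add_diff_cancel_right' diff_pCons diff_zero one_pCons)
    moreover from this have "c - 1 = 0" using p0[of 0] by simp
    ultimately have "p = 0" by simp
    then show False using fin by (simp add: p_def)
  qed
  then obtain x where "poly (p + 1) x = 0" using alg_closed_imp_poly_has_root by blast
  then show False using p0 by simp
qed

text \<open>The coordinate vectors \<open>(1, t, t\<^sup>2)\<close> for three different \<open>t\<close> are linearly independent (Vandermonde).\<close>

definition moment_form :: "'k \<Rightarrow> (3, 'k::field) mpoly" where
  "moment_form t = Var 0 + Const t * Var 1 + Const (t\<^sup>2) * Var 2"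

lemma Const_inverse_cancel:
  assumes "c \<noteq> 0"
  shows "Const (inverse c) * (Const c * p) = (p :: ('v, 'k::field) mpoly)"
proof -
  have "Const (inverse c) * (Const c * p) = Const (inverse c * c) * p"
    by (simp only: mult_single mult.assoc[symmetric] add_0_right)
  then show ?thesis using assms by simp
qed

lemma three_moment_forms_generate_Vars:
  fixes P :: "(3, 'k::field) mpoly set"
  assumes P: "ideal P mpoly_ring" and rst: "r \<noteq> s" "r \<noteq> t" "s \<noteq> t"
    and mem: "moment_form r \<in> P" "moment_form s \<in> P" "moment_form t \<in> P"
  shows "Var i \<in> P"
proof -
  interpret C: comm_ring_hom "Const :: 'k \<Rightarrow> (3, 'k) mpoly" by (rule comm_ring_hom_Const)
  note diff = type_ring_ideal_diff[OF P]
  have mult: "x * y \<in> P" if "y \<in> P" for x y using P that unfolding type_ring_ideal_iff by blast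
  have unit: "y \<in> P" if y: "Const c * y \<in> P" and "c \<noteq> 0" for c y
  proof -
    show ?thesis using mult[OF y, of "Const (inverse c)"] by (simp only: Const_inverse_cancel[OF \<open>c \<noteq> 0\<close>])
  qed
  have sq: "Const (c\<^sup>2) = (Const c :: (3, 'k) mpoly)\<^sup>2" for c :: 'k by (rule C.hom_power)
  have step: "Var 1 + Const (c + d) * Var 2 \<in> P"
    if cd: "moment_form c \<in> P" "moment_form d \<in> P" "c \<noteq> d" for c d
  proof (rule unit)
    have "Const (c - d) * ((Var 1 :: (3, 'k) mpoly) + Const (c + d) * Var 2) = moment_form c - moment_form d"
      unfolding moment_form_def C.hom_minus C.hom_add sq by (simp add: algebra_simps power2_eq_square)
    also have "\<dots> \<in> P" using diff cd by blast
    finally show "Const (c - d) * (Var 1 + Const (c + d) * Var 2) \<in> P" .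
  qed (use cd(3) in simp)
  have 1: "Var 2 \<in> P"
  proof (rule unit)
    have "Const (s - t) * (Var 2 :: (3, 'k) mpoly) = (Var 1 + Const (s + r) * Var 2) - (Var 1 + Const (t + r) * Var 2)"
      unfolding C.hom_minus C.hom_add by (simp add: algebra_simps)
    also have "\<dots> \<in> P" using mem rst by (intro diff step) auto
    finally show "Const (s - t) * Var 2 \<in> P" .
  qed (use rst in simp)
  have 2: "Var 1 \<in> P"
    using diff[OF step[OF mem(1,2) rst(1)] mult[OF 1, of "Const (r + s)"]] by simp
  have "Var 0 \<in> P"
    using diff[OF diff[OF mem(1) mult[OF 1, of "Const (r\<^sup>2)"]] mult[OF 2, of "Const r"]]
    by (simp add: moment_form_def)
  then show ?thesis using 1 2 by (cases i rule: exhaust_3) simp_all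
qed

lemma lookup_0_eq_0_mem:
  fixes P :: "('v::finite, 'k::comm_ring_1) mpoly set"
  assumes P: "ideal P mpoly_ring" "\<And>i. Var i \<in> P" and a: "Poly_Mapping.lookup a 0 = 0"
  shows "a \<in> P"
proof -
  obtain c s where as: "a = Const c + (\<Sum>i\<in>UNIV. Var i * s i)" using mpoly_eq_Const_plus_Vars by blast
  have V: "Poly_Mapping.lookup (Var i * p) 0 = 0" for i and p :: "('v, 'k) mpoly"
  proof -
    have "0 \<notin> Poly_Mapping.keys (Var i * p)"
    proof
      assume "0 \<in> Poly_Mapping.keys (Var i * p)"
      then obtain m n where mn: "m \<in> Poly_Mapping.keys (Var i :: ('v, 'k) mpoly)" "0 = m + n"
        using keys_mult[of "Var i" p] by blast
      have "mon_degree m = 1" using form_Var(1)[of i] mn(1) unfolding form_def by blast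
      then show False using arg_cong[OF mn(2), of mon_degree] by (simp add: mon_degree_add)
    qed
    then show ?thesis by (simp add: in_keys_iff)
  qed
  have "c = 0" using a V by (simp add: as lookup_add lookup_sum)
  then have "a = (\<Sum>i\<in>UNIV. s i * Var i)" by (simp add: as mult.commute)
  also have "\<dots> \<in> P"
    using P unfolding type_ring_ideal_iff by (intro type_ring_ideal_sum[OF P(1)]) blast
  finally show ?thesis .
qed

text \<open>
  By induction on the degree: once the lower components of \<open>v\<close> lie in \<open>I\<close>, the component of \<open>s v\<close> in
  degree \<open>n\<close> is that of \<open>v\<close> modulo \<open>I\<close>, up to the constant term of \<open>s\<close>.
\<close>

lemma homogeneous_ideal_unit_cancel:
  fixes I :: "('v::finite, 'k::field) mpoly set"
  assumes I: "ideal I mpoly_ring" and hom: "\<And>p n. p \<in> I \<Longrightarrow> hcomp n p \<in> I"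
    and s: "Poly_Mapping.lookup s 0 \<noteq> 0" "s * v \<in> I"
  shows "v \<in> I"
proof -
  note id = I[unfolded type_ring_ideal_iff]
  obtain c where c: "hcomp 0 s = Const c" using form_0_eq_Const form_hcomp by metis
  have "c = Poly_Mapping.lookup (hcomp 0 s) 0" by (simp add: c)
  then have "c \<noteq> 0" using s(1) by (simp add: lookup_hcomp)
  have "hcomp n v \<in> I" for n
  proof (induction n rule: less_induct)
    case (less n)
    have "hcomp n (s * v) - (\<Sum>j<n. hcomp (n - j) s * hcomp j v) = Const c * hcomp n v"
      by (simp add: hcomp_mult lessThan_Suc_atMost[symmetric] c)
    moreover have "hcomp n (s * v) - (\<Sum>j<n. hcomp (n - j) s * hcomp j v) \<in> I"
    proof (rule type_ring_ideal_diff[OF I hom[OF s(2)]])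
      show "(\<Sum>j<n. hcomp (n - j) s * hcomp j v) \<in> I"
        using less id by (intro type_ring_ideal_sum[OF I]) auto
    qed
    ultimately have "Const c * hcomp n v \<in> I" by (simp only:)
    then have "Const (inverse c) * (Const c * hcomp n v) \<in> I" using id by blast
    then show ?case by (simp only: Const_inverse_cancel[OF \<open>c \<noteq> 0\<close>])
  qed
  moreover obtain N where "\<And>m. m \<in> Poly_Mapping.keys v \<Longrightarrow> mon_degree m \<le> N"
    using obtain_degree_bound by blast
  then have "v = (\<Sum>n\<le>N. hcomp n v)" by (rule mpoly_eq_sum_hcomp)
  ultimately show ?thesis using type_ring_ideal_sum[OF I, of "{..N}" "\<lambda>n. hcomp n v"] by simp
qed

text \<open>
  The Cohen-Macaulay property at the origin provides a nonzerodivisor that vanishes there.  Homogeneity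
  removes the localization, and prime avoidance over the infinite field replaces the nonzerodivisor by
  a linear one.
\<close>

lemma cohen_macaulay_quotient_imp_regular_linear_form:
  fixes I :: "(3, 'k::alg_closed_field) mpoly set"
  assumes I: "ideal I mpoly_ring" and hom: "\<And>p n. p \<in> I \<Longrightarrow> hcomp n p \<in> I"
    and I0: "\<And>p. p \<in> I \<Longrightarrow> Poly_Mapping.lookup p 0 = 0"
    and x: "\<And>n. Var i ^ n \<notin> I"
    and CM: "cohen_macaulay (mpoly_ring Quot I)"
  obtains t where "\<And>v. moment_form t * v \<in> I \<Longrightarrow> v \<in> I"
proof -
  let ?S = "mpoly_ring :: (3, 'k) mpoly ring"
  let ?A = "?S Quot I"
  interpret S: cring ?S by (rule cring_from_type_algebra)
  interpret I: ideal I ?S by (rule I)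
  have A: "cring ?A" "noetherian_ring ?A" using CM by (simp_all add: cohen_macaulay_def)
  interpret A: cring ?A by (rule A(1))
  define q where "q = a_r_coset ?S I"
  interpret q: ring_hom_ring ?S ?A q unfolding q_def by (rule I.rcos_ring_hom_ring)
  have q_closed: "q f \<in> carrier ?A" for f using q.hom_closed by simp
  have q_surj: "\<exists>f. y = q f" if "y \<in> carrier ?A" for y
    using that unfolding q_def FactRing_def A_RCOSETS_def' by auto
  have q_mult: "q f \<otimes>\<^bsub>?A\<^esub> q g = q (f * g)" for f g using q.hom_mult[of f g] by simp
  have q_eq: "q f = q g \<longleftrightarrow> f - g \<in> I" for f g
    unfolding q_def using S.quotient_eq_iff_same_a_r_cos[OF I, of f g] by (simp add: a_minus_def)
  have q_zero: "q f = \<zero>\<^bsub>?A\<^esub> \<longleftrightarrow> f \<in> I" for f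
    using q_eq[of f 0] q.hom_zero by simp
  have q_one: "\<one>\<^bsub>?A\<^esub> = q 1" using q.hom_one by simp
  have q_pow: "q f [^]\<^bsub>?A\<^esub> n = q (f ^ n)" for f and n :: nat
  proof (induction n)
    case 0
    show ?case by (simp add: q_one)
  next
    case (Suc n)
    then show ?case by (simp add: q_mult mult.commute)
  qed
  define m where "m = {f :: (3, 'k) mpoly. Poly_Mapping.lookup f 0 = 0}"
  have lookup_mult: "Poly_Mapping.lookup (f * g) 0 = Poly_Mapping.lookup f 0 * Poly_Mapping.lookup g 0" for f g :: "(3, 'k) mpoly"
  proof -
    have "Poly_Mapping.lookup (f * g) 0 = Poly_Mapping.lookup (hcomp 0 (f * g)) 0" by (simp add: lookup_hcomp)
    also have "\<dots> = Poly_Mapping.lookup (hcomp 0 f * hcomp 0 g) 0" by (simp add: hcomp_mult)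
    also have "\<dots> = Poly_Mapping.lookup (hcomp 0 f) 0 * Poly_Mapping.lookup (hcomp 0 g) 0"
    proof -
      obtain c d where "hcomp 0 f = Const c" "hcomp 0 g = Const d" using form_0_eq_Const form_hcomp by metis
      then show ?thesis by (simp add: mult_single)
    qed
    finally show ?thesis by (simp add: lookup_hcomp)
  qed
  have m: "ideal m ?S"
    by (rule type_ring_idealI) (auto simp: m_def lookup_add lookup_mult)
  define P where "P = q ` m"
  have mem_P: "q f \<in> P \<longleftrightarrow> f \<in> m" for f
  proof
    assume "q f \<in> P"
    then obtain g where "g \<in> m" "q f = q g" by (auto simp: P_def)
    then have "Poly_Mapping.lookup (f - g) 0 = 0" using I0 q_eq by blast
    then show "f \<in> m" using \<open>g \<in> m\<close> by (simp add: m_def lookup_minus)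
  qed (simp add: P_def)
  have "maximalideal P ?A"
  proof (rule maximalidealI)
    show P: "ideal P ?A" unfolding P_def q_def by (rule S.ring_ideal_imp_quot_ideal[OF I m])
    show "carrier ?A \<noteq> P" using mem_P[of 1] q_closed[of 1] by (auto simp: m_def)
    fix K assume K: "ideal K ?A" "P \<subseteq> K" "K \<subseteq> carrier ?A"
    show "K = P \<or> K = carrier ?A"
    proof (cases "K \<subseteq> P")
      case False
      then obtain y where y: "y \<in> K" "y \<notin> P" by blast
      then obtain f where f: "y = q f" using K(3) q_surj by blast
      define c where "c = Poly_Mapping.lookup f 0"
      have "c \<noteq> 0" using y f mem_P by (simp add: c_def m_def)
      have "q (Const (inverse c) * f) \<in> K"
        using ideal.I_l_closed[OF K(1) y(1) q_closed, of "Const (inverse c)"] by (simp add: f q_mult)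
      moreover have "1 - Const (inverse c) * f \<in> m"
        using \<open>c \<noteq> 0\<close> by (simp add: m_def lookup_minus lookup_Const_mult c_def)
      then have "q (1 - Const (inverse c) * f) \<in> K" using mem_P K(2) by blast
      ultimately have "q (1 - Const (inverse c) * f) \<oplus>\<^bsub>?A\<^esub> q (Const (inverse c) * f) \<in> K"
        using additive_subgroup.a_closed[OF ideal.axioms(1)[OF K(1)]] by blast
      then have "\<one>\<^bsub>?A\<^esub> \<in> K"
        using q.hom_add[of "1 - Const (inverse c) * f" "Const (inverse c) * f"] by (simp add: q_one)
      then show ?thesis using ideal.one_imp_carrier[OF K(1)] by blast
    qed (use K in blast)
  qed
  then have P: "primeideal P ?A" and CML: "cohen_macaulay_local (localization ?A P)"
    using CM A.maximalideal_prime by (simp_all add: cohen_macaulay_def)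
  have cancel: "f \<in> I" if u: "u \<in> carrier ?A - P" "u \<otimes>\<^bsub>?A\<^esub> q f = \<zero>\<^bsub>?A\<^esub>" for u f
  proof -
    obtain s where s: "u = q s" using u(1) q_surj by blast
    have "Poly_Mapping.lookup s 0 \<noteq> 0" using u(1) mem_P[of s] s by (simp add: m_def)
    moreover have "s * f \<in> I" using u(2) by (simp add: s q_mult q_zero)
    ultimately show ?thesis using homogeneous_ideal_unit_cancel[OF I, of s f] hom by blast
  qed
  have "Poly_Mapping.single i (1::nat) \<noteq> 0" by (metis mon_degree_0 mon_degree_single one_neq_zero)
  then have qx: "q (Var i) \<in> P" unfolding mem_P m_def by (simp add: Var_def lookup_single when_def)
  obtain a where a: "a \<in> P" "\<And>v. v \<in> carrier ?A \<Longrightarrow> a \<otimes>\<^bsub>?A\<^esub> v = \<zero>\<^bsub>?A\<^esub> \<Longrightarrow> \<exists>u\<in>carrier ?A - P. u \<otimes>\<^bsub>?A\<^esub> v = \<zero>\<^bsub>?A\<^esub>"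
  proof (rule cohen_macaulay_localization_imp_regular_element[OF A(1) P CML qx])
    show "u \<otimes>\<^bsub>?A\<^esub> q (Var i) [^]\<^bsub>?A\<^esub> n \<noteq> \<zero>\<^bsub>?A\<^esub>" if "u \<in> carrier ?A - P" for n :: nat and u
      using cancel[OF that, of "Var i ^ n"] x[of n] by (auto simp: q_pow)
  qed (rule that)
  obtain b where b: "a = q b" "b \<in> m" using a(1) by (auto simp: P_def)
  obtain t where t: "\<And>v. v \<in> carrier ?A \<Longrightarrow> q (moment_form t) \<otimes>\<^bsub>?A\<^esub> v = \<zero>\<^bsub>?A\<^esub> \<Longrightarrow> v = \<zero>\<^bsub>?A\<^esub>"
  proof (rule infinite_family_contains_nonzerodivisor[OF A infinite_UNIV_alg_closed_field, of "\<lambda>t. q (moment_form t)" a])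
    show "a \<in> carrier ?A" by (simp add: b q_closed)
    show "v = \<zero>\<^bsub>?A\<^esub>" if v: "v \<in> carrier ?A" "a \<otimes>\<^bsub>?A\<^esub> v = \<zero>\<^bsub>?A\<^esub>" for v
    proof -
      obtain f where f: "v = q f" using v(1) q_surj by blast
      obtain u where "u \<in> carrier ?A - P" "u \<otimes>\<^bsub>?A\<^esub> v = \<zero>\<^bsub>?A\<^esub>" using a(2)[OF v] by blast
      then show ?thesis using cancel[of u f] by (simp add: f q_zero)
    qed
    show "finite {t. q (moment_form t) \<in> Q}" if Q: "primeideal Q ?A" "a \<notin> Q" for Q
    proof (rule ccontr)
      assume "infinite {t. q (moment_form t) \<in> Q}"
      then obtain T where T: "T \<subseteq> {t. q (moment_form t) \<in> Q}" "finite T" "card T = 3"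
        using infinite_arbitrarily_large by blast
      then obtain r s t where rst: "r \<noteq> s" "r \<noteq> t" "s \<noteq> t" "T = {r, s, t}" by (auto simp: card_3_iff)
      have Q': "ideal {f. q f \<in> Q} ?S"
        using primeideal.axioms(1)[OF q.primeideal_vimage[OF S.is_cring Q(1)]] by simp
      have "b \<in> {f. q f \<in> Q}"
      proof (rule lookup_0_eq_0_mem[OF Q'])
        show "Var j \<in> {f. q f \<in> Q}" for j
          using three_moment_forms_generate_Vars[OF Q' rst(1-3)] T(1) rst(4) by simp
      qed (use b(2) in \<open>simp add: m_def\<close>)
      then show False using Q(2) b(1) by simp
    qed
  qed (rule q_closed, rule that)
  show ?thesis
  proof (rule that)
    show "v \<in> I" if "moment_form t * v \<in> I" for v
      using t[OF q_closed[of v]] that by (simp add: q_mult q_zero)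
  qed
qed

section \<open>Relations of bidegree (1,2) and the inverse map\<close>

lemma form_degree_unique: "form a p \<Longrightarrow> form b p \<Longrightarrow> p \<noteq> 0 \<Longrightarrow> a = b"
  using hcomp_form by metis

lemma ideal_prod_left_subset:
  fixes J K :: "'a::comm_ring_1 set"
  assumes "ideal J ring_of_type_algebra" "p \<in> ideal_prod ring_of_type_algebra J K"
  shows "p \<in> J"
  using assms(2)
proof induction
  case (prod i j)
  then have "j * i \<in> J" using assms(1) unfolding type_ring_ideal_iff by blast
  then show ?case by (simp add: mult.commute)
next
  case (sum s1 s2)
  then show ?case using assms(1) unfolding type_ring_ideal_iff by simp
qed

lemma subst_form_mem_ideal_power:
  fixes f :: "3 \<Rightarrow> (3, 'k::field) mpoly"
  assumes J: "ideal J mpoly_ring" and f: "\<And>i. f i \<in> J" and p: "form n p"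
  shows "subst f p \<in> ideal_power mpoly_ring J n"
  unfolding subst_def
proof (rule type_ring_ideal_sum[OF ideal_ideal_power[OF J]])
  fix m assume "m \<in> Poly_Mapping.keys p"
  then have n: "n = Poly_Mapping.lookup m 0 + Poly_Mapping.lookup m 1 + Poly_Mapping.lookup m 2"
    using p by (simp add: form_def mon_degree_def sum_3)
  have f1: "f i \<in> ideal_power mpoly_ring J 1" for i
    using ideal_prod.prod[of "f i" J 1 UNIV mpoly_ring] f[of i]
    by (simp add: ideal_power_Suc[OF J] ideal_power_0[OF J])
  have pow: "f i ^ k \<in> ideal_power mpoly_ring J k" for i k
  proof (induction k)
    case 0
    show ?case by (simp add: ideal_power_0[OF J])
  next
    case (Suc k)
    then show ?case using ideal_power_mult[OF J f1[of i] Suc] by simp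
  qed
  have "(\<Prod>i\<in>UNIV. f i ^ Poly_Mapping.lookup m i) \<in> ideal_power mpoly_ring J n"
    unfolding n prod_3 by (intro ideal_power_mult[OF J] pow)
  then show "Const (Poly_Mapping.lookup p m) * (\<Prod>i\<in>UNIV. f i ^ Poly_Mapping.lookup m i) \<in> ideal_power mpoly_ring J n"
    using ideal_ideal_power[OF J, of n] unfolding type_ring_ideal_iff by blast
qed

lemma ideal_power_2E:
  fixes f :: "'i::finite \<Rightarrow> 'a::comm_ring_1"
  assumes J: "ideal J ring_of_type_algebra" and gen: "J = genideal ring_of_type_algebra (range f)"
    and p: "p \<in> ideal_power ring_of_type_algebra J 2"
  obtains r where "p = (\<Sum>i\<in>UNIV. \<Sum>j\<in>UNIV. r i j * (f i * f j))"
proof -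
  have "p \<in> ideal_prod ring_of_type_algebra J (ideal_prod ring_of_type_algebra J UNIV)"
    using p by (simp add: numeral_2_eq_2 ideal_power_Suc[OF J] ideal_power_0[OF J])
  then have "\<exists>r. p = (\<Sum>i\<in>UNIV. \<Sum>j\<in>UNIV. r i j * (f i * f j))"
  proof induction
    case (prod a b)
    then have "b \<in> J" using ideal_prod_left_subset[OF J] by blast
    then obtain v w where "a = (\<Sum>i\<in>UNIV. v i * f i)" "b = (\<Sum>i\<in>UNIV. w i * f i)"
      using prod(1) unfolding gen genideal_range_eq by blast
    then have "a * b = (\<Sum>i\<in>UNIV. \<Sum>j\<in>UNIV. (v i * w j) * (f i * f j))"
      by (simp add: sum_product mult_ac)
    then show ?case by (intro exI[of _ "\<lambda>i j. v i * w j"]) simp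
  next
    case (sum s1 s2)
    then obtain r1 r2 where "s1 = (\<Sum>i\<in>UNIV. \<Sum>j\<in>UNIV. r1 i j * (f i * f j))"
      "s2 = (\<Sum>i\<in>UNIV. \<Sum>j\<in>UNIV. r2 i j * (f i * f j))" by blast
    then have "s1 + s2 = (\<Sum>i\<in>UNIV. \<Sum>j\<in>UNIV. (r1 i j + r2 i j) * (f i * f j))"
      by (simp add: distrib_right sum.distrib)
    then show ?case by (intro exI[of _ "\<lambda>i j. r1 i j + r2 i j"]) simp
  qed
  then show ?thesis using that by blast
qed

lemma subst_Var_id: "subst Var p = p"
proof -
  have "comm_ring_hom (\<lambda>p :: ('v::finite, 'k::comm_ring_1) mpoly. p)" by standard simp_all
  then show ?thesis using mpoly_hom_eqI[OF comm_ring_hom_subst, of "\<lambda>p. p" Var p] by simp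
qed

lemma subst_scale:
  assumes "form e p"
  shows "subst (\<lambda>i. y * h i) p = y ^ e * subst h p"
  unfolding subst_def sum_distrib_left
proof (rule sum.cong)
  fix m assume "m \<in> Poly_Mapping.keys p"
  then have "(\<Sum>i\<in>UNIV. Poly_Mapping.lookup m i) = e"
    using assms by (simp add: form_def mon_degree_def)
  then have "(\<Prod>i\<in>UNIV. (y * h i) ^ Poly_Mapping.lookup m i) = y ^ e * (\<Prod>i\<in>UNIV. h i ^ Poly_Mapping.lookup m i)"
    by (simp add: power_mult_distrib prod.distrib power_sum[symmetric])
  then show "Const (Poly_Mapping.lookup p m) * (\<Prod>i\<in>UNIV. (y * h i) ^ Poly_Mapping.lookup m i) =
      y ^ e * (Const (Poly_Mapping.lookup p m) * (\<Prod>i\<in>UNIV. h i ^ Poly_Mapping.lookup m i))"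
    by (simp add: mult.left_commute)
qed simp

locale independent_quartics = quartic_resolution J a b1 b2
  for J :: "(3, 'k::field) mpoly set" and a b1 b2 :: "3 \<Rightarrow> (3, 'k) mpoly" +
  fixes f :: "3 \<Rightarrow> (3, 'k) mpoly"
  assumes form_f: "form 4 (f i)" and ideal_J: "ideal J mpoly_ring"
    and gen: "J = genideal mpoly_ring (range f)"
    and independent: "form e F \<Longrightarrow> subst f F = 0 \<Longrightarrow> F = 0"
begin

abbreviation "J2 \<equiv> ideal_power mpoly_ring J 2"

lemma f_mem_J: "f i \<in> J"
  using ring.genideal_self[OF ring_from_type_algebra, of "range f"] by (auto simp: gen)

lemma ideal_J2: "ideal J2 mpoly_ring"
  by (rule ideal_ideal_power[OF ideal_J])

lemma J2_subset_J: "p \<in> J2 \<Longrightarrow> p \<in> J"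
  using ideal_prod_left_subset[OF ideal_J] by (simp add: numeral_2_eq_2 ideal_power_Suc[OF ideal_J])

lemma form_ff: "form 8 (f i * f j)"
  using form_mult[OF form_f[of i] form_f[of j]] by simp

lemma hcomp_J2: "p \<in> J2 \<Longrightarrow> hcomp n p \<in> J2"
proof -
  assume "p \<in> J2"
  then obtain r where p: "p = (\<Sum>i\<in>UNIV. \<Sum>j\<in>UNIV. r i j * (f i * f j))"
    by (rule ideal_power_2E[OF ideal_J gen])
  have "f i * f j \<in> J2" for i j
  proof -
    have "form 2 (Var i * Var j :: (3, 'k) mpoly)" using form_mult[OF form_Var(1) form_Var(1)] by (metis one_add_one)
    then show ?thesis
      using subst_form_mem_ideal_power[OF ideal_J f_mem_J, of 2 "Var i * Var j"] by (simp add: subst.hom_mult)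
  qed
  then have m: "s * (f i * f j) \<in> J2" for s i j using ideal_J2 unfolding type_ring_ideal_iff by blast
  have "hcomp n (s * (f i * f j)) \<in> J2" for s i j
  proof (cases "n < 8")
    case True
    then show ?thesis using hcomp_mult_form(2)[OF form_ff] ideal_J2 unfolding type_ring_ideal_iff by simp
  next
    case False
    then have "n = (n - 8) + 8" by simp
    then show ?thesis using hcomp_mult_form(1)[OF form_ff, of "n - 8" s i j] m by metis
  qed
  then show "hcomp n p \<in> J2" unfolding p hcomp_sum by (intro type_ring_ideal_sum[OF ideal_J2])
qed

lemma lookup_0_J2: "p \<in> J2 \<Longrightarrow> Poly_Mapping.lookup p 0 = 0"
proof -
  assume "p \<in> J2"
  then obtain r where p: "p = (\<Sum>i\<in>UNIV. \<Sum>j\<in>UNIV. r i j * (f i * f j))"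
    by (rule ideal_power_2E[OF ideal_J gen])
  have "hcomp 0 p = 0" unfolding p hcomp_sum using hcomp_mult_form(2)[OF form_ff, of 0] by simp
  then have "Poly_Mapping.lookup (hcomp 0 p) 0 = 0" by simp
  then show "Poly_Mapping.lookup p 0 = 0" by (simp add: lookup_hcomp)
qed

lemma form_8_J2E:
  assumes "u \<in> J2" "form 8 u"
  obtains c where "form 2 c" "u = subst f c"
proof -
  obtain r where u: "u = (\<Sum>i\<in>UNIV. \<Sum>j\<in>UNIV. r i j * (f i * f j))"
    by (rule ideal_power_2E[OF ideal_J gen assms(1)])
  have "\<exists>k. hcomp 0 (r i j) = Const k" for i j by (metis form_0_eq_Const form_hcomp)
  then obtain k where k: "\<And>i j. hcomp 0 (r i j) = Const (k i j)" by metis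
  have h: "hcomp 8 (r i j * (f i * f j)) = Const (k i j) * (f i * f j)" for i j
    using hcomp_mult_form(1)[OF form_ff, of 0 "r i j" i j] by (simp add: k)
  define c :: "(3, 'k) mpoly" where "c = (\<Sum>i\<in>UNIV. \<Sum>j\<in>UNIV. Const (k i j) * (Var i * Var j))"
  have "u = hcomp 8 u" using hcomp_form[OF assms(2), of 8] by simp
  also have "\<dots> = (\<Sum>i\<in>UNIV. \<Sum>j\<in>UNIV. Const (k i j) * (f i * f j))"
    unfolding u hcomp_sum h ..
  also have "\<dots> = subst f c"
    unfolding c_def by (simp add: subst.hom_sum subst.hom_mult)
  finally have "u = subst f c" .
  moreover have "form 2 (Var i * Var j :: (3, 'k) mpoly)" for i j
    using form_mult[OF form_Var(1) form_Var(1)] by (metis one_add_one)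
  then have "form 2 c" unfolding c_def by (intro form_sum form_Const_mult)
  ultimately show ?thesis by (rule that[rotated])
qed

text \<open>
  Counting in degree 9 against a linear form \<open>l\<close> that is regular modulo \<open>J\<^sup>2\<close>.  The products
  \<open>y f\<^sub>i f\<^sub>j\<close>, \<open>z f\<^sub>i f\<^sub>j\<close> and \<open>l m\<close> with a monomial \<open>m\<close> of degree 8 number 6 + 6 + 45 = 57 in a space of dimension 55.
  In a linear relation among them, the factor of \<open>l\<close> lies in \<open>J\<^sup>2\<close> and is a quadratic form in the \<open>f\<^sub>i\<close>.  One
  spare dimension remains, which allows one product \<open>y f\<^sub>i f\<^sub>j\<close> or \<open>z f\<^sub>i f\<^sub>j\<close> to be omitted.  Its coefficient is that
  of \<open>\<mu>\<close> in the \<open>s\<close>-th entry of \<open>c\<close> after the multiple of \<open>l = x + ty + t\<^sup>2z\<close> that cancels the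
  entry \<open>c 0\<close> has been subtracted.
\<close>

lemma exists_relation_with_zero_coefficient:
  assumes regular: "\<And>v. moment_form t * v \<in> J2 \<Longrightarrow> v \<in> J2"
    and s: "s = 1 \<or> s = 2" and \<mu>: "mon_degree \<mu> = 2"
  obtains c where "\<And>i. form 2 (c i)" "(\<Sum>i\<in>UNIV. Var i * subst f (c i)) = 0" "\<exists>i. c i \<noteq> 0"
    "Poly_Mapping.lookup (c s - Const (if s = 1 then t else t\<^sup>2) * c 0) \<mu> = 0"
proof -
  let ?M = "\<lambda>n. {m :: 3 \<Rightarrow>\<^sub>0 nat. mon_degree m = n}"
  let ?l = "moment_form t"
  define u0 :: "((3 \<Rightarrow>\<^sub>0 nat) + (3 \<Rightarrow>\<^sub>0 nat)) + (3 \<Rightarrow>\<^sub>0 nat)" where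
    "u0 = Inl (if s = 1 then Inl \<mu> else Inr \<mu>)"
  let ?U = "(?M 2 <+> ?M 2) <+> ?M 8"
  define P where "P = case_sum (case_sum (\<lambda>m. Var 1 * subst f (Poly_Mapping.single m 1))
    (\<lambda>m. Var 2 * subst f (Poly_Mapping.single m 1))) (\<lambda>m. ?l * Poly_Mapping.single m 1)"
  have form_l: "form 1 ?l"
    unfolding moment_form_def by (intro form_add form_Const_mult form_Var)
  have form_P: "form 9 (P u)" if "u \<in> ?U" for u
  proof -
    have 1: "form 9 (Var i * subst f (Poly_Mapping.single m 1))" if "mon_degree m = 2" for i m
      using form_mult[OF form_Var(1)[of i] form_subst[OF form_f form_single[of m 1]]] that by simp
    have 2: "form 9 (?l * Poly_Mapping.single m 1)" if "mon_degree m = 8" for m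
      using form_mult[OF form_l form_single[of m 1]] that by simp
    show ?thesis using that 1 2 by (auto simp: P_def)
  qed
  have fin: "finite (?M 9)" "finite ?U" by (simp_all add: finite_monomials_of_degree)
  have u0: "u0 \<in> ?U" using \<mu> by (auto simp: u0_def)
  have card: "card (?M 9) < card (?U - {u0})"
    using u0 fin by (simp add: card_monomials_of_degree card_Plus finite_monomials_of_degree)
  have keys: "Poly_Mapping.keys (P u) \<subseteq> ?M 9" if "u \<in> ?U - {u0}" for u
    using form_P[of u] that unfolding form_def by blast
  have finU: "finite (?U - {u0})" using fin by simp
  obtain v0 where v0: "\<exists>u\<in>?U - {u0}. v0 u \<noteq> 0" "(\<Sum>u\<in>?U - {u0}. Const (v0 u) * P u) = 0"
    by (rule linearly_dependent_mpolys[of "?M 9" "?U - {u0}" P])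
      ((rule fin finU card | erule keys | erule that, assumption)+)
  define v where "v = v0(u0 := 0)"
  have "(\<Sum>u\<in>?U. Const (v u) * P u) = Const (v u0) * P u0 + (\<Sum>u\<in>?U - {u0}. Const (v u) * P u)"
    by (rule sum.remove[OF fin(2) u0])
  also have "(\<Sum>u\<in>?U - {u0}. Const (v u) * P u) = (\<Sum>u\<in>?U - {u0}. Const (v0 u) * P u)"
    by (rule sum.cong) (auto simp: v_def)
  finally have sum0: "(\<Sum>u\<in>?U. Const (v u) * P u) = 0" using v0(2) by (simp add: v_def)
  have v_ne: "\<exists>u\<in>?U. v u \<noteq> 0" using v0(1) by (auto simp: v_def)
  define c1 where "c1 = (\<Sum>m\<in>?M 2. Poly_Mapping.single m (v (Inl (Inl m))))"
  define c2 where "c2 = (\<Sum>m\<in>?M 2. Poly_Mapping.single m (v (Inl (Inr m))))"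
  define u where "u = (\<Sum>m\<in>?M 8. Poly_Mapping.single m (v (Inr m)))"
  have lookup: "Poly_Mapping.lookup (\<Sum>m\<in>?M n. Poly_Mapping.single m (c m)) m = c m"
    if "mon_degree m = n" for n m and c :: "_ \<Rightarrow> 'k"
    using that finite_monomials_of_degree[of n] by (simp add: lookup_sum lookup_single when_def)
  have form_M: "form n (\<Sum>m\<in>?M n. Poly_Mapping.single m (w m))" for n and w :: "_ \<Rightarrow> 'k"
  proof (rule form_sum)
    fix m assume "m \<in> ?M n"
    then show "form n (Poly_Mapping.single m (w m))" using form_single[of m "w m"] by simp
  qed
  have forms: "form 2 c1" "form 2 c2" "form 8 u"
    unfolding c1_def c2_def u_def by (rule form_M)+
  have S: "Const c * (y * subst f (Poly_Mapping.single m 1)) = y * subst f (Poly_Mapping.single m c)" for c y m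
  proof -
    have "subst f (Poly_Mapping.single m c) = Const c * subst f (Poly_Mapping.single m 1)"
      using Const_mult_single_1[of c m] by (metis subst.hom_mult subst_Const)
    then show ?thesis by (simp only: mult.left_commute)
  qed
  have T: "Const c * (y * Poly_Mapping.single m 1) = y * Poly_Mapping.single m c" for c :: 'k and y and m :: "3 \<Rightarrow>\<^sub>0 nat"
    unfolding mult.left_commute[of "Const c" y] Const_mult_single_1 ..
  have "(\<Sum>u\<in>?U. Const (v u) * P u) =
      ((\<Sum>m\<in>?M 2. Const (v (Inl (Inl m))) * P (Inl (Inl m))) + (\<Sum>m\<in>?M 2. Const (v (Inl (Inr m))) * P (Inl (Inr m)))) +
      (\<Sum>m\<in>?M 8. Const (v (Inr m)) * P (Inr m))"
    by (simp only: sum.Plus finite_Plus finite_monomials_of_degree o_def)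
  also have "(\<Sum>m\<in>?M 2. Const (v (Inl (Inl m))) * P (Inl (Inl m))) = Var 1 * subst f c1"
    unfolding P_def sum.case c1_def subst.hom_sum sum_distrib_left S ..
  also have "(\<Sum>m\<in>?M 2. Const (v (Inl (Inr m))) * P (Inl (Inr m))) = Var 2 * subst f c2"
    unfolding P_def sum.case c2_def subst.hom_sum sum_distrib_left S ..
  also have "(\<Sum>m\<in>?M 8. Const (v (Inr m)) * P (Inr m)) = ?l * u"
    unfolding P_def sum.case u_def sum_distrib_left T ..
  finally have rel: "Var 1 * subst f c1 + Var 2 * subst f c2 + ?l * u = 0" using sum0 by simp
  have l0: "?l \<noteq> 0"
  proof
    assume "?l = 0"
    then have "?l * 1 \<in> J2" using ideal_J2 unfolding type_ring_ideal_iff by simp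
    then have "1 \<in> J2" by (rule regular)
    then show False using lookup_0_J2[of 1] by simp
  qed
  have c_ne: "c1 \<noteq> 0 \<or> c2 \<noteq> 0"
  proof (rule ccontr)
    assume "\<not> ?thesis"
    then have c0: "c1 = 0" "c2 = 0" by simp_all
    then have u0: "u = 0" using rel l0 by simp
    have "v (Inl (Inl m)) = 0" "v (Inl (Inr m)) = 0" if "mon_degree m = 2" for m
      using lookup[OF that, of "\<lambda>m. v (Inl (Inl m))"] lookup[OF that, of "\<lambda>m. v (Inl (Inr m))"] c0
      by (simp_all add: c1_def c2_def)
    moreover have "v (Inr m) = 0" if "mon_degree m = 8" for m
      using lookup[OF that, of "\<lambda>m. v (Inr m)"] u0 by (simp add: u_def)
    ultimately show False using v_ne by auto
  qed
  have "u \<in> J2"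
  proof (rule regular)
    have "Var i * subst f c' \<in> J2" if "form 2 c'" for i and c' :: "(3, 'k) mpoly"
      using subst_form_mem_ideal_power[of J f, OF ideal_J f_mem_J that] ideal_J2
      unfolding type_ring_ideal_iff by blast
    from this[OF forms(1)] this[OF forms(2)]
    have "Var 1 * subst f c1 \<in> J2" "Var 2 * subst f c2 \<in> J2" .
    moreover have "?l * u = 0 - Var 1 * subst f c1 - Var 2 * subst f c2" using rel by (simp add: algebra_simps eq_neg_iff_add_eq_0)
    moreover have "0 \<in> J2" using ideal_J2 unfolding type_ring_ideal_iff by blast
    ultimately show "?l * u \<in> J2" using type_ring_ideal_diff[OF ideal_J2] by metis
  qed
  then obtain c0 where c0: "form 2 c0" "u = subst f c0" using forms(3) by (rule form_8_J2E)
  define c where "c = (\<lambda>i::3. if i = 0 then c0 else if i = 1 then c1 + Const t * c0 else c2 + Const (t\<^sup>2) * c0)"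
  have ne: "(1::3) \<noteq> 0" "(2::3) \<noteq> 0" "(2::3) \<noteq> 1" "(1::3) \<noteq> 2" by simp_all
  have cs: "c 0 = c0" "c 1 = c1 + Const t * c0" "c 2 = c2 + Const (t\<^sup>2) * c0"
    using ne by (simp_all add: c_def)
  show ?thesis
  proof (rule that)
    show "form 2 (c i)" for i
      unfolding c_def using forms c0(1) by (auto intro: form_add form_Const_mult)
    have "(\<Sum>i\<in>UNIV. Var i * subst f (c i)) = Var 1 * subst f c1 + Var 2 * subst f c2 + ?l * u"
      unfolding sum_3 cs subst.hom_add subst.hom_mult subst_Const c0(2) moment_form_def by (simp add: algebra_simps)
    then show "(\<Sum>i\<in>UNIV. Var i * subst f (c i)) = 0" using rel by simp
    show "\<exists>i. c i \<noteq> 0"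
    proof (rule ccontr)
      assume "\<not> ?thesis"
      then have "c 0 = 0" "c 1 = 0" "c 2 = 0" by blast+
      then show False using c_ne by (simp add: cs)
    qed
    have "c s - Const (if s = 1 then t else t\<^sup>2) * c 0 = (if s = 1 then c1 else c2)"
      using s ne by (auto simp: cs)
    moreover have "Poly_Mapping.lookup (if s = 1 then c1 else c2) \<mu> = v u0"
      using lookup[OF \<mu>, of "\<lambda>m. v (Inl (Inl m))"] lookup[OF \<mu>, of "\<lambda>m. v (Inl (Inr m))"]
      by (simp add: c1_def c2_def u0_def)
    ultimately show "Poly_Mapping.lookup (c s - Const (if s = 1 then t else t\<^sup>2) * c 0) \<mu> = 0"
      by (simp add: v_def)
  qed
qed

text \<open>
  The second relation omits a product that has a nonzero coefficient in the first one.
\<close>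

lemma two_independent_relations:
  assumes regular: "\<And>v. moment_form t * v \<in> J2 \<Longrightarrow> v \<in> J2"
  obtains c c' where "\<And>i. form 2 (c i)" "(\<Sum>i\<in>UNIV. Var i * subst f (c i)) = 0" "\<exists>i. c i \<noteq> 0"
    "\<And>i. form 2 (c' i)" "(\<Sum>i\<in>UNIV. Var i * subst f (c' i)) = 0"
    "\<And>k. \<exists>i. c' i \<noteq> Const k * c i"
proof -
  let ?\<tau> = "\<lambda>s::3. if s = 1 then t else t\<^sup>2"
  obtain c where c: "\<And>i. form 2 (c i)" "(\<Sum>i\<in>UNIV. Var i * subst f (c i)) = 0" "\<exists>i. c i \<noteq> 0"
  proof (rule exists_relation_with_zero_coefficient[of t 1 "Poly_Mapping.single 0 2"])
    show "v \<in> J2" if "moment_form t * v \<in> J2" for v using that by (rule regular)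
  qed (simp, rule mon_degree_single, rule that)
  define d where "d s = c s - Const (?\<tau> s) * c 0" for s
  have form_d: "form 2 (d s)" for s unfolding d_def by (intro form_diff form_Const_mult c(1))
  have "\<exists>s. (s = 1 \<or> s = 2) \<and> d s \<noteq> 0"
  proof (rule ccontr)
    assume "\<not> ?thesis"
    then have "d 1 = 0" "d 2 = 0" by blast+
    then have cs: "c 1 = Const t * c 0" "c 2 = Const (t\<^sup>2) * c 0" by (simp_all add: d_def)
    have "moment_form t * subst f (c 0) = (\<Sum>i\<in>UNIV. Var i * subst f (c i))"
      unfolding sum_3 cs subst.hom_mult subst_Const moment_form_def by (simp add: algebra_simps)
    then have 0: "moment_form t * subst f (c 0) = 0" using c(2) by simp
    have "moment_form t \<noteq> 0"
    proof
      assume "moment_form t = 0"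
      then have "moment_form t * 1 \<in> J2" using ideal_J2 unfolding type_ring_ideal_iff by simp
      then have "1 \<in> J2" by (rule regular)
      then show False using lookup_0_J2[of 1] by simp
    qed
    then have "c 0 = 0" using 0 independent[OF c(1)] by simp
    then have "c i = 0" for i by (cases i rule: exhaust_3) (simp_all add: cs)
    then show False using c(3) by blast
  qed
  then obtain s where s: "s = 1 \<or> s = 2" "d s \<noteq> 0" by blast
  then obtain \<mu> where \<mu>: "Poly_Mapping.lookup (d s) \<mu> \<noteq> 0" by (metis lookup_zero poly_mapping_eqI)
  then have deg: "mon_degree \<mu> = 2" using form_d[of s] unfolding form_def by (simp add: in_keys_iff)
  obtain c' where c': "\<And>i. form 2 (c' i)" "(\<Sum>i\<in>UNIV. Var i * subst f (c' i)) = 0" "\<exists>i. c' i \<noteq> 0"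
      "Poly_Mapping.lookup (c' s - Const (?\<tau> s) * c' 0) \<mu> = 0"
  proof (rule exists_relation_with_zero_coefficient[of t s \<mu>])
    show "v \<in> J2" if "moment_form t * v \<in> J2" for v using that by (rule regular)
  qed (rule s(1), rule deg, rule that)
  have "\<exists>i. c' i \<noteq> Const k * c i" for k
  proof (rule ccontr)
    assume "\<not> ?thesis"
    then have k: "c' i = Const k * c i" for i by blast
    have "c' s - Const (?\<tau> s) * c' 0 = Const k * d s"
      unfolding k d_def by (simp add: algebra_simps)
    then have "k * Poly_Mapping.lookup (d s) \<mu> = 0" using c'(4) by (simp add: lookup_Const_mult)
    then have "k = 0" using \<mu> by simp
    then have "c' i = 0" for i by (simp add: k)
    then show False using c'(3) by blast
  qed
  then show ?thesis by (rule that[OF c c'(1,2)])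
qed

text \<open>
  Proportional relations have a common factor, and dividing it out leaves a relation that is
  linear or constant in the \<open>f\<^sub>i\<close>.  There is none, as \<open>J\<close> has no linear syzygies
  and the variables are linearly independent.
\<close>

lemma independent_relations_not_proportional:
  assumes c: "\<And>i. form 2 (c i)" "(\<Sum>i\<in>UNIV. Var i * subst f (c i)) = 0" "\<exists>i. c i \<noteq> 0"
    and c': "\<And>i. form 2 (c' i)" "\<And>k. \<exists>i. c' i \<noteq> Const k * c i"
  shows "\<exists>i j. c i * c' j \<noteq> c j * c' i"
proof (rule ccontr)
  assume "\<not> ?thesis"
  then have prp: "c i * c' j = c j * c' i" for i j by blast
  obtain \<alpha> \<beta> e where e: "\<And>i. c i = \<alpha> * e i" "\<And>i. c' i = \<beta> * e i"
    by (rule proportional_imp_common_factor[of c c', OF prp c(3)]) (rule that)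
  obtain i0 where i0: "c i0 \<noteq> 0" using c(3) by blast
  then have ne: "\<alpha> \<noteq> 0" "e i0 \<noteq> 0" using e(1)[of i0] by auto
  obtain d b where d: "form d \<alpha>" "form b (e i0)" "d + b = 2"
    using form_mult_imp_forms[of 2 \<alpha> "e i0"] c(1)[of i0] i0 e(1)[of i0] by metis
  have form_e: "form b (e i)" for i
  proof (cases "e i = 0")
    case False
    then have "\<alpha> * e i \<noteq> 0" using ne by simp
    then obtain d' b' where d': "form d' \<alpha>" "form b' (e i)" "d' + b' = 2"
      using form_mult_imp_forms[of 2 \<alpha> "e i"] c(1)[of i] e(1)[of i] by metis
    have "d' = d" by (rule form_degree_unique[OF d'(1) d(1) ne(1)])
    then have "b' = b" using d'(3) d(3) by linarith
    then show ?thesis using d'(2) by simp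
  qed simp
  have "\<beta> \<noteq> 0"
  proof
    assume "\<beta> = 0"
    then have "c' i = Const 0 * c i" for i by (simp add: e(2))
    then show False using c'(2)[of 0] by blast
  qed
  then have "\<beta> * e i0 \<noteq> 0" using ne by simp
  then obtain d' b' where d': "form d' \<beta>" "form b' (e i0)" "d' + b' = 2"
    using form_mult_imp_forms[of 2 \<beta> "e i0"] c'(1)[of i0] e(2)[of i0] by metis
  have "b' = b" by (rule form_degree_unique[OF d'(2) d(2) ne(2)])
  then have "d' = d" using d'(3) d(3) by linarith
  then have form_\<beta>: "form d \<beta>" using d'(1) by simp
  have "subst f \<alpha> \<noteq> 0" using independent[OF d(1)] ne(1) by blast
  moreover have "subst f \<alpha> * (\<Sum>i\<in>UNIV. Var i * subst f (e i)) = 0"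
    using c(2) by (simp add: e(1) subst.hom_mult sum_distrib_left mult.left_commute)
  ultimately have rel: "(\<Sum>i\<in>UNIV. Var i * subst f (e i)) = 0" by simp
  have "b = 2 \<or> b = 1 \<or> b = 0" using d(3) by linarith
  then have "e i0 = 0"
  proof (elim disjE)
    assume "b = 2"
    then have "d = 0" using d(3) by simp
    then obtain k l where kl: "\<alpha> = Const k" "\<beta> = Const l"
      using d(1) form_\<beta> form_0_eq_Const by metis
    then have "k \<noteq> 0" using ne(1) by auto
    then have "\<beta> = Const (l / k) * \<alpha>" by (simp add: kl mult_single)
    then have "c' i = Const (l / k) * c i" for i by (simp add: e mult.assoc)
    then show ?thesis using c'(2)[of "l / k"] by blast
  next
    assume b: "b = 1"
    have mem: "subst f (e i) \<in> J" for i
    proof -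
      have "subst f (e i) \<in> ideal_power mpoly_ring J 1"
        by (rule subst_form_mem_ideal_power[OF ideal_J f_mem_J]) (use form_e b in simp)
      then show ?thesis using ideal_prod_left_subset[OF ideal_J] by (simp add: ideal_power_Suc[OF ideal_J])
    qed
    have "form 4 (subst f (e i))" for i
      using form_subst[OF form_f form_e[of i]] b by simp
    then have "subst f (e i0) = 0" using linear_relation_of_quartics_eq_0[of "\<lambda>i. subst f (e i)", OF mem _ rel] by blast
    then show ?thesis using independent[OF form_e] by blast
  next
    assume "b = 0"
    then have "\<exists>k. e i = Const k" for i using form_e[of i] form_0_eq_Const by metis
    then obtain k where k: "\<And>i. e i = Const (k i)" by metis
    have "k i0 = 0" by (rule Var_combination_eq_0) (use rel in \<open>simp add: k\<close>)
    then show ?thesis by (simp add: k)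
  qed
  then show False using ne(2) by blast
qed

lemma common_divisor_of_f_is_unit:
  assumes "\<And>i. h dvd f i"
  shows "h dvd 1"
proof (rule common_divisor_is_unit)
  fix i
  obtain v where "a i = (\<Sum>j\<in>UNIV. v j * f j)" using a_mem_J[of i] unfolding gen genideal_range_eq by blast
  then show "h dvd a i" using assms by (auto intro!: dvd_sum dvd_mult)
qed

text \<open>
  The inverse map is the cross product \<open>g = c \<times> c'\<close> of two relations: both \<open>c(f)\<close> and \<open>c'(f)\<close> are
  orthogonal to \<open>(x,y,z)\<close>, so \<open>g(f)\<close> is proportional to it.  The other composite is then the
  identity by the algebraic independence of the \<open>f\<^sub>i\<close>.
\<close>

lemma relations_imp_birational:
  assumes c: "\<And>i. form 2 (c i)" "(\<Sum>i\<in>UNIV. Var i * subst f (c i)) = 0"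
    and c': "\<And>i. form 2 (c' i)" "(\<Sum>i\<in>UNIV. Var i * subst f (c' i)) = 0"
    and np: "\<exists>i j. c i * c' j \<noteq> c j * c' i"
  shows "birational f"
proof -
  have ne: "(1::3) \<noteq> 0" "(2::3) \<noteq> 0" "(2::3) \<noteq> 1" by simp_all
  define g :: "3 \<Rightarrow> (3, 'k) mpoly" where "g = (\<lambda>i. if i = 0 then c 1 * c' 2 - c 2 * c' 1
    else if i = 1 then c 2 * c' 0 - c 0 * c' 2 else c 0 * c' 1 - c 1 * c' 0)"
  have gs: "g 0 = c 1 * c' 2 - c 2 * c' 1" "g 1 = c 2 * c' 0 - c 0 * c' 2" "g 2 = c 0 * c' 1 - c 1 * c' 0"
    using ne by (simp_all add: g_def)
  have "form 4 (c i * c' j)" for i j using form_mult[OF c(1)[of i] c'(1)[of j]] by simp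
  then have form_g: "form 4 (g i)" for i unfolding g_def by (auto intro: form_diff)
  have g_ne: "\<exists>i. g i \<noteq> 0"
  proof (rule ccontr)
    assume "\<not> ?thesis"
    then have "g 0 = 0" "g 1 = 0" "g 2 = 0" by blast+
    then have "c 1 * c' 2 = c 2 * c' 1" "c 2 * c' 0 = c 0 * c' 2" "c 0 * c' 1 = c 1 * c' 0"
      by (simp_all add: gs)
    then have "c i * c' j = c j * c' i" for i j
      by (cases i rule: exhaust_3; cases j rule: exhaust_3) simp_all
    then show False using np by blast
  qed
  define G where "G i = subst f (g i)" for i
  have form_G: "form 16 (G i)" for i unfolding G_def using form_subst[OF form_f form_g[of i]] by simp
  obtain i0 where "g i0 \<noteq> 0" using g_ne by blast
  then have "G i0 \<noteq> 0" using independent[OF form_g[of i0]] unfolding G_def by blast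
  then have G_ne: "\<exists>i. G i \<noteq> 0" by blast
  define A where "A i = subst f (c i)" for i
  define B where "B i = subst f (c' i)" for i
  have Gs: "G 0 = A 1 * B 2 - A 2 * B 1" "G 1 = A 2 * B 0 - A 0 * B 2" "G 2 = A 0 * B 1 - A 1 * B 0"
    by (simp_all add: G_def gs A_def B_def subst.hom_minus subst.hom_mult)
  let ?x = "Var :: 3 \<Rightarrow> (3, 'k) mpoly"
  have AB: "?x 0 * A 0 + ?x 1 * A 1 + ?x 2 * A 2 = 0" "?x 0 * B 0 + ?x 1 * B 1 + ?x 2 * B 2 = 0"
    using c(2) c'(2) unfolding sum_3 A_def B_def by simp_all
  have G01: "G 0 * ?x 1 = G 1 * ?x 0"
  proof -
    have "G 0 * ?x 1 - G 1 * ?x 0 = B 2 * (?x 0 * A 0 + ?x 1 * A 1 + ?x 2 * A 2) - A 2 * (?x 0 * B 0 + ?x 1 * B 1 + ?x 2 * B 2)"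
      unfolding Gs by (simp add: algebra_simps)
    then show ?thesis unfolding AB by simp
  qed
  have G12: "G 1 * ?x 2 = G 2 * ?x 1"
  proof -
    have "G 1 * ?x 2 - G 2 * ?x 1 = B 0 * (?x 0 * A 0 + ?x 1 * A 1 + ?x 2 * A 2) - A 0 * (?x 0 * B 0 + ?x 1 * B 1 + ?x 2 * B 2)"
      unfolding Gs by (simp add: algebra_simps)
    then show ?thesis unfolding AB by simp
  qed
  have G20: "G 2 * ?x 0 = G 0 * ?x 2"
  proof -
    have "G 2 * ?x 0 - G 0 * ?x 2 = B 1 * (?x 0 * A 0 + ?x 1 * A 1 + ?x 2 * A 2) - A 1 * (?x 0 * B 0 + ?x 1 * B 1 + ?x 2 * B 2)"
      unfolding Gs by (simp add: algebra_simps)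
    then show ?thesis unfolding AB by simp
  qed
  have Gx: "G i * ?x j = G j * ?x i" for i j
    by (cases i rule: exhaust_3; cases j rule: exhaust_3) (simp_all add: G01 G12 G20)
  have Var_ne: "?x i \<noteq> 0" for i
    by (simp add: Var_def) (metis lookup_single_eq lookup_zero one_neq_zero)
  have f_ne: "f i \<noteq> 0" for i
  proof
    assume "f i = 0"
    then have "subst f (Var i) = 0" by simp
    then show False using independent[OF form_Var(1)] Var_ne by blast
  qed
  \<comment> \<open>Since \<open>G\<close> is proportional to \<open>(x,y,z)\<close>, so is \<open>f(G)\<close> to \<open>f\<close>.\<close>
  have fG: "?x 0 ^ 4 * subst G (f i) = G 0 ^ 4 * f i" for i
  proof -
    have "?x 0 ^ 4 * subst G (f i) = subst (\<lambda>j. ?x 0 * G j) (f i)" by (rule subst_scale[OF form_f, symmetric])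
    also have "(\<lambda>j. ?x 0 * G j) = (\<lambda>j. G 0 * ?x j)" using Gx[of _ 0] by (simp add: fun_eq_iff mult.commute)
    also have "subst (\<lambda>j. G 0 * ?x j) (f i) = G 0 ^ 4 * f i" unfolding subst_scale[OF form_f] subst_Var_id ..
    finally show ?thesis .
  qed
  define K where "K i = subst g (f i)" for i
  have form_K: "form 16 (K i)" for i unfolding K_def using form_subst[OF form_g form_f[of i]] by simp
  have fK: "subst f (K i) = subst G (f i)" for i unfolding K_def subst_subst G_def ..
  have Kx: "K i * ?x j = K j * ?x i" for i j
  proof -
    have "form 17 (K i * ?x j)" for i j using form_mult[OF form_K[of i] form_Var(1)[of j]] by simp
    then have form17: "form 17 (K i * ?x j - K j * ?x i)" by (intro form_diff)
    have "?x 0 ^ 4 * subst f (K i * ?x j - K j * ?x i) =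
        (?x 0 ^ 4 * subst G (f i)) * f j - (?x 0 ^ 4 * subst G (f j)) * f i"
      by (simp add: subst.hom_minus subst.hom_mult fK algebra_simps)
    also have "\<dots> = 0" unfolding fG by (simp add: mult_ac)
    finally have "subst f (K i * ?x j - K j * ?x i) = 0" using Var_ne by simp
    then show ?thesis using independent[OF form17] by simp
  qed
  have K_ne: "\<exists>i. K i \<noteq> 0"
  proof (rule ccontr)
    assume "\<not> ?thesis"
    then have "subst f (K 0) = 0" by simp
    then have "G 0 ^ 4 * f 0 = 0" using fG[of 0] unfolding fK by simp
    then have "G 0 = 0" using f_ne by simp
    then have "G j = 0" for j using Gx[of 0 j] Var_ne by simp
    then show False using G_ne by blast
  qed
  have rep: "represents_rational_map h" if "\<And>i. form n (h i)" "\<exists>i. h i \<noteq> 0" for h :: "3 \<Rightarrow> (3, 'k) mpoly" and n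
    unfolding represents_rational_map_def using that by blast
  have rep_f: "represents_rational_map f" by (rule rep[OF form_f]) (use f_ne in blast)
  have rep_g: "represents_rational_map g" by (rule rep[OF form_g g_ne])
  have rep_Var: "represents_rational_map ?x" by (rule rep[OF form_Var(1)]) (use Var_ne in blast)
  have GK: "compose_map g f = G" "compose_map f g = K"
    by (simp_all add: compose_map_def G_def K_def fun_eq_iff)
  have "same_rational_map (compose_map g f) Var"
    unfolding GK same_rational_map_def using rep[OF form_G G_ne] rep_Var Gx by simp
  moreover have "same_rational_map (compose_map f g) Var"
    unfolding GK same_rational_map_def using rep[OF form_K K_ne] rep_Var Kx by simp
  ultimately show ?thesis unfolding birational_def using rep_f rep_g by blast
qed

end

theorem proposition2p17:
  fixes J :: "(3, 'k::alg_closed_field) mpoly set"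
  assumes "ideal J mpoly_ring" and "homogeneous_ideal J"
    and "has_minimal_graded_resolution J [4, 4, 4] [6, 6]"
    and "analytic_spread J = 3"
    and "cohen_macaulay (mpoly_ring Quot ideal_power mpoly_ring J 2)"
  shows "\<forall>f :: 3 \<Rightarrow> (3, 'k) mpoly.
           (\<forall>i. form 4 (f i)) \<and> J = genideal mpoly_ring (range f) \<longrightarrow> defines_cremona_map 4 f"
proof (intro allI impI)
  fix f :: "3 \<Rightarrow> (3, 'k) mpoly"
  assume f: "(\<forall>i. form 4 (f i)) \<and> J = genideal mpoly_ring (range f)"
  then have gen: "J = genideal mpoly_ring (range f)" by blast
  obtain a b1 b2 where res: "quartic_resolution J a b1 b2"
    by (rule minimal_graded_resolution_imp_quartic_resolution[OF assms(3)])
  interpret independent_quartics J a b1 b2 f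
  proof (intro independent_quartics.intro independent_quartics_axioms.intro)
    show "quartic_resolution J a b1 b2" by (rule res)
    show "form 4 (f i)" for i using f by blast
    show "ideal J mpoly_ring" by (rule assms(1))
    show "J = genideal mpoly_ring (range f)" by (rule gen)
    show "F = 0" if "form e F" "subst f F = 0" for e F
      by (rule analytic_spread_3_imp_independent[OF assms(1) gen assms(4) that])
  qed
  obtain i where i: "\<And>n. Var i ^ n \<notin> J" using some_Var_not_nilpotent by blast
  obtain t where t: "\<And>v. moment_form t * v \<in> J2 \<Longrightarrow> v \<in> J2"
  proof (rule cohen_macaulay_quotient_imp_regular_linear_form[of J2 i])
    show "Var i ^ n \<notin> J2" for n using i J2_subset_J by blast
  qed (rule ideal_J2, erule hcomp_J2, erule lookup_0_J2, rule assms(5), rule that)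
  obtain c c' where c: "\<And>i. form 2 (c i)" "(\<Sum>i\<in>UNIV. Var i * subst f (c i)) = 0" "\<exists>i. c i \<noteq> 0"
      "\<And>i. form 2 (c' i)" "(\<Sum>i\<in>UNIV. Var i * subst f (c' i)) = 0"
      "\<And>k. \<exists>i. c' i \<noteq> Const k * c i"
  proof (rule two_independent_relations)
    show "v \<in> J2" if "moment_form t * v \<in> J2" for v using that by (rule t)
  qed (rule that)
  have "\<exists>i j. c i * c' j \<noteq> c j * c' i"
    by (rule independent_relations_not_proportional[OF c(1-4,6)])
  then have "birational f"
    by (rule relations_imp_birational[OF c(1,2,4,5)])
  then show "defines_cremona_map 4 f"
    unfolding defines_cremona_map_def using form_f common_divisor_of_f_is_unit by blast
qed

end
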